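(* (i) The antipode of an $\mathfrak h$-Hopf algebroid $A$ is unique. Moreover, the antipode $S$ of an $\mathfrak h$-Hopf algebroid $A$ satisfies $$S(A_{\alpha\beta})\subseteq A_{-\beta,-\alpha}\quad(\alpha,\beta\in\mathfrak h^* ),$$ $$S(ab)=S(b)S(a)\ (a,b\in A),\qquad \Delta\circ S=\sigma\circ(S\otimes S)\circ\Delta,\qquad S(1)=1,\qquad \varepsilon\circ S=S^{D_{\mathfrak h}}\circ\varepsilon,$$ $$S(\mu_l(f))=\mu_r(f),\qquad S(\mu_r(f))=\mu_l(f)\qquad(f\in M_{\mathfrak h^*}),$$ where $\sigma(a\otimes b)=b\otimes a$ is the flip and $S^{D_{\mathfrak h}}$ is the algebra antihomomorphism of $D_{\mathfrak h}$ defined by $S^{D_{\mathfrak h}}(f\,T_\alpha)=T_{-\alpha}\circ f=(T_{-\alpha}f)T_{-\alpha}$. (ii) Let $A$ be an $\mathfrak h$-bialgebroid generated as an algebra by a subset $X$, and let $S:A\to A$ be a ($\mathbb C$-linear) algebra antihomomorphism such that $S(\mu_l(f))=\mu_r(f)$ and $S(\mu_r(f))=\mu_l(f)$ for all $f\in M_{\mathfrak h^*}$, and such that the two identities $$m\circ(\mathrm{id}\otimes S)\circ\Delta(a)=\mu_l(\varepsilon(a)1),\qquad m\circ(S\otimes\mathrm{id})\circ\Delta(a)=\mu_r(T_\alpha(\varepsilon(a)1))\ \ (a\in A_{\alpha\beta})$$ hold for every bihomogeneous component $a$ of every element of $X$. Then $S$ is an antipode on $A$.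
   Context: $\mathfrak h$ is a finite-dimensional complex commutative Lie algebra, $M_{\mathfrak h^*}$ is the field of meromorphic functions on $\mathfrak h^*$, and $T_\alpha f(\lambda)=f(\lambda+\alpha)$ for $\alpha\in\mathfrak h^*$. An $\mathfrak h$-algebra is a complex associative unital algebra $A$, bigraded over $\mathfrak h^*$, $A=\bigoplus_{\alpha,\beta\in\mathfrak h^*}A_{\alpha\beta}$, with two algebra embeddings $\mu_l,\mu_r:M_{\mathfrak h^*}\to A_{00}$ (left and right moment maps) such that $\mu_l(f)a=a\,\mu_l(T_\alpha f)$ and $\mu_r(f)a=a\,\mu_r(T_\beta f)$ for $a\in A_{\alpha\beta}$, $f\in M_{\mathfrak h^*}$. Homomorphisms of $\mathfrak h$-algebras are algebra homomorphisms preserving the moment maps and the bigrading. The matrix tensor product $A\widetilde\otimes B$ of $\mathfrak h$-algebras has $(A\widetilde\otimes B)_{\alpha\beta}=\bigoplus_\gamma A_{\alpha\gamma}\otimes_{M_{\mathfrak h^*}}B_{\gamma\beta}$, where $\otimes_{M_{\mathfrak h^*}}$ is the tensor product over $\mathbb C$ modulo $\mu_r^A(f)a\otimes b=a\otimes\mu_l^B(f)b$; multiplication $(a\otimes b)(c\otimes d)=ac\otimes bd$; moment maps $\mu_l(f)=\mu_l^A(f)\otimes1$, $\mu_r(f)=1\otimes\mu_r^B(f)$. $D_{\mathfrak h}$ is the algebra of difference operators $\sum_i f_iT_{\beta_i}$ on $M_{\mathfrak h^*}$ ($f_i\in M_{\mathfrak h^*}$, $\beta_i\in\mathfrak h^*$);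 it is an $\mathfrak h$-algebra with $f\,T_{-\beta}\in(D_{\mathfrak h})_{\beta\beta}$ and both moment maps the natural embedding. There are canonical isomorphisms $A\simeq A\widetilde\otimes D_{\mathfrak h}\simeq D_{\mathfrak h}\widetilde\otimes A$, $x\simeq x\otimes T_{-\beta}\simeq T_{-\alpha}\otimes x$ for $x\in A_{\alpha\beta}$. An $\mathfrak h$-bialgebroid is an $\mathfrak h$-algebra $A$ with $\mathfrak h$-algebra homomorphisms $\Delta:A\to A\widetilde\otimes A$ and $\varepsilon:A\to D_{\mathfrak h}$ such that $(\Delta\otimes\mathrm{id})\circ\Delta=(\mathrm{id}\otimes\Delta)\circ\Delta$ and, under the canonical isomorphisms, $(\varepsilon\otimes\mathrm{id})\circ\Delta=(\mathrm{id}\otimes\varepsilon)\circ\Delta=\mathrm{id}$. An $\mathfrak h$-Hopf algebroid is an $\mathfrak h$-bialgebroid $A$ with a $\mathbb C$-linear map $S:A\to A$ (antipode) such that, for $a\in A$, $f\in M_{\mathfrak h^*}$, $S(\mu_r(f)a)=S(a)\mu_l(f)$, $S(a\mu_l(f))=\mu_r(f)S(a)$; $m\circ(\mathrm{id}\otimes S)\circ\Delta(a)=\mu_l(\varepsilon(a)1)$ for $a\in A$; and $m\circ(S\otimes\mathrm{id})\circ\Delta(a)=\mu_r(T_\alpha(\varepsilon(a)1))$ for $a\in A_{\alpha\beta}$. Here $m$ is multiplication and $\varepsilon(a)1\in M_{\mathfrak h^*}$ is the result of applying the difference operator $\varepsilon(a)$ to the constant function $1$. (The first two conditions make the left-hand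 sides of the last two well-defined.) *)

theory Defs
  imports
    "HOL-Complex_Analysis.Complex_Analysis"
    "HOL-Library.Poly_Mapping"
    "HOL-Algebra.Module"
begin

section \<open>Finite-dimensional complex vector spaces\<close>

text \<open>
  A type of this class plays the role of the dual space of the commutative Lie algebra; every
  finite-dimensional complex vector space (including the zero space) is such a dual.
  The norm only serves to provide the topology, which in finite dimension does not depend on it.
\<close>

class complex_fd_space = real_normed_vector +
  fixes scaleC :: "complex \<Rightarrow> 'a \<Rightarrow> 'a" (infixr "*\<^sub>C" 75)
  assumes scaleC_add_right: "c *\<^sub>C (x + y) = c *\<^sub>C x + c *\<^sub>C y"
    and scaleC_add_left: "(c + d) *\<^sub>C x = c *\<^sub>C x + d *\<^sub>C x"
    and scaleC_scaleC: "c *\<^sub>C (d *\<^sub>C x) = (c * d) *\<^sub>C x"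
    and scaleC_of_real: "complex_of_real r *\<^sub>C x = r *\<^sub>R x"
    and norm_scaleC: "norm (c *\<^sub>C x) = cmod c * norm x"
    and finite_spanning_set: "\<exists>B. finite B \<and> (\<forall>x. \<exists>c. x = (\<Sum>b\<in>B. c b *\<^sub>C b))"

section \<open>The field of meromorphic functions\<close>

text \<open>For open \<open>U\<close>: complex Frechet differentiability at every point of \<open>U\<close>.\<close>

definition holo_on :: "('v::complex_fd_space \<Rightarrow> complex) \<Rightarrow> 'v set \<Rightarrow> bool" where
  "holo_on f U \<longleftrightarrow>
     (\<forall>x\<in>U. \<exists>D. (f has_derivative D) (at x) \<and> (\<forall>c v. D (c *\<^sub>C v) = c * D v))"

text \<open>
  A meromorphic function is locally a quotient \<open>g / h\<close> of holomorphic functions, where the zero set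
  of \<open>h\<close> has empty interior.  The values where no local denominator is nonzero are irrelevant;
  they are factored out below by identifying functions that agree on a dense open set.
\<close>

definition local_quot ::
  "('v::complex_fd_space \<Rightarrow> complex) \<Rightarrow> 'v set \<Rightarrow> ('v \<Rightarrow> complex) \<Rightarrow> ('v \<Rightarrow> complex) \<Rightarrow> bool" where
  "local_quot f W g h \<longleftrightarrow> open W \<and> holo_on g W \<and> holo_on h W \<and>
     W \<subseteq> closure {z\<in>W. h z \<noteq> 0} \<and> (\<forall>z\<in>W. h z \<noteq> 0 \<longrightarrow> f z = g z / h z)"

definition is_mero :: "('v::complex_fd_space \<Rightarrow> complex) \<Rightarrow> bool" where
  "is_mero f \<longleftrightarrow> (\<forall>p. \<exists>W g h. p \<in> W \<and> local_quot f W g h)"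

definition ae_eq :: "('v::complex_fd_space \<Rightarrow> complex) \<Rightarrow> ('v \<Rightarrow> complex) \<Rightarrow> bool" where
  "ae_eq f g \<longleftrightarrow> (\<exists>U. open U \<and> closure U = UNIV \<and> (\<forall>z\<in>U. f z = g z))"

definition mero_rel :: "('v::complex_fd_space \<Rightarrow> complex) \<Rightarrow> ('v \<Rightarrow> complex) \<Rightarrow> bool" where
  "mero_rel f g \<longleftrightarrow> is_mero f \<and> is_mero g \<and> ae_eq f g"

lemma dense_open_Int:
  fixes U V W :: "'a::topological_space set"
  assumes "open U" "open V" "W \<subseteq> closure U" "W \<subseteq> closure V" "open W"
  shows "W \<subseteq> closure (U \<inter> V)"
proof -
  have "W \<inter> closure U \<subseteq> closure (W \<inter> U)" using assms(5) by (rule open_Int_closure_subset)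
  then have 1: "W \<subseteq> closure (W \<inter> U)" using assms(3) by auto
  have "(W \<inter> U) \<inter> closure V \<subseteq> closure ((W \<inter> U) \<inter> V)"
    using assms by (intro open_Int_closure_subset) auto
  then have "W \<inter> U \<subseteq> closure (U \<inter> V)"
    using assms(4) by (smt (verit) Int_assoc closure_mono inf.coboundedI1 inf.orderE inf_le2 order_trans subset_trans)
  then show ?thesis using 1 by (meson closed_closure closure_minimal order_trans)
qed

lemma closure_meets_open:
  assumes "z \<in> closure S" "open N" "z \<in> N" shows "\<exists>y. y \<in> N \<and> y \<in> S"
  using open_Int_closure_eq_empty[OF assms(2), of S] assms by blast

lemma ae_eq_refl: "ae_eq f f"
  unfolding ae_eq_def by (rule exI[of _ UNIV]) auto

lemma ae_eq_sym: "ae_eq f g \<Longrightarrow> ae_eq g f"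
  unfolding ae_eq_def by metis

lemma ae_eq_comb:
  assumes "ae_eq f f'" "ae_eq g g'" "\<And>z. f z = f' z \<Longrightarrow> g z = g' z \<Longrightarrow> k z = k' z"
  shows "ae_eq k k'"
proof -
  from assms(1) obtain U where U: "open U" "closure U = UNIV" "\<forall>z\<in>U. f z = f' z"
    unfolding ae_eq_def by auto
  from assms(2) obtain V where V: "open V" "closure V = UNIV" "\<forall>z\<in>V. g z = g' z"
    unfolding ae_eq_def by auto
  have "UNIV \<subseteq> closure (U \<inter> V)" using U V by (intro dense_open_Int) auto
  then show ?thesis unfolding ae_eq_def using U V assms(3)
    by (intro exI[of _ "U \<inter> V"]) auto
qed

lemma ae_eq_trans: "ae_eq f g \<Longrightarrow> ae_eq g h \<Longrightarrow> ae_eq f h"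
  by (rule ae_eq_comb[of f g g h]) auto

lemma holo_on_const: "holo_on (\<lambda>_. c) U"
  unfolding holo_on_def by (auto intro!: exI[of _ "\<lambda>_. 0"] derivative_eq_intros)

lemma holo_on_add: "holo_on f U \<Longrightarrow> holo_on g U \<Longrightarrow> holo_on (\<lambda>z. f z + g z) U"
  unfolding holo_on_def
proof
  fix x assume *: "\<forall>x\<in>U. \<exists>D. (f has_derivative D) (at x) \<and> (\<forall>c v. D (c *\<^sub>C v) = c * D v)"
    "\<forall>x\<in>U. \<exists>D. (g has_derivative D) (at x) \<and> (\<forall>c v. D (c *\<^sub>C v) = c * D v)" "x \<in> U"
  then obtain D E where "(f has_derivative D) (at x)" "\<forall>c v. D (c *\<^sub>C v) = c * D v"
    "(g has_derivative E) (at x)" "\<forall>c v. E (c *\<^sub>C v) = c * E v" by metis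
  then show "\<exists>D. ((\<lambda>z. f z + g z) has_derivative D) (at x) \<and> (\<forall>c v. D (c *\<^sub>C v) = c * D v)"
    by (intro exI[of _ "\<lambda>v. D v + E v"])
       (auto intro!: has_derivative_add simp: algebra_simps)
qed

lemma holo_on_mult: "holo_on f U \<Longrightarrow> holo_on g U \<Longrightarrow> holo_on (\<lambda>z. f z * g z) U"
  unfolding holo_on_def
proof
  fix x assume *: "\<forall>x\<in>U. \<exists>D. (f has_derivative D) (at x) \<and> (\<forall>c v. D (c *\<^sub>C v) = c * D v)"
    "\<forall>x\<in>U. \<exists>D. (g has_derivative D) (at x) \<and> (\<forall>c v. D (c *\<^sub>C v) = c * D v)" "x \<in> U"
  then obtain D E where "(f has_derivative D) (at x)" "\<forall>c v. D (c *\<^sub>C v) = c * D v"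
    "(g has_derivative E) (at x)" "\<forall>c v. E (c *\<^sub>C v) = c * E v" by metis
  then show "\<exists>D. ((\<lambda>z. f z * g z) has_derivative D) (at x) \<and> (\<forall>c v. D (c *\<^sub>C v) = c * D v)"
    using has_derivative_mult[of f D x UNIV g E]
    by (intro exI[of _ "\<lambda>v. f x * E v + D v * g x"]) (auto simp: algebra_simps)
qed

lemma holo_on_subset: "holo_on f U \<Longrightarrow> V \<subseteq> U \<Longrightarrow> holo_on f V"
  unfolding holo_on_def by auto

lemma holo_on_imp_continuous_on: "holo_on f U \<Longrightarrow> continuous_on U f"
  unfolding holo_on_def
  by (meson continuous_at_imp_continuous_on has_derivative_continuous)

lemma open_nonzero:
  assumes "open W" "holo_on h W" shows "open {z\<in>W. h z \<noteq> 0}"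
proof -
  have "open (W \<inter> h -` (- {0}))"
    using assms holo_on_imp_continuous_on continuous_open_preimage by blast
  also have "W \<inter> h -` (- {0}) = {z\<in>W. h z \<noteq> 0}" by auto
  finally show ?thesis .
qed

lemma is_mero_const: "is_mero (\<lambda>_. c)"
  unfolding is_mero_def local_quot_def
  by (intro allI exI[of _ UNIV] exI[of _ "\<lambda>_. c"] exI[of _ "\<lambda>_. 1"]) (auto simp: holo_on_const)

lemma local_quot_common:
  assumes "local_quot f W g h" "local_quot f' W' g' h'"
  shows "W \<inter> W' \<subseteq> closure {z\<in>W \<inter> W'. h z * h' z \<noteq> 0}"
proof -
  have "W \<inter> W' \<subseteq> closure ({z\<in>W. h z \<noteq> 0} \<inter> {z\<in>W'. h' z \<noteq> 0})"
    using assms unfolding local_quot_def by (intro dense_open_Int open_nonzero) auto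
  also have "{z\<in>W. h z \<noteq> 0} \<inter> {z\<in>W'. h' z \<noteq> 0} = {z\<in>W \<inter> W'. h z * h' z \<noteq> 0}" by auto
  finally show ?thesis .
qed

lemma is_mero_add:
  assumes "is_mero f" "is_mero f'" shows "is_mero (\<lambda>z. f z + f' z)"
  unfolding is_mero_def
proof
  fix p
  obtain W g h where 1: "p \<in> W" "local_quot f W g h" using assms unfolding is_mero_def by metis
  obtain W' g' h' where 2: "p \<in> W'" "local_quot f' W' g' h'"
    using assms unfolding is_mero_def by metis
  have "local_quot (\<lambda>z. f z + f' z) (W \<inter> W') (\<lambda>z. g z * h' z + g' z * h z) (\<lambda>z. h z * h' z)"
    using 1 2 local_quot_common[OF 1(2) 2(2)] unfolding local_quot_def
    by (intro conjI holo_on_add holo_on_mult open_Int ballI impI)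
       (auto elim: holo_on_subset simp: add_frac_eq)
  then show "\<exists>W g h. p \<in> W \<and> local_quot (\<lambda>z. f z + f' z) W g h" using 1 2 by blast
qed

lemma is_mero_mult:
  assumes "is_mero f" "is_mero f'" shows "is_mero (\<lambda>z. f z * f' z)"
  unfolding is_mero_def
proof
  fix p
  obtain W g h where 1: "p \<in> W" "local_quot f W g h" using assms unfolding is_mero_def by metis
  obtain W' g' h' where 2: "p \<in> W'" "local_quot f' W' g' h'"
    using assms unfolding is_mero_def by metis
  have "local_quot (\<lambda>z. f z * f' z) (W \<inter> W') (\<lambda>z. g z * g' z) (\<lambda>z. h z * h' z)"
    using 1 2 local_quot_common[OF 1(2) 2(2)] unfolding local_quot_def
    by (intro conjI holo_on_add holo_on_mult open_Int ballI impI)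
       (auto elim: holo_on_subset simp: add_frac_eq)
  then show "\<exists>W g h. p \<in> W \<and> local_quot (\<lambda>z. f z * f' z) W g h" using 1 2 by blast
qed

lemma is_mero_uminus: "is_mero f \<Longrightarrow> is_mero (\<lambda>z. - f z)"
  using is_mero_mult[OF is_mero_const[of "-1"], of f] by simp

lemma closure_shift:
  fixes a :: "'v::real_normed_vector"
  shows "z \<in> closure {z. z + a \<in> S} \<longleftrightarrow> z + a \<in> closure S"
proof -
  have "{z. z + a \<in> S} = (\<lambda>x. - a + x) ` S" by (auto simp: image_iff algebra_simps)
  then have "closure {z. z + a \<in> S} = (\<lambda>x. - a + x) ` closure S"
    by (simp only: closure_translation)
  then show ?thesis by (auto simp: image_iff algebra_simps intro: bexI[of _ "z + a"])
qed

lemma open_shift: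
  fixes a :: "'v::real_normed_vector"
  assumes "open S" shows "open {z. z + a \<in> S}"
proof -
  have "{z. z + a \<in> S} = (\<lambda>x. - a + x) ` S" by (auto simp: image_iff algebra_simps)
  then show ?thesis using assms open_translation by metis
qed

lemma holo_on_shift:
  assumes "holo_on f U" shows "holo_on (\<lambda>z. f (z + a)) {z. z + a \<in> U}"
  unfolding holo_on_def
proof
  fix x assume "x \<in> {z. z + a \<in> U}"
  then obtain D where D: "(f has_derivative D) (at (x + a))" "\<forall>c v. D (c *\<^sub>C v) = c * D v"
    using assms unfolding holo_on_def by auto
  have "((\<lambda>z. z + a) has_derivative (\<lambda>v. v)) (at x)" by (auto intro!: derivative_eq_intros)
  from has_derivative_compose[OF this D(1)] D(2)
  show "\<exists>D. ((\<lambda>z. f (z + a)) has_derivative D) (at x) \<and> (\<forall>c v. D (c *\<^sub>C v) = c * D v)" by auto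
qed

lemma local_quot_shift:
  assumes "local_quot f W g h"
  shows "local_quot (\<lambda>z. f (z + a)) {z. z + a \<in> W} (\<lambda>z. g (z + a)) (\<lambda>z. h (z + a))"
  unfolding local_quot_def
proof (intro conjI)
  have W: "open W" "holo_on g W" "holo_on h W" "W \<subseteq> closure {z\<in>W. h z \<noteq> 0}"
    "\<And>z. z \<in> W \<Longrightarrow> h z \<noteq> 0 \<Longrightarrow> f z = g z / h z"
    using assms unfolding local_quot_def by auto
  show "open {z. z + a \<in> W}" by (rule open_shift[OF W(1)])
  show "holo_on (\<lambda>z. g (z + a)) {z. z + a \<in> W}" by (rule holo_on_shift[OF W(2)])
  show "holo_on (\<lambda>z. h (z + a)) {z. z + a \<in> W}" by (rule holo_on_shift[OF W(3)])
  have eq: "{z \<in> {z. z + a \<in> W}. h (z + a) \<noteq> 0} = {z. z + a \<in> {z\<in>W. h z \<noteq> 0}}" by simp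
  show "{z. z + a \<in> W} \<subseteq> closure {z \<in> {z. z + a \<in> W}. h (z + a) \<noteq> 0}"
  proof
    fix z assume "z \<in> {z. z + a \<in> W}"
    then have "z + a \<in> closure {z\<in>W. h z \<noteq> 0}" using W(4) by auto
    then show "z \<in> closure {z \<in> {z. z + a \<in> W}. h (z + a) \<noteq> 0}"
      unfolding eq by (simp only: closure_shift)
  qed
  show "\<forall>z\<in>{z. z + a \<in> W}. h (z + a) \<noteq> 0 \<longrightarrow> f (z + a) = g (z + a) / h (z + a)"
    using W(5) by simp
qed

lemma is_mero_shift:
  assumes "is_mero f" shows "is_mero (\<lambda>z. f (z + a))"
  unfolding is_mero_def
proof
  fix p
  obtain W g h where 1: "p + a \<in> W" "local_quot f W g h" using assms unfolding is_mero_def by metis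
  show "\<exists>W g h. p \<in> W \<and> local_quot (\<lambda>z. f (z + a)) W g h"
    by (rule exI[of _ "{z. z + a \<in> W}"], rule exI[of _ "\<lambda>z. g (z + a)"],
        rule exI[of _ "\<lambda>z. h (z + a)"]) (simp add: 1(1) local_quot_shift[OF 1(2)])
qed

lemma ae_eq_shift:
  assumes "ae_eq f g" shows "ae_eq (\<lambda>z. f (z + a)) (\<lambda>z. g (z + a))"
proof -
  from assms obtain U where "open U" "closure U = UNIV" "\<forall>z\<in>U. f z = g z"
    unfolding ae_eq_def by auto
  then show ?thesis unfolding ae_eq_def
    by (intro exI[of _ "{z. z + a \<in> U}"]) (auto intro: open_shift closure_shift[THEN iffD2])
qed

lemma holo_on_line:
  assumes "holo_on g W" "\<And>t. t \<in> T \<Longrightarrow> q + t *\<^sub>C v \<in> W"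
  shows "(\<lambda>t. g (q + t *\<^sub>C v)) holomorphic_on T"
  unfolding holomorphic_on_def
proof
  fix t assume "t \<in> T"
  then obtain D where D: "(g has_derivative D) (at (q + t *\<^sub>C v))" "\<forall>c v. D (c *\<^sub>C v) = c * D v"
    using assms unfolding holo_on_def by meson
  have "bounded_linear (\<lambda>t. t *\<^sub>C v)"
    by (rule bounded_linear_intro[where K = "norm v"])
       (auto simp: scaleC_add_left norm_scaleC scaleC_scaleC scaleR_conv_of_real
             simp flip: scaleC_of_real)
  then have "((\<lambda>t. q + t *\<^sub>C v) has_derivative (\<lambda>s. s *\<^sub>C v)) (at t)"
    by (auto intro!: derivative_eq_intros bounded_linear_imp_has_derivative)
  from has_derivative_compose[OF this D(1)] D(2)
  have "((\<lambda>t. g (q + t *\<^sub>C v)) has_field_derivative D v) (at t)"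
    by (simp add: has_field_derivative_def mult.commute[of _ "D v"])
  then show "(\<lambda>t. g (q + t *\<^sub>C v)) field_differentiable at t within T"
    using field_differentiable_at_within field_differentiable_def by blast
qed

lemma holo_identity:
  assumes g: "holo_on g (ball p r)" and U: "open U" "q \<in> U" "U \<subseteq> ball p r" "\<forall>z\<in>U. g z = 0"
    and z: "z \<in> ball p r"
  shows "g z = 0"
proof -
  define T where "T = {t. q + t *\<^sub>C (z - q) \<in> ball p r}"
  define k where "k t = q + t *\<^sub>C (z - q)" for t
  have bl: "bounded_linear (\<lambda>t. t *\<^sub>C (z - q))"
    by (rule bounded_linear_intro[where K = "norm (z - q)"])
       (auto simp: scaleC_add_left norm_scaleC scaleC_scaleC scaleR_conv_of_real
             simp flip: scaleC_of_real)
  then have cont: "continuous_on UNIV k" unfolding k_def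
    by (intro continuous_on_add continuous_on_const linear_continuous_on)
  have openT: "open T"
    using open_vimage[OF open_ball cont] by (simp add: T_def vimage_def k_def)
  have convT: "convex T"
  proof (rule convexI)
    fix s t u v assume *: "s \<in> T" "t \<in> T" "0 \<le> u" "0 \<le> v" "u + v = (1::real)"
    have "k (u *\<^sub>R s + v *\<^sub>R t) = u *\<^sub>R k s + v *\<^sub>R k t"
    proof -
      have "u *\<^sub>R q + v *\<^sub>R q = q" using * by (simp flip: scaleR_add_left)
      moreover have "(u *\<^sub>R s + v *\<^sub>R t) *\<^sub>C (z - q) = u *\<^sub>R s *\<^sub>C (z - q) + v *\<^sub>R t *\<^sub>C (z - q)"
        by (simp add: scaleC_add_left scaleC_scaleC scaleR_conv_of_real flip: scaleC_of_real)
      ultimately show ?thesis unfolding k_def scaleR_add_right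
        by (metis (no_types, lifting) add.assoc add.left_commute)
    qed
    moreover have "u *\<^sub>R k s + v *\<^sub>R k t \<in> ball p r"
      using * by (intro convexD[OF convex_ball]) (auto simp: T_def k_def)
    ultimately show "u *\<^sub>R s + v *\<^sub>R t \<in> T" by (simp add: T_def k_def)
  qed
  have k0: "k 0 = q" "k 1 = z"
    using scaleC_of_real[of 0 "z - q"] scaleC_of_real[of 1 "z - q"] by (auto simp: k_def)
  have openV: "open (k -` U)" using open_vimage[OF U(1) cont] .
  have "g (k 1) = 0"
  proof (rule analytic_continuation_open[of "k -` U" T "\<lambda>t. g (k t)" "\<lambda>_. 0"])
    show "(\<lambda>t. g (k t)) holomorphic_on T" unfolding k_def
      by (rule holo_on_line[OF g]) (auto simp: T_def)
    show "k -` U \<noteq> {}" using k0 U(2) by auto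
    show "connected T" using convT by (rule convex_connected)
    show "k -` U \<subseteq> T" using U(3) by (auto simp: T_def k_def)
    show "1 \<in> T" using k0 z by (simp add: T_def k_def)
  qed (use openV openT U in auto)
  then show ?thesis using k0 by simp
qed

lemma zero_on_open_imp_ae_zero:
  assumes f: "is_mero f" and U: "open U" "U \<noteq> {}" "U \<subseteq> closure {z. \<exists>V. open V \<and> z \<in> V \<and> (\<forall>y\<in>V. f y = 0)}"
  shows "ae_eq f (\<lambda>_. 0)"
proof -
  define Z where "Z = {z. \<exists>V. open V \<and> z \<in> V \<and> (\<forall>y\<in>V. f y = 0)}"
  have openZ: "open Z" unfolding Z_def
    by (subst open_subopen) (blast)
  define C where "C = interior (closure Z)"
  have "closure C \<subseteq> C"
  proof
    fix p assume p: "p \<in> closure C"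
    obtain W g h where W: "p \<in> W" "local_quot f W g h" using f unfolding is_mero_def by metis
    then obtain r where r: "r > 0" "ball p r \<subseteq> W" unfolding local_quot_def
      by (meson open_contains_ball)
    have "ball p r \<inter> closure Z \<noteq> {}"
      using p r unfolding C_def
      by (metis IntI centre_in_ball closed_closure closure_minimal emptyE interior_subset subsetD)
    then have ne: "ball p r \<inter> Z \<noteq> {}" using open_Int_closure_eq_empty[OF open_ball] by blast
    then obtain q where q: "q \<in> ball p r" "q \<in> Z" by auto
    have gh: "holo_on g (ball p r)" using W r holo_on_subset unfolding local_quot_def by metis
    have "g z = 0" if "z \<in> ball p r \<inter> Z" for z
    proof (rule ccontr)
      assume nz: "g z \<noteq> 0"
      have op: "open ({y \<in> ball p r. g y \<noteq> 0} \<inter> Z)"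
        using open_nonzero[OF open_ball gh] openZ by auto
      have "z \<in> closure {z\<in>W. h z \<noteq> 0}" using that W r unfolding local_quot_def by auto
      moreover have "z \<in> {y \<in> ball p r. g y \<noteq> 0} \<inter> Z" using nz that by auto
      ultimately obtain y where
        "y \<in> {y \<in> ball p r. g y \<noteq> 0} \<inter> Z" "y \<in> {z\<in>W. h z \<noteq> 0}"
        using closure_meets_open[OF _ op] by meson
      then show False using W unfolding local_quot_def Z_def by auto
    qed
    then have g0: "g z = 0" if "z \<in> ball p r" for z
      using holo_identity[OF gh, of "ball p r \<inter> Z" q z] openZ q that by auto
    have "{z\<in>W. h z \<noteq> 0} \<inter> ball p r \<subseteq> Z"
    proof
      fix z assume z: "z \<in> {z\<in>W. h z \<noteq> 0} \<inter> ball p r"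
      have "open ({z\<in>W. h z \<noteq> 0} \<inter> ball p r)"
        using W open_nonzero unfolding local_quot_def by blast
      moreover have "\<forall>y\<in>{z\<in>W. h z \<noteq> 0} \<inter> ball p r. f y = 0"
        using g0 W unfolding local_quot_def by auto
      ultimately show "z \<in> Z" using z unfolding Z_def by blast
    qed
    moreover have "ball p r \<subseteq> closure ({z\<in>W. h z \<noteq> 0} \<inter> ball p r)"
    proof -
      have "ball p r \<inter> closure {z\<in>W. h z \<noteq> 0} \<subseteq> closure (ball p r \<inter> {z\<in>W. h z \<noteq> 0})"
        by (rule open_Int_closure_subset[OF open_ball])
      moreover have "ball p r \<subseteq> closure {z\<in>W. h z \<noteq> 0}"
        using W r unfolding local_quot_def by auto
      ultimately show ?thesis by (auto simp: Int_commute)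
    qed
    ultimately have "ball p r \<subseteq> closure Z" by (meson closure_mono order_trans)
    then show "p \<in> C" unfolding C_def using r by (meson centre_in_ball interiorI open_ball)
  qed
  then have "closed C" by (simp add: closure_subset_eq)
  moreover have "open C" unfolding C_def by simp
  moreover have "C \<noteq> {}" using U unfolding C_def Z_def[symmetric]
    by (metis interior_maximal subset_empty)
  ultimately have "C = UNIV" using connected_UNIV clopen by blast
  then have "closure Z = UNIV" unfolding C_def by (metis interior_subset top.extremum_uniqueI)
  moreover have "\<forall>z\<in>Z. f z = 0" unfolding Z_def by auto
  ultimately show ?thesis unfolding ae_eq_def using openZ by blast
qed

lemma is_mero_inverse:
  assumes f: "is_mero f" shows "is_mero (\<lambda>z. inverse (f z))"
proof (cases "ae_eq f (\<lambda>_. 0)")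
  case True
  then obtain U where U: "open U" "closure U = UNIV" "\<forall>z\<in>U. f z = 0" unfolding ae_eq_def by auto
  show ?thesis unfolding is_mero_def
  proof
    fix p
    obtain W g h where W: "p \<in> W" "local_quot f W g h" using f unfolding is_mero_def by metis
    have "g z = 0" if "z \<in> W" for z
    proof (rule ccontr)
      assume nz: "g z \<noteq> 0"
      have 1: "W \<subseteq> closure ({z\<in>W. h z \<noteq> 0} \<inter> U)"
        using W U unfolding local_quot_def by (intro dense_open_Int open_nonzero) auto
      have "open {z\<in>W. g z \<noteq> 0}" using W open_nonzero unfolding local_quot_def by blast
      moreover have "z \<in> {z\<in>W. g z \<noteq> 0}" using nz that by auto
      moreover have "z \<in> closure ({z\<in>W. h z \<noteq> 0} \<inter> U)" using 1 that by auto
      ultimately obtain y where "y \<in> {z\<in>W. g z \<noteq> 0}" "y \<in> {z\<in>W. h z \<noteq> 0} \<inter> U"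
        using closure_meets_open by meson
      then show False using W U unfolding local_quot_def by auto
    qed
    then have "local_quot (\<lambda>z. inverse (f z)) W (\<lambda>_. 0) h"
      using W unfolding local_quot_def by (auto simp: holo_on_const)
    then show "\<exists>W g h. p \<in> W \<and> local_quot (\<lambda>z. inverse (f z)) W g h" using W by blast
  qed
next
  case False
  show ?thesis unfolding is_mero_def
  proof
    fix p
    obtain W g h where W: "p \<in> W" "local_quot f W g h" using f unfolding is_mero_def by metis
    have opg: "open {z\<in>W. g z \<noteq> 0}" and oph: "open {z\<in>W. h z \<noteq> 0}"
      using W open_nonzero unfolding local_quot_def by blast+
    have dg: "W \<subseteq> closure {z\<in>W. g z \<noteq> 0}"
    proof (rule ccontr)
      define N where "N = W - closure {z\<in>W. g z \<noteq> 0}"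
      assume "\<not> W \<subseteq> closure {z\<in>W. g z \<noteq> 0}"
      then have N: "open N" "N \<noteq> {}" unfolding N_def using W unfolding local_quot_def by auto
      have g0: "g z = 0" if "z \<in> N" for z
        using that closure_subset[of "{z\<in>W. g z \<noteq> 0}"] unfolding N_def by auto
      have oN: "open (N \<inter> {z\<in>W. h z \<noteq> 0})" using N oph by auto
      have f0: "\<forall>y\<in>N \<inter> {z\<in>W. h z \<noteq> 0}. f y = 0" using g0 W unfolding local_quot_def by auto
      have "N \<inter> closure {z\<in>W. h z \<noteq> 0} \<subseteq> closure (N \<inter> {z\<in>W. h z \<noteq> 0})"
        by (rule open_Int_closure_subset[OF N(1)])
      then have "N \<subseteq> closure (N \<inter> {z\<in>W. h z \<noteq> 0})"
        using W unfolding local_quot_def N_def by auto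
      also have "\<dots> \<subseteq> closure {z. \<exists>V. open V \<and> z \<in> V \<and> (\<forall>y\<in>V. f y = 0)}"
        using oN f0 by (intro closure_mono) blast
      finally show False using zero_on_open_imp_ae_zero[OF f N] False by blast
    qed
    have "W \<subseteq> closure ({z\<in>W. g z \<noteq> 0} \<inter> {z\<in>W. h z \<noteq> 0})"
      using W dg opg oph unfolding local_quot_def by (intro dense_open_Int) auto
    also have "{z\<in>W. g z \<noteq> 0} \<inter> {z\<in>W. h z \<noteq> 0} = {z\<in>W. g z * h z \<noteq> 0}" by auto
    finally have "local_quot (\<lambda>z. inverse (f z)) W (\<lambda>z. h z * h z) (\<lambda>z. g z * h z)"
      using W unfolding local_quot_def
      by (intro conjI holo_on_mult ballI impI) auto
    then show "\<exists>W g h. p \<in> W \<and> local_quot (\<lambda>z. inverse (f z)) W g h" using W by blast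
  qed
qed

lemma mero_rel_part_equivp: "part_equivp mero_rel"
proof (rule part_equivpI)
  show "\<exists>f. mero_rel f f" using is_mero_const ae_eq_refl unfolding mero_rel_def by blast
  show "symp mero_rel" unfolding mero_rel_def symp_def using ae_eq_sym by blast
  show "transp mero_rel" unfolding mero_rel_def transp_def using ae_eq_trans by blast
qed

quotient_type (overloaded) 'v mero = "'v::complex_fd_space \<Rightarrow> complex" / partial: mero_rel
  by (rule mero_rel_part_equivp)

instantiation mero :: (complex_fd_space) field
begin

lift_definition zero_mero :: "'a mero" is "\<lambda>_. 0"
  by (simp add: mero_rel_def is_mero_const ae_eq_refl)

lift_definition one_mero :: "'a mero" is "\<lambda>_. 1"
  by (simp add: mero_rel_def is_mero_const ae_eq_refl)

lift_definition plus_mero :: "'a mero \<Rightarrow> 'a mero \<Rightarrow> 'a mero" is "\<lambda>f g z. f z + g z"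
  by (auto simp: mero_rel_def intro: is_mero_add elim: ae_eq_comb)

lift_definition times_mero :: "'a mero \<Rightarrow> 'a mero \<Rightarrow> 'a mero" is "\<lambda>f g z. f z * g z"
  by (auto simp: mero_rel_def intro: is_mero_mult elim: ae_eq_comb)

lift_definition uminus_mero :: "'a mero \<Rightarrow> 'a mero" is "\<lambda>f z. - f z"
  by (auto simp: mero_rel_def intro: is_mero_uminus elim: ae_eq_comb[OF _ ae_eq_refl])

lift_definition inverse_mero :: "'a mero \<Rightarrow> 'a mero" is "\<lambda>f z. inverse (f z)"
  by (auto simp: mero_rel_def intro: is_mero_inverse elim: ae_eq_comb[OF _ ae_eq_refl])

definition minus_mero :: "'a mero \<Rightarrow> 'a mero \<Rightarrow> 'a mero" where
  "minus_mero f g = f + - g"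

definition divide_mero :: "'a mero \<Rightarrow> 'a mero \<Rightarrow> 'a mero" where
  "divide_mero f g = f * inverse g"

instance
proof
  fix a b c :: "'a mero"
  show "a + b + c = a + (b + c)" "a * b * c = a * (b * c)" "(a + b) * c = a * c + b * c"
    by (transfer, auto simp: mero_rel_def algebra_simps
          intro!: is_mero_add is_mero_mult ae_eq_refl)+
  show "a + b = b + a" "a * b = b * a"
    by (transfer, auto simp: mero_rel_def add.commute mult.commute
          intro!: is_mero_add is_mero_mult ae_eq_refl)+
  show "0 + a = a" "1 * a = a" "- a + a = 0"
    by (transfer, auto simp: mero_rel_def intro!: is_mero_const ae_eq_refl)+
  show "a - b = a + - b" "a div b = a * inverse b"
    by (simp_all add: minus_mero_def divide_mero_def)
  show "0 \<noteq> (1 :: 'a mero)"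
    by transfer (auto simp: mero_rel_def ae_eq_def)
  show "inverse 0 = (0 :: 'a mero)"
    by transfer (auto simp: mero_rel_def intro!: is_mero_const ae_eq_refl)
  show "a \<noteq> 0 \<Longrightarrow> inverse a * a = 1"
  proof (transfer)
    fix f :: "'a \<Rightarrow> complex" assume f: "mero_rel f f" "\<not> mero_rel f (\<lambda>_. 0)"
    then have m: "is_mero f" "\<not> ae_eq f (\<lambda>_. 0)"
      unfolding mero_rel_def using is_mero_const by auto
    define N where "N = {z. \<exists>V. open V \<and> z \<in> V \<and> (\<forall>y\<in>V. f y \<noteq> 0)}"
    have oN: "open N" unfolding N_def by (subst open_subopen) blast
    have "closure N = UNIV"
    proof (rule ccontr)
      assume "closure N \<noteq> UNIV"
      then obtain p where p: "p \<notin> closure N" by auto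
      obtain W g h where W: "p \<in> W" "local_quot f W g h" using m unfolding is_mero_def by metis
      have op: "open ({z\<in>W. g z \<noteq> 0} \<inter> {z\<in>W. h z \<noteq> 0})"
        using W open_nonzero unfolding local_quot_def by blast
      then have "{z\<in>W. g z \<noteq> 0} \<inter> {z\<in>W. h z \<noteq> 0} \<subseteq> N"
      proof -
        have "\<forall>y\<in>{z\<in>W. g z \<noteq> 0} \<inter> {z\<in>W. h z \<noteq> 0}. f y \<noteq> 0"
          using W unfolding local_quot_def by auto
        then show ?thesis using op unfolding N_def by blast
      qed
      then have g0: "g z = 0 \<or> h z = 0" if "z \<in> W - closure N" for z
        using that closure_subset[of N] by auto
      define O' where "O' = (W - closure N) \<inter> {z\<in>W. h z \<noteq> 0}"
      have O1: "open O'" unfolding O'_def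
        using W open_nonzero unfolding local_quot_def by blast
      have O2: "\<forall>y\<in>O'. f y = 0" using g0 W unfolding O'_def local_quot_def by auto
      have oW: "open (W - closure N)" using W unfolding local_quot_def by auto
      have "W - closure N \<subseteq> closure O'" 
        using open_Int_closure_subset[OF oW, of "{z\<in>W. h z \<noteq> 0}"] W
        unfolding O'_def local_quot_def by auto
      also have "\<dots> \<subseteq> closure {z. \<exists>V. open V \<and> z \<in> V \<and> (\<forall>y\<in>V. f y = 0)}"
        using O1 O2 by (intro closure_mono) blast
      finally have "ae_eq f (\<lambda>_. 0)"
        using zero_on_open_imp_ae_zero[OF m(1) oW] p W by blast
      then show False using m by blast
    qed
    moreover have "\<forall>z\<in>N. inverse (f z) * f z = 1" unfolding N_def by auto
    ultimately have "ae_eq (\<lambda>z. inverse (f z) * f z) (\<lambda>_. 1)" unfolding ae_eq_def using oN by blast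
    then show "mero_rel (\<lambda>z. inverse (f z) * f z) (\<lambda>_. 1)"
      unfolding mero_rel_def using m by (auto intro: is_mero_mult is_mero_inverse is_mero_const)
  qed
qed

end

lift_definition mero_const :: "complex \<Rightarrow> 'v::complex_fd_space mero" is "\<lambda>c _. c"
  by (simp add: mero_rel_def is_mero_const ae_eq_refl)

lift_definition shift :: "'v::complex_fd_space \<Rightarrow> 'v mero \<Rightarrow> 'v mero" is "\<lambda>\<alpha> f z. f (z + \<alpha>)"
  by (auto simp: mero_rel_def intro: is_mero_shift ae_eq_shift)

section \<open>Algebras bigraded over the dual space\<close>

definition complex_ring :: "complex ring" where
  "complex_ring = \<lparr>carrier = UNIV, mult = (*), one = 1, zero = 0, add = (+)\<rparr>"

record (overloaded) ('v::complex_fd_space, 'a) h_alg = "(complex, 'a) module" +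
  bigr :: "'v \<Rightarrow> 'v \<Rightarrow> 'a set"
  lmom :: "'v mero \<Rightarrow> 'a" ("\<mu>\<^sub>l\<index>")
  rmom :: "'v mero \<Rightarrow> 'a" ("\<mu>\<^sub>r\<index>")

text \<open>\<open>c \<alpha> \<beta>\<close> are the components of \<open>x\<close> in a decomposition into bihomogeneous elements.\<close>

definition decomposition ::
  "('v::complex_fd_space, 'a, 'm) h_alg_scheme \<Rightarrow> 'a \<Rightarrow> ('v \<Rightarrow> 'v \<Rightarrow> 'a) \<Rightarrow> bool" where
  "decomposition A x c \<longleftrightarrow> (\<forall>\<alpha> \<beta>. c \<alpha> \<beta> \<in> bigr A \<alpha> \<beta>) \<and>
     finite {(\<alpha>, \<beta>). c \<alpha> \<beta> \<noteq> \<zero>\<^bsub>A\<^esub>} \<and>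
     x = (\<Oplus>\<^bsub>A\<^esub>d \<in> {(\<alpha>, \<beta>). c \<alpha> \<beta> \<noteq> \<zero>\<^bsub>A\<^esub>}. c (fst d) (snd d))"

definition component :: "('v::complex_fd_space, 'a, 'm) h_alg_scheme \<Rightarrow> 'v \<Rightarrow> 'v \<Rightarrow> 'a \<Rightarrow> 'a" where
  "component A \<alpha> \<beta> x = (THE c. decomposition A x c) \<alpha> \<beta>"

locale h_algebra = module complex_ring A + ring A
  for A :: "('v::complex_fd_space, 'a, 'm) h_alg_scheme" (structure) +
  assumes smult_mult_left: "\<lbrakk>x \<in> carrier A; y \<in> carrier A\<rbrakk> \<Longrightarrow> (c \<odot> x) \<otimes> y = c \<odot> (x \<otimes> y)"
    and smult_mult_right: "\<lbrakk>x \<in> carrier A; y \<in> carrier A\<rbrakk> \<Longrightarrow> x \<otimes> (c \<odot> y) = c \<odot> (x \<otimes> y)"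
    and bigr_carrier: "bigr A \<alpha> \<beta> \<subseteq> carrier A"
    and bigr_zero: "\<zero> \<in> bigr A \<alpha> \<beta>"
    and bigr_add: "\<lbrakk>x \<in> bigr A \<alpha> \<beta>; y \<in> bigr A \<alpha> \<beta>\<rbrakk> \<Longrightarrow> x \<oplus> y \<in> bigr A \<alpha> \<beta>"
    and bigr_smult: "x \<in> bigr A \<alpha> \<beta> \<Longrightarrow> c \<odot> x \<in> bigr A \<alpha> \<beta>"
    and bigr_mult: "\<lbrakk>x \<in> bigr A \<alpha> \<beta>; y \<in> bigr A \<gamma> \<delta>\<rbrakk> \<Longrightarrow> x \<otimes> y \<in> bigr A (\<alpha> + \<gamma>) (\<beta> + \<delta>)"
    and direct_sum: "x \<in> carrier A \<Longrightarrow> \<exists>!c. decomposition A x c"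
    and lmom_bigr: "\<mu>\<^sub>l f \<in> bigr A 0 0"
    and rmom_bigr: "\<mu>\<^sub>r f \<in> bigr A 0 0"
    and lmom_add: "\<mu>\<^sub>l (f + g) = \<mu>\<^sub>l f \<oplus> \<mu>\<^sub>l g"
    and rmom_add: "\<mu>\<^sub>r (f + g) = \<mu>\<^sub>r f \<oplus> \<mu>\<^sub>r g"
    and lmom_mult: "\<mu>\<^sub>l (f * g) = \<mu>\<^sub>l f \<otimes> \<mu>\<^sub>l g"
    and rmom_mult: "\<mu>\<^sub>r (f * g) = \<mu>\<^sub>r f \<otimes> \<mu>\<^sub>r g"
    and lmom_const: "\<mu>\<^sub>l (mero_const c) = c \<odot> \<one>"
    and rmom_const: "\<mu>\<^sub>r (mero_const c) = c \<odot> \<one>"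
    and lmom_inj: "inj \<mu>\<^sub>l"
    and rmom_inj: "inj \<mu>\<^sub>r"
    and lmom_comm: "a \<in> bigr A \<alpha> \<beta> \<Longrightarrow> \<mu>\<^sub>l f \<otimes> a = a \<otimes> \<mu>\<^sub>l (shift \<alpha> f)"
    and rmom_comm: "a \<in> bigr A \<alpha> \<beta> \<Longrightarrow> \<mu>\<^sub>r f \<otimes> a = a \<otimes> \<mu>\<^sub>r (shift \<beta> f)"

definition clinear_on ::
  "('v::complex_fd_space, 'a, 'm) h_alg_scheme \<Rightarrow> ('v, 'b, 'n) h_alg_scheme \<Rightarrow> ('a \<Rightarrow> 'b) \<Rightarrow> bool" where
  "clinear_on A B \<phi> \<longleftrightarrow> \<phi> \<in> carrier A \<rightarrow> carrier B \<and>
     (\<forall>x\<in>carrier A. \<forall>y\<in>carrier A. \<phi> (x \<oplus>\<^bsub>A\<^esub> y) = \<phi> x \<oplus>\<^bsub>B\<^esub> \<phi> y) \<and>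
     (\<forall>c. \<forall>x\<in>carrier A. \<phi> (c \<odot>\<^bsub>A\<^esub> x) = c \<odot>\<^bsub>B\<^esub> \<phi> x)"

definition h_hom ::
  "('v::complex_fd_space, 'a, 'm) h_alg_scheme \<Rightarrow> ('v, 'b, 'n) h_alg_scheme \<Rightarrow> ('a \<Rightarrow> 'b) set" where
  "h_hom A B = {\<phi> \<in> ring_hom A B. clinear_on A B \<phi> \<and>
     (\<forall>\<alpha> \<beta>. \<phi> ` bigr A \<alpha> \<beta> \<subseteq> bigr B \<alpha> \<beta>) \<and>
     (\<forall>f. \<phi> (\<mu>\<^sub>l\<^bsub>A\<^esub> f) = \<mu>\<^sub>l\<^bsub>B\<^esub> f) \<and> (\<forall>f. \<phi> (\<mu>\<^sub>r\<^bsub>A\<^esub> f) = \<mu>\<^sub>r\<^bsub>B\<^esub> f)}"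

definition alg_antihom :: "('v::complex_fd_space, 'a, 'm) h_alg_scheme \<Rightarrow> ('a \<Rightarrow> 'a) \<Rightarrow> bool" where
  "alg_antihom A S \<longleftrightarrow> clinear_on A A S \<and> S \<one>\<^bsub>A\<^esub> = \<one>\<^bsub>A\<^esub> \<and>
     (\<forall>a\<in>carrier A. \<forall>b\<in>carrier A. S (a \<otimes>\<^bsub>A\<^esub> b) = S b \<otimes>\<^bsub>A\<^esub> S a)"

inductive_set alg_gen :: "('v::complex_fd_space, 'a, 'm) h_alg_scheme \<Rightarrow> 'a set \<Rightarrow> 'a set"
  for A :: "('v::complex_fd_space, 'a, 'm) h_alg_scheme" and X :: "'a set" where
  gen: "x \<in> X \<Longrightarrow> x \<in> alg_gen A X"
| one: "\<one>\<^bsub>A\<^esub> \<in> alg_gen A X"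
| add: "\<lbrakk>x \<in> alg_gen A X; y \<in> alg_gen A X\<rbrakk> \<Longrightarrow> x \<oplus>\<^bsub>A\<^esub> y \<in> alg_gen A X"
| mult: "\<lbrakk>x \<in> alg_gen A X; y \<in> alg_gen A X\<rbrakk> \<Longrightarrow> x \<otimes>\<^bsub>A\<^esub> y \<in> alg_gen A X"
| smult: "x \<in> alg_gen A X \<Longrightarrow> c \<odot>\<^bsub>A\<^esub> x \<in> alg_gen A X"

section \<open>Matrix tensor product\<close>

definition matched ::
  "('v::complex_fd_space, 'a, 'm) h_alg_scheme \<Rightarrow> ('v, 'b, 'n) h_alg_scheme \<Rightarrow> ('a \<times> 'b) set" where
  "matched A B = (\<Union>\<alpha> \<gamma> \<beta>. bigr A \<alpha> \<gamma> \<times> bigr B \<gamma> \<beta>)"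

definition cscale :: "complex \<Rightarrow> ('x \<Rightarrow>\<^sub>0 complex) \<Rightarrow> ('x \<Rightarrow>\<^sub>0 complex)" where
  "cscale c p = Poly_Mapping.map ((*) c) p"

text \<open>
  The direct sum over \<open>\<alpha>\<close>, \<open>\<beta>\<close>, \<open>\<gamma>\<close> of the \<open>A\<^sub>\<alpha>\<^sub>\<gamma> \<otimes> B\<^sub>\<gamma>\<^sub>\<beta>\<close> is presented as the free complex vector space
  on all pairs in some \<open>A\<^sub>\<alpha>\<^sub>\<gamma> \<times> B\<^sub>\<gamma>\<^sub>\<beta>\<close> modulo the following subspace.  Each generating relation
  involves a single triple \<open>(\<alpha>, \<gamma>, \<beta>)\<close>, and the pairs belonging to more than one triple are those
  with a zero entry, which vanish in the quotient.
\<close>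

inductive_set tensor_rel ::
  "('v::complex_fd_space, 'a, 'm) h_alg_scheme \<Rightarrow> ('v, 'b, 'n) h_alg_scheme \<Rightarrow> ('a \<times> 'b \<Rightarrow>\<^sub>0 complex) set"
  for A :: "('v::complex_fd_space, 'a, 'm) h_alg_scheme" and B :: "('v, 'b, 'n) h_alg_scheme" where
  zero: "0 \<in> tensor_rel A B"
| add: "\<lbrakk>p \<in> tensor_rel A B; q \<in> tensor_rel A B\<rbrakk> \<Longrightarrow> p + q \<in> tensor_rel A B"
| smult: "p \<in> tensor_rel A B \<Longrightarrow> cscale c p \<in> tensor_rel A B"
| add_left: "\<lbrakk>a \<in> bigr A \<alpha> \<gamma>; a' \<in> bigr A \<alpha> \<gamma>; b \<in> bigr B \<gamma> \<beta>\<rbrakk> \<Longrightarrow>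
    Poly_Mapping.single (a \<oplus>\<^bsub>A\<^esub> a', b) 1 - Poly_Mapping.single (a, b) 1
      - Poly_Mapping.single (a', b) 1 \<in> tensor_rel A B"
| add_right: "\<lbrakk>a \<in> bigr A \<alpha> \<gamma>; b \<in> bigr B \<gamma> \<beta>; b' \<in> bigr B \<gamma> \<beta>\<rbrakk> \<Longrightarrow>
    Poly_Mapping.single (a, b \<oplus>\<^bsub>B\<^esub> b') 1 - Poly_Mapping.single (a, b) 1
      - Poly_Mapping.single (a, b') 1 \<in> tensor_rel A B"
| smult_left: "\<lbrakk>a \<in> bigr A \<alpha> \<gamma>; b \<in> bigr B \<gamma> \<beta>\<rbrakk> \<Longrightarrow>
    Poly_Mapping.single (c \<odot>\<^bsub>A\<^esub> a, b) 1 - Poly_Mapping.single (a, b) c \<in> tensor_rel A B"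
| smult_right: "\<lbrakk>a \<in> bigr A \<alpha> \<gamma>; b \<in> bigr B \<gamma> \<beta>\<rbrakk> \<Longrightarrow>
    Poly_Mapping.single (a, c \<odot>\<^bsub>B\<^esub> b) 1 - Poly_Mapping.single (a, b) c \<in> tensor_rel A B"
| balance: "\<lbrakk>a \<in> bigr A \<alpha> \<gamma>; b \<in> bigr B \<gamma> \<beta>\<rbrakk> \<Longrightarrow>
    Poly_Mapping.single (\<mu>\<^sub>r\<^bsub>A\<^esub> f \<otimes>\<^bsub>A\<^esub> a, b) 1
      - Poly_Mapping.single (a, \<mu>\<^sub>l\<^bsub>B\<^esub> f \<otimes>\<^bsub>B\<^esub> b) 1 \<in> tensor_rel A B"

definition tclass ::
  "('v::complex_fd_space, 'a, 'm) h_alg_scheme \<Rightarrow> ('v, 'b, 'n) h_alg_scheme \<Rightarrow>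
   ('a \<times> 'b \<Rightarrow>\<^sub>0 complex) \<Rightarrow> ('a \<times> 'b \<Rightarrow>\<^sub>0 complex) set" where
  "tclass A B p = {q. q - p \<in> tensor_rel A B}"

text \<open>
  The value \<open>0\<close> for non-matching homogeneous arguments makes maps such as
  \<open>(t, c) \<mapsto> \<Sum> a \<otimes> (b \<otimes> c)\<close> for \<open>t = \<Sum> a \<otimes> b\<close> independent of the representative of \<open>t\<close>: the
  representative may contain relations in degrees that do not match \<open>c\<close>.
\<close>

definition tensor ::
  "('v::complex_fd_space, 'a, 'm) h_alg_scheme \<Rightarrow> ('v, 'b, 'n) h_alg_scheme \<Rightarrow>
   'a \<Rightarrow> 'b \<Rightarrow> ('a \<times> 'b \<Rightarrow>\<^sub>0 complex) set" where
  "tensor A B a b =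
     tclass A B (if (a, b) \<in> matched A B then Poly_Mapping.single (a, b) 1 else 0)"

definition free_mult ::
  "('v::complex_fd_space, 'a, 'm) h_alg_scheme \<Rightarrow> ('v, 'b, 'n) h_alg_scheme \<Rightarrow>
   ('a \<times> 'b \<Rightarrow>\<^sub>0 complex) \<Rightarrow> ('a \<times> 'b \<Rightarrow>\<^sub>0 complex) \<Rightarrow> ('a \<times> 'b \<Rightarrow>\<^sub>0 complex)" where
  "free_mult A B p q =
     (\<Sum>(a, b)\<in>Poly_Mapping.keys p. \<Sum>(c, d)\<in>Poly_Mapping.keys q.
        Poly_Mapping.single (a \<otimes>\<^bsub>A\<^esub> c, b \<otimes>\<^bsub>B\<^esub> d)
          (Poly_Mapping.lookup p (a, b) * Poly_Mapping.lookup q (c, d)))"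

definition mtensor ::
  "('v::complex_fd_space, 'a, 'm) h_alg_scheme \<Rightarrow> ('v, 'b, 'n) h_alg_scheme \<Rightarrow>
   ('v, ('a \<times> 'b \<Rightarrow>\<^sub>0 complex) set) h_alg" where
  "mtensor A B = \<lparr>
     carrier = {tclass A B p |p. Poly_Mapping.keys p \<subseteq> matched A B},
     mult = (\<lambda>X Y. \<Union>p\<in>X. \<Union>q\<in>Y. tclass A B (free_mult A B p q)),
     one = tensor A B \<one>\<^bsub>A\<^esub> \<one>\<^bsub>B\<^esub>,
     zero = tclass A B 0,
     add = (\<lambda>X Y. \<Union>p\<in>X. \<Union>q\<in>Y. tclass A B (p + q)),
     smult = (\<lambda>c X. \<Union>p\<in>X. tclass A B (cscale c p)),
     bigr = (\<lambda>\<alpha> \<beta>. {tclass A B p |p.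
               Poly_Mapping.keys p \<subseteq> (\<Union>\<gamma>. bigr A \<alpha> \<gamma> \<times> bigr B \<gamma> \<beta>)}),
     lmom = (\<lambda>f. tensor A B (\<mu>\<^sub>l\<^bsub>A\<^esub> f) \<one>\<^bsub>B\<^esub>),
     rmom = (\<lambda>f. tensor A B \<one>\<^bsub>A\<^esub> (\<mu>\<^sub>r\<^bsub>B\<^esub> f))\<rparr>"

text \<open>
  The linear map into \<open>C\<close> induced by \<open>a \<otimes> b \<mapsto> \<phi> a b\<close>; meaningful when \<open>\<phi>\<close> respects the relations,
  so that all representatives of the class \<open>X\<close> give the same value.
\<close>

definition lift_tensor ::
  "('v::complex_fd_space, 'c, 'm) h_alg_scheme \<Rightarrow> ('a \<Rightarrow> 'b \<Rightarrow> 'c) \<Rightarrow>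
   ('a \<times> 'b \<Rightarrow>\<^sub>0 complex) set \<Rightarrow> 'c" where
  "lift_tensor C \<phi> X = the_elem
     ((\<lambda>p. \<Oplus>\<^bsub>C\<^esub>x \<in> Poly_Mapping.keys p. Poly_Mapping.lookup p x \<odot>\<^bsub>C\<^esub> \<phi> (fst x) (snd x)) ` X)"

text \<open>\<open>\<phi> \<otimes> \<psi>\<close> with values in the matrix tensor product of \<open>C\<close> and \<open>D\<close>\<close>

definition map_tensor ::
  "('v::complex_fd_space, 'c, 'm) h_alg_scheme \<Rightarrow> ('v, 'd, 'n) h_alg_scheme \<Rightarrow>
   ('a \<Rightarrow> 'c) \<Rightarrow> ('b \<Rightarrow> 'd) \<Rightarrow> ('a \<times> 'b \<Rightarrow>\<^sub>0 complex) set \<Rightarrow> ('c \<times> 'd \<Rightarrow>\<^sub>0 complex) set" where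
  "map_tensor C D \<phi> \<psi> = lift_tensor (mtensor C D) (\<lambda>a b. tensor C D (\<phi> a) (\<psi> b))"

text \<open>The canonical identification \<open>(a \<otimes> b) \<otimes> c \<mapsto> a \<otimes> (b \<otimes> c)\<close>\<close>

definition assoc_tensor ::
  "('v::complex_fd_space, 'a, 'm) h_alg_scheme \<Rightarrow> ('v, 'b, 'n) h_alg_scheme \<Rightarrow>
   ('v, 'c, 'k) h_alg_scheme \<Rightarrow> (('a \<times> 'b \<Rightarrow>\<^sub>0 complex) set \<times> 'c \<Rightarrow>\<^sub>0 complex) set \<Rightarrow>
   ('a \<times> ('b \<times> 'c \<Rightarrow>\<^sub>0 complex) set \<Rightarrow>\<^sub>0 complex) set" where
  "assoc_tensor A B C =
     lift_tensor (mtensor A (mtensor B C))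
       (\<lambda>t c. lift_tensor (mtensor A (mtensor B C))
          (\<lambda>a b. tensor A (mtensor B C) a (tensor B C b c)) t)"

section \<open>Difference operators\<close>

type_synonym 'v diff_op = "'v mero \<Rightarrow> 'v mero"

definition diff_sum :: "'v::complex_fd_space set \<Rightarrow> ('v \<Rightarrow> 'v mero) \<Rightarrow> 'v diff_op" where
  "diff_sum F f = (\<lambda>g. \<Sum>\<beta>\<in>F. f \<beta> * shift \<beta> g)"

definition diff_alg :: "('v::complex_fd_space, 'v diff_op) h_alg" ("D\<^sub>\<hh>") where
  "D\<^sub>\<hh> = \<lparr>
     carrier = {diff_sum F f |F f. finite F},
     mult = (\<lambda>P Q. P \<circ> Q),
     one = id,
     zero = (\<lambda>_. 0),
     add = (\<lambda>P Q g. P g + Q g),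
     smult = (\<lambda>c P g. mero_const c * P g),
     bigr = (\<lambda>\<alpha> \<beta>. if \<alpha> = \<beta> then {\<lambda>g. f * shift (- \<beta>) g |f. True} else {\<lambda>_. 0}),
     lmom = (\<lambda>f g. f * g),
     rmom = (\<lambda>f g. f * g)\<rparr>"

text \<open>
  The additive extension of \<open>f T\<^sub>\<beta> \<mapsto> T\<^sub>-\<^sub>\<beta> \<circ> f\<close>.  It is well defined because distinct shifts are
  linearly independent over the meromorphic functions.
\<close>

definition diff_antipode :: "'v::complex_fd_space diff_op \<Rightarrow> 'v diff_op" where
  "diff_antipode P = (THE Q. \<exists>F f. finite F \<and> P = diff_sum F f \<and>
     Q = (\<lambda>g. \<Sum>\<beta>\<in>F. shift (- \<beta>) (f \<beta> * g)))"

section \<open>Bialgebroids and Hopf algebroids\<close>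

text \<open>
  In the counit axiom, the canonical isomorphisms identify \<open>a \<in> A\<^sub>\<alpha>\<^sub>\<beta>\<close> with \<open>T\<^sub>-\<^sub>\<alpha> \<otimes> a\<close> and \<open>a \<otimes> T\<^sub>-\<^sub>\<beta>\<close>.
\<close>

locale h_bialgebroid = h_algebra A
  for A :: "('v::complex_fd_space, 'a, 'm) h_alg_scheme" (structure) +
  fixes \<Delta> :: "'a \<Rightarrow> ('a \<times> 'a \<Rightarrow>\<^sub>0 complex) set"
    and \<epsilon> :: "'a \<Rightarrow> 'v diff_op"
  assumes comult_hom: "\<Delta> \<in> h_hom A (mtensor A A)"
    and counit_hom: "\<epsilon> \<in> h_hom A D\<^sub>\<hh>"
    and coassoc: "a \<in> carrier A \<Longrightarrow>
      assoc_tensor A A A (map_tensor (mtensor A A) A \<Delta> id (\<Delta> a)) =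
      map_tensor A (mtensor A A) id \<Delta> (\<Delta> a)"
    and counit_left: "a \<in> bigr A \<alpha> \<beta> \<Longrightarrow>
      map_tensor D\<^sub>\<hh> A \<epsilon> id (\<Delta> a) = tensor D\<^sub>\<hh> A (shift (- \<alpha>)) a"
    and counit_right: "a \<in> bigr A \<alpha> \<beta> \<Longrightarrow>
      map_tensor A D\<^sub>\<hh> id \<epsilon> (\<Delta> a) = tensor A D\<^sub>\<hh> a (shift (- \<beta>))"

text \<open>The two antipode identities; \<open>\<epsilon> a 1\<close> is the operator \<open>\<epsilon> a\<close> applied to the constant function \<open>1\<close>.\<close>

definition antipode_id_left ::
  "('v::complex_fd_space, 'a, 'm) h_alg_scheme \<Rightarrow> ('a \<Rightarrow> ('a \<times> 'a \<Rightarrow>\<^sub>0 complex) set) \<Rightarrow>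
   ('a \<Rightarrow> 'v diff_op) \<Rightarrow> ('a \<Rightarrow> 'a) \<Rightarrow> 'a \<Rightarrow> bool" where
  "antipode_id_left A \<Delta> \<epsilon> S a \<longleftrightarrow>
     lift_tensor A (\<lambda>x y. x \<otimes>\<^bsub>A\<^esub> S y) (\<Delta> a) = \<mu>\<^sub>l\<^bsub>A\<^esub> (\<epsilon> a 1)"

definition antipode_id_right ::
  "('v::complex_fd_space, 'a, 'm) h_alg_scheme \<Rightarrow> ('a \<Rightarrow> ('a \<times> 'a \<Rightarrow>\<^sub>0 complex) set) \<Rightarrow>
   ('a \<Rightarrow> 'v diff_op) \<Rightarrow> ('a \<Rightarrow> 'a) \<Rightarrow> 'v \<Rightarrow> 'a \<Rightarrow> bool" where
  "antipode_id_right A \<Delta> \<epsilon> S \<alpha> a \<longleftrightarrow>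
     lift_tensor A (\<lambda>x y. S x \<otimes>\<^bsub>A\<^esub> y) (\<Delta> a) = \<mu>\<^sub>r\<^bsub>A\<^esub> (shift \<alpha> (\<epsilon> a 1))"

locale h_hopf_algebroid = h_bialgebroid A \<Delta> \<epsilon>
  for A :: "('v::complex_fd_space, 'a, 'm) h_alg_scheme" (structure) and \<Delta> \<epsilon> +
  fixes S :: "'a \<Rightarrow> 'a"
  assumes antipode_linear: "clinear_on A A S"
    and antipode_rmom: "a \<in> carrier A \<Longrightarrow> S (\<mu>\<^sub>r f \<otimes> a) = S a \<otimes> \<mu>\<^sub>l f"
    and antipode_lmom: "a \<in> carrier A \<Longrightarrow> S (a \<otimes> \<mu>\<^sub>l f) = \<mu>\<^sub>r f \<otimes> S a"
    and antipode_left: "a \<in> carrier A \<Longrightarrow> antipode_id_left A \<Delta> \<epsilon> S a"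
    and antipode_right: "a \<in> bigr A \<alpha> \<beta> \<Longrightarrow> antipode_id_right A \<Delta> \<epsilon> S \<alpha> a"

text \<open>
  \<open>\<sigma> \<circ> (S \<otimes> S)\<close>, that is \<open>a \<otimes> b \<mapsto> S b \<otimes> S a\<close>.  It is given as one map since \<open>S a \<otimes> S b\<close> itself does not
  lie in the matrix tensor product: the factors match only after the flip.
\<close>

definition flip_antipode ::
  "('v::complex_fd_space, 'a, 'm) h_alg_scheme \<Rightarrow> ('a \<Rightarrow> 'a) \<Rightarrow>
   ('a \<times> 'a \<Rightarrow>\<^sub>0 complex) set \<Rightarrow> ('a \<times> 'a \<Rightarrow>\<^sub>0 complex) set" where
  "flip_antipode A S = lift_tensor (mtensor A A) (\<lambda>a b. tensor A A (S b) (S a))"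

end

theory Submission
  imports Defs
begin

text \<open>
  The antipode is an inverse of the identity map under convolution. More generally, let \<open>h : A \<rightarrow> M\<close> be
  an algebra homomorphism. If \<open>S\<^sub>1\<close> is a left and \<open>S\<^sub>2\<close> a right convolution inverse of \<open>h\<close>, then
  evaluating \<open>S\<^sub>1 \<otimes> h \<otimes> S\<^sub>2\<close> on the iterated coproduct in two ways gives \<open>S\<^sub>1 = S\<^sub>2\<close>. With \<open>M = A\<close>
  this yields uniqueness and, applied to the graded part of \<open>S\<close>, the degrees of \<open>S\<close>; with \<open>M\<close> the
  matrix tensor square and \<open>h = \<Delta>\<close> it yields the compatibility of \<open>S\<close> with \<open>\<Delta>\<close>. The same double
  evaluation gives \<open>\<Sum> S(a' b) a'' = \<mu>\<^sub>r(T\<^sub>\<alpha>\<^sub>+\<^sub>\<gamma>(\<epsilon>(a) 1)) S(b)\<close> for \<open>a \<in> A\<^sub>\<alpha>\<^sub>\<beta>\<close> and \<open>b \<in> A\<^sub>\<gamma>\<^sub>\<delta>\<close>, and then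
  \<open>S(a b) = S(b) S(a)\<close>. In the converse direction, the elements all of whose components satisfy the
  antipode identities form a subalgebra.
\<close>

section \<open>Linear extension of maps on pairs\<close>

text \<open>The two antipode identities have different right-hand sides,
  \<open>\<mu>\<^sub>l (\<epsilon> a 1)\<close> and
  \<open>\<mu>\<^sub>r (shift \<alpha> (\<epsilon> a 1))\<close>, so there is no convolution monoid
  in which inverses could simply be cancelled. The double evaluation still closes because
  \<open>\<epsilon>\<close> lands in an algebra concentrated on the diagonal:
  \<open>\<epsilon> x\<close> vanishes unless both degrees of \<open>x\<close> agree, so a shift by
  the left degree may be replaced by one by the right degree, which is what moves the coefficient
  past the next factor. Every Sweedler sum is a linear map on a quotient, so a summand may be
  rewritten only when both versions are known to be balanced; this is why balancedness is carried
  along with the evaluated identities. The degrees of \<open>S\<close> are settled early: they allow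
  \<open>\<mu>\<^sub>r f\<close> to pass \<open>S b\<close> in the proof of antimultiplicativity,
  and they make \<open>S b\<close> and \<open>S a\<close> match after the flip.\<close>

lemma lookup_cscale: "Poly_Mapping.lookup (cscale c p) x = c * Poly_Mapping.lookup p x"
  by (simp add: cscale_def Poly_Mapping.map.rep_eq when_def)

lemma keys_cscale: "Poly_Mapping.keys (cscale c p) \<subseteq> Poly_Mapping.keys p"
  by (auto simp: in_keys_iff lookup_cscale)

lemma cscale_add_right: "cscale c (p + q) = cscale c p + cscale c q"
  by (rule poly_mapping_eqI) (simp add: lookup_cscale lookup_add algebra_simps)

lemma cscale_add_left: "cscale (c + d) p = cscale c p + cscale d p"
  by (rule poly_mapping_eqI) (simp add: lookup_cscale lookup_add algebra_simps)

lemma cscale_cscale: "cscale c (cscale d p) = cscale (c * d) p"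
  by (rule poly_mapping_eqI) (simp add: lookup_cscale)

lemma cscale_one: "cscale 1 p = p"
  by (rule poly_mapping_eqI) (simp add: lookup_cscale)

lemma cscale_diff_right: "cscale c (p - q) = cscale c p - cscale c q"
  by (rule poly_mapping_eqI) (simp add: lookup_cscale lookup_minus algebra_simps)

lemma cscale_zero: "cscale c 0 = 0"
  by (rule poly_mapping_eqI) (simp add: lookup_cscale)

lemma cscale_minus_one: "cscale (- 1) p = - p"
  by (rule poly_mapping_eqI) (simp add: lookup_cscale)

lemma cscale_single: "cscale c (Poly_Mapping.single x d) = Poly_Mapping.single x (c * d)"
  by (rule poly_mapping_eqI) (simp add: lookup_cscale lookup_single when_def)

lemma keys_add_subset:
  "Poly_Mapping.keys p \<subseteq> K \<Longrightarrow> Poly_Mapping.keys q \<subseteq> K \<Longrightarrow> Poly_Mapping.keys (p + q) \<subseteq> K"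
  using Poly_Mapping.keys_add[of p q] by blast

lemma keys_diff_subset:
  fixes p q :: "'x \<Rightarrow>\<^sub>0 complex"
  shows "Poly_Mapping.keys p \<subseteq> K \<Longrightarrow> Poly_Mapping.keys q \<subseteq> K \<Longrightarrow> Poly_Mapping.keys (p - q) \<subseteq> K"
  using Poly_Mapping.keys_diff[of p q] by blast

lemma keys_single_subset: "x \<in> K \<Longrightarrow> Poly_Mapping.keys (Poly_Mapping.single x c) \<subseteq> K"
  by auto

text \<open>Updating a fresh key amounts to adding a \<open>single\<close>, so a linear statement
  needs checking only on single pairs. The bound \<open>K\<close> on the supports keeps all pairs
  matched during the induction.\<close>

lemma poly_mapping_linear_induct [consumes 1, case_names zero single add]:
  fixes p :: "'x \<Rightarrow>\<^sub>0 complex"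
  assumes "Poly_Mapping.keys p \<subseteq> K"
    and "P 0"
    and "\<And>x c. x \<in> K \<Longrightarrow> P (Poly_Mapping.single x c)"
    and "\<And>p q. Poly_Mapping.keys p \<subseteq> K \<Longrightarrow> Poly_Mapping.keys q \<subseteq> K \<Longrightarrow> P p \<Longrightarrow> P q \<Longrightarrow> P (p + q)"
  shows "P p"
  using assms(1)
proof (induction p rule: update_induct)
  case const
  show ?case by (rule assms(2))
next
  case (update f a b)
  have eq: "Poly_Mapping.update a b f = f + Poly_Mapping.single a b"
    using update(1) by (intro poly_mapping_eqI)
      (auto simp: lookup_update lookup_add lookup_single when_def in_keys_iff)
  have k: "Poly_Mapping.keys (Poly_Mapping.update a b f) = insert a (Poly_Mapping.keys f)"
    using update by (auto simp: in_keys_iff lookup_update split: if_splits)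
  show ?case
    unfolding eq using update k by (intro assms) auto
qed

lemma cring_complex_ring: "cring complex_ring"
  by (rule cringI, rule abelian_groupI)
     (auto simp: complex_ring_def algebra_simps intro!: comm_monoidI exI[of _ "- x" for x :: complex])

lemma complex_ring_simps [simp]:
  "carrier complex_ring = UNIV" "mult complex_ring = (*)" "one complex_ring = 1"
  "add complex_ring = (+)" "zero complex_ring = 0"
  by (auto simp: complex_ring_def)

text \<open>The targets of linear extensions. Only the vector space structure is asked for, so that
  iterated tensor products such as \<open>mtensor A (mtensor A A)\<close> can serve as targets
  without being shown to be algebras.\<close>

locale cvector_space = module complex_ring C
  for C :: "('v::complex_fd_space, 'c, 'm) h_alg_scheme" (structure)

text \<open>The value that \<open>lift_tensor\<close> assigns to a single representative.\<close>

definition lin_ext ::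
  "('v::complex_fd_space, 'c, 'm) h_alg_scheme \<Rightarrow> ('a \<Rightarrow> 'b \<Rightarrow> 'c) \<Rightarrow> ('a \<times> 'b \<Rightarrow>\<^sub>0 complex) \<Rightarrow> 'c" where
  "lin_ext C \<phi> p =
     (\<Oplus>\<^bsub>C\<^esub>x \<in> Poly_Mapping.keys p. Poly_Mapping.lookup p x \<odot>\<^bsub>C\<^esub> \<phi> (fst x) (snd x))"

context cvector_space
begin

lemma smult_zero_left [simp]: "x \<in> carrier C \<Longrightarrow> (0::complex) \<odot> x = \<zero>"
  using smult_l_null by simp

lemma smult_one_left [simp]: "x \<in> carrier C \<Longrightarrow> (1::complex) \<odot> x = x"
  using smult_one by simp

lemma smult_add_scalar: "x \<in> carrier C \<Longrightarrow> ((c::complex) + d) \<odot> x = c \<odot> x \<oplus> d \<odot> x"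
  using smult_l_distr[of c d x] by simp

lemma smult_add_vec: "x \<in> carrier C \<Longrightarrow> y \<in> carrier C \<Longrightarrow> c \<odot> (x \<oplus> y) = c \<odot> x \<oplus> c \<odot> y"
  using smult_r_distr[of c x y] by simp

lemma smult_smult: "x \<in> carrier C \<Longrightarrow> ((c::complex) * d) \<odot> x = c \<odot> (d \<odot> x)"
  using smult_assoc1[of c d x] by simp

lemma smult_carrier [simp, intro]: "x \<in> carrier C \<Longrightarrow> c \<odot> x \<in> carrier C"
  using smult_closed[of c x] by simp

lemma smult_minus_one: "x \<in> carrier C \<Longrightarrow> (- 1 :: complex) \<odot> x = \<ominus> x"
  using smult_l_minus[of 1 x] smult_one[of x]
  by (metis UNIV_I a_comm add.inv_equality complex_ring_simps(1) cvector_space.smult_add_scalar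
      cvector_space_axioms neg_eq_iff_add_eq_0 smult_carrier smult_one_left smult_zero_left)

lemma lin_ext_superset:
  assumes "finite K" "Poly_Mapping.keys p \<subseteq> K" "\<And>x y. (x, y) \<in> K \<Longrightarrow> \<phi> x y \<in> carrier C"
  shows "lin_ext C \<phi> p = (\<Oplus>x\<in>K. Poly_Mapping.lookup p x \<odot> \<phi> (fst x) (snd x))"
  unfolding lin_ext_def
  using assms by (intro add.finprod_mono_neutral_cong_left) (auto simp: in_keys_iff)

text \<open>Cancellation may make the support of \<open>p + q\<close> smaller than the union of the
  two supports, so all three sums are first taken over that union.\<close>

lemma lin_ext_add:
  assumes "Poly_Mapping.keys p \<subseteq> K" "Poly_Mapping.keys q \<subseteq> K" "\<And>x y. (x, y) \<in> K \<Longrightarrow> \<phi> x y \<in> carrier C"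
  shows "lin_ext C \<phi> (p + q) = lin_ext C \<phi> p \<oplus> lin_ext C \<phi> q"
proof -
  let ?K = "Poly_Mapping.keys p \<union> Poly_Mapping.keys q"
  have K: "(x, y) \<in> ?K \<Longrightarrow> \<phi> x y \<in> carrier C" for x y using assms by blast
  have cl: "(\<lambda>x. Poly_Mapping.lookup r x \<odot> \<phi> (fst x) (snd x)) \<in> ?K \<rightarrow> carrier C" for r
    using K by auto
  have "lin_ext C \<phi> (p + q) = (\<Oplus>x\<in>?K. Poly_Mapping.lookup (p + q) x \<odot> \<phi> (fst x) (snd x))"
    using K by (intro lin_ext_superset Poly_Mapping.keys_add) auto
  also have "\<dots> = (\<Oplus>x\<in>?K. Poly_Mapping.lookup p x \<odot> \<phi> (fst x) (snd x)
      \<oplus> Poly_Mapping.lookup q x \<odot> \<phi> (fst x) (snd x))"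
    using K by (intro add.finprod_cong') (auto simp: lookup_add smult_add_scalar)
  also have "\<dots> = (\<Oplus>x\<in>?K. Poly_Mapping.lookup p x \<odot> \<phi> (fst x) (snd x))
      \<oplus> (\<Oplus>x\<in>?K. Poly_Mapping.lookup q x \<odot> \<phi> (fst x) (snd x))"
    by (rule add.finprod_multf[OF cl cl])
  also have "\<dots> = lin_ext C \<phi> p \<oplus> lin_ext C \<phi> q"
    using K by (intro arg_cong2[where f = "(\<oplus>)"] lin_ext_superset[symmetric]) auto
  finally show ?thesis .
qed

lemma lin_ext_zero [simp]: "lin_ext C \<phi> 0 = \<zero>"
  by (simp add: lin_ext_def)

lemma lin_ext_single:
  assumes "\<phi> x y \<in> carrier C"
  shows "lin_ext C \<phi> (Poly_Mapping.single (x, y) c) = c \<odot> \<phi> x y"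
  using lin_ext_superset[of "{(x, y)}" "Poly_Mapping.single (x, y) c" \<phi>] assms by auto

lemma lin_ext_closed:
  assumes "Poly_Mapping.keys p \<subseteq> K" "\<And>x y. (x, y) \<in> K \<Longrightarrow> \<phi> x y \<in> carrier C"
  shows "lin_ext C \<phi> p \<in> carrier C"
  unfolding lin_ext_def using assms by (intro finsum_closed) auto

lemma lin_ext_cscale:
  assumes "Poly_Mapping.keys p \<subseteq> K" "\<And>x y. (x, y) \<in> K \<Longrightarrow> \<phi> x y \<in> carrier C"
  shows "lin_ext C \<phi> (cscale c p) = c \<odot> lin_ext C \<phi> p"
  using assms(1)
proof (induction p rule: poly_mapping_linear_induct)
  case zero
  then show ?case using smult_r_null[of c] by (simp add: cscale_zero)
next
  case (single x d)
  then show ?case using assms(2)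
    by (cases x) (simp add: cscale_single lin_ext_single smult_smult)
next
  case (add p q)
  have "lin_ext C \<phi> (cscale c (p + q)) = lin_ext C \<phi> (cscale c p) \<oplus> lin_ext C \<phi> (cscale c q)"
    unfolding cscale_add_right
    by (intro lin_ext_add[of _ K] order_trans[OF keys_cscale] add assms(2))
  then show ?case using add assms(2)
    by (simp add: lin_ext_add[of _ K] lin_ext_closed[of _ K] smult_add_vec)
qed

lemma lin_ext_diff:
  assumes "Poly_Mapping.keys p \<subseteq> K" "Poly_Mapping.keys q \<subseteq> K" "\<And>x y. (x, y) \<in> K \<Longrightarrow> \<phi> x y \<in> carrier C"
  shows "lin_ext C \<phi> (p - q) = lin_ext C \<phi> p \<ominus> lin_ext C \<phi> q"
proof -
  have "lin_ext C \<phi> (p + cscale (- 1) q) = lin_ext C \<phi> p \<oplus> (- 1) \<odot> lin_ext C \<phi> q"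
    using assms keys_cscale[of "-1" q]
    by (subst lin_ext_add[of _ K]) (auto simp: lin_ext_cscale[of _ K])
  then show ?thesis using lin_ext_closed[OF assms(2,3)]
    by (simp add: cscale_minus_one smult_minus_one a_minus_def)
qed

end

section \<open>The matrix tensor product as a vector space\<close>

text \<open>The closure properties that keep the tensor relations inside the matched pairs. They can
  be verified for an \<h>-algebra, for the difference operators and for \<open>mtensor A A\<close>
  alike, without first constructing unique decompositions in the latter two.\<close>

definition bigr_closed :: "('v::complex_fd_space, 'a, 'm) h_alg_scheme \<Rightarrow> bool" where
  "bigr_closed A \<longleftrightarrow> (\<forall>\<alpha> \<beta>. \<zero>\<^bsub>A\<^esub> \<in> bigr A \<alpha> \<beta> \<and> (\<forall>x\<in>bigr A \<alpha> \<beta>. x \<in> carrier A \<and>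
     (\<forall>y\<in>bigr A \<alpha> \<beta>. x \<oplus>\<^bsub>A\<^esub> y \<in> bigr A \<alpha> \<beta>) \<and> (\<forall>c. c \<odot>\<^bsub>A\<^esub> x \<in> bigr A \<alpha> \<beta>) \<and>
     (\<forall>f. \<mu>\<^sub>l\<^bsub>A\<^esub> f \<otimes>\<^bsub>A\<^esub> x \<in> bigr A \<alpha> \<beta> \<and> \<mu>\<^sub>r\<^bsub>A\<^esub> f \<otimes>\<^bsub>A\<^esub> x \<in> bigr A \<alpha> \<beta>)))"

text \<open>One clause for each kind of generator of \<open>tensor_rel\<close>: bilinearity in every
  block of matching degrees, and balancing over the meromorphic functions. Values on pairs of
  unequal inner degrees are left free.\<close>

definition balanced ::
  "('v::complex_fd_space, 'c, 'k) h_alg_scheme \<Rightarrow> ('v, 'a, 'm) h_alg_scheme \<Rightarrow>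
   ('v, 'b, 'n) h_alg_scheme \<Rightarrow> ('a \<Rightarrow> 'b \<Rightarrow> 'c) \<Rightarrow> bool" where
  "balanced C A B \<phi> \<longleftrightarrow> (\<forall>\<alpha> \<gamma> \<beta>. \<forall>a\<in>bigr A \<alpha> \<gamma>. \<forall>b\<in>bigr B \<gamma> \<beta>. \<phi> a b \<in> carrier C \<and>
     (\<forall>a'\<in>bigr A \<alpha> \<gamma>. \<phi> (a \<oplus>\<^bsub>A\<^esub> a') b = \<phi> a b \<oplus>\<^bsub>C\<^esub> \<phi> a' b) \<and>
     (\<forall>b'\<in>bigr B \<gamma> \<beta>. \<phi> a (b \<oplus>\<^bsub>B\<^esub> b') = \<phi> a b \<oplus>\<^bsub>C\<^esub> \<phi> a b') \<and>
     (\<forall>c. \<phi> (c \<odot>\<^bsub>A\<^esub> a) b = c \<odot>\<^bsub>C\<^esub> \<phi> a b \<and> \<phi> a (c \<odot>\<^bsub>B\<^esub> b) = c \<odot>\<^bsub>C\<^esub> \<phi> a b) \<and>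
     (\<forall>f. \<phi> (\<mu>\<^sub>r\<^bsub>A\<^esub> f \<otimes>\<^bsub>A\<^esub> a) b = \<phi> a (\<mu>\<^sub>l\<^bsub>B\<^esub> f \<otimes>\<^bsub>B\<^esub> b)))"

lemma tensor_rel_uminus: "p \<in> tensor_rel A B \<Longrightarrow> - p \<in> tensor_rel A B"
  using tensor_rel.smult[of p A B "-1"] by (simp add: cscale_minus_one)

lemma tensor_rel_diff: "p \<in> tensor_rel A B \<Longrightarrow> q \<in> tensor_rel A B \<Longrightarrow> p - q \<in> tensor_rel A B"
  using tensor_rel.add[of p A B "- q"] tensor_rel_uminus[of q A B] by simp

lemma tclass_eq_iff: "tclass A B p = tclass A B q \<longleftrightarrow> p - q \<in> tensor_rel A B"
proof
  assume "tclass A B p = tclass A B q"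
  moreover have "p \<in> tclass A B p" by (simp add: tclass_def tensor_rel.zero)
  ultimately show "p - q \<in> tensor_rel A B" by (simp add: tclass_def)
next
  assume *: "p - q \<in> tensor_rel A B"
  have "r - p \<in> tensor_rel A B \<longleftrightarrow> r - q \<in> tensor_rel A B" for r
    using tensor_rel.add[OF _ *, of "r - p"] tensor_rel_diff[OF _ *, of "r - q"] by auto
  then show "tclass A B p = tclass A B q" by (auto simp: tclass_def)
qed

lemma tclass_self: "p \<in> tclass A B p"
  by (simp add: tclass_def tensor_rel.zero)

text \<open>The sum is defined as a union over all representatives; the union collapses because
  every choice yields the same coset.\<close>

lemma mtensor_add: "tclass A B p \<oplus>\<^bsub>mtensor A B\<^esub> tclass A B q = tclass A B (p + q)"
proof -
  have "tclass A B (p' + q') = tclass A B (p + q)" if "p' \<in> tclass A B p" "q' \<in> tclass A B q" for p' q'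
    using that tensor_rel.add[of "p' - p" A B "q' - q"] unfolding tclass_eq_iff
    by (simp add: tclass_def algebra_simps)
  then have "tclass A B p \<oplus>\<^bsub>mtensor A B\<^esub> tclass A B q =
      (\<Union>p'\<in>tclass A B p. \<Union>q'\<in>tclass A B q. tclass A B (p + q))"
    by (simp add: mtensor_def)
  then show ?thesis using tclass_self by blast
qed

lemma mtensor_smult: "c \<odot>\<^bsub>mtensor A B\<^esub> tclass A B p = tclass A B (cscale c p)"
proof -
  have "tclass A B (cscale c p') = tclass A B (cscale c p)" if "p' \<in> tclass A B p" for p'
    using that tensor_rel.smult[of "p' - p" A B c] unfolding tclass_eq_iff
    by (simp add: tclass_def cscale_diff_right)
  then have "c \<odot>\<^bsub>mtensor A B\<^esub> tclass A B p = (\<Union>p'\<in>tclass A B p. tclass A B (cscale c p))"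
    by (simp add: mtensor_def)
  then show ?thesis using tclass_self by blast
qed

lemma mtensor_zero: "\<zero>\<^bsub>mtensor A B\<^esub> = tclass A B 0"
  by (simp add: mtensor_def)

lemma mtensor_carrier: "carrier (mtensor A B) = {tclass A B p |p. Poly_Mapping.keys p \<subseteq> matched A B}"
  by (simp add: mtensor_def)

lemma tclass_carrier: "Poly_Mapping.keys p \<subseteq> matched A B \<Longrightarrow> tclass A B p \<in> carrier (mtensor A B)"
  by (auto simp: mtensor_carrier)

lemma mtensor_carrierE:
  assumes "X \<in> carrier (mtensor A B)"
  obtains p where "X = tclass A B p" "Poly_Mapping.keys p \<subseteq> matched A B"
  using assms by (auto simp: mtensor_carrier)

lemma mtensor_bigr: "bigr (mtensor A B) \<alpha> \<beta> =
    {tclass A B p |p. Poly_Mapping.keys p \<subseteq> (\<Union>\<gamma>. bigr A \<alpha> \<gamma> \<times> bigr B \<gamma> \<beta>)}"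
  by (simp add: mtensor_def)

lemma tclass_bigr: "Poly_Mapping.keys p \<subseteq> (\<Union>\<gamma>. bigr A \<alpha> \<gamma> \<times> bigr B \<gamma> \<beta>) \<Longrightarrow>
    tclass A B p \<in> bigr (mtensor A B) \<alpha> \<beta>"
  by (auto simp: mtensor_bigr)

lemma mtensor_bigrE:
  assumes "X \<in> bigr (mtensor A B) \<alpha> \<beta>"
  obtains p where "X = tclass A B p" "Poly_Mapping.keys p \<subseteq> (\<Union>\<gamma>. bigr A \<alpha> \<gamma> \<times> bigr B \<gamma> \<beta>)"
  using assms by (auto simp: mtensor_bigr)

text \<open>The cosets inherit all axioms from finitely supported functions, and the supports stay
  inside \<open>matched A B\<close> under the operations.\<close>

lemma mtensor_cvector_space: "cvector_space (mtensor A B)"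
proof -
  interpret cring complex_ring by (rule cring_complex_ring)
  have "abelian_group (mtensor A B)"
  proof (rule abelian_groupI)
    fix X assume "X \<in> carrier (mtensor A B)"
    then obtain p where p: "X = tclass A B p" "Poly_Mapping.keys p \<subseteq> matched A B"
      by (auto simp: mtensor_carrier)
    then show "\<exists>Y\<in>carrier (mtensor A B). Y \<oplus>\<^bsub>mtensor A B\<^esub> X = \<zero>\<^bsub>mtensor A B\<^esub>"
      by (intro bexI[of _ "tclass A B (- p)"])
         (auto simp: mtensor_add mtensor_zero mtensor_carrier intro!: exI[of _ "- p"])
  qed (auto simp: mtensor_add mtensor_zero algebra_simps elim!: mtensor_carrierE
        intro: tclass_carrier[OF keys_add_subset] tclass_carrier)
  then have "module complex_ring (mtensor A B)"
    by (intro moduleI cring_complex_ring)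
       (auto simp: mtensor_add mtensor_smult cscale_add_left cscale_add_right
          cscale_cscale cscale_one elim!: mtensor_carrierE
          intro!: tclass_carrier order_trans[OF keys_cscale])
  then show ?thesis by (simp add: cvector_space_def)
qed

lemma tensor_matched:
  "a \<in> bigr A \<alpha> \<gamma> \<Longrightarrow> b \<in> bigr B \<gamma> \<beta> \<Longrightarrow> tensor A B a b = tclass A B (Poly_Mapping.single (a, b) 1)"
  by (auto simp: tensor_def matched_def)

lemma matchedI: "a \<in> bigr A \<alpha> \<gamma> \<Longrightarrow> b \<in> bigr B \<gamma> \<beta> \<Longrightarrow> (a, b) \<in> matched A B"
  by (auto simp: matched_def)

lemma tensor_bigr: "a \<in> bigr A \<alpha> \<gamma> \<Longrightarrow> b \<in> bigr B \<gamma> \<beta> \<Longrightarrow> tensor A B a b \<in> bigr (mtensor A B) \<alpha> \<beta>"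
  by (auto simp: tensor_matched mtensor_bigr intro!: exI[of _ "Poly_Mapping.single (a, b) 1"])

lemma mtensor_bigr_carrier: "bigr (mtensor A B) \<alpha> \<beta> \<subseteq> carrier (mtensor A B)"
  by (fastforce simp: mtensor_bigr mtensor_carrier matched_def)

lemma tensor_carrier: "tensor A B a b \<in> carrier (mtensor A B)"
  by (auto simp: tensor_def mtensor_carrier intro: exI[of _ "Poly_Mapping.single (a, b) 1"] exI[of _ 0])

text \<open>A scalar coefficient is absorbed into the left factor. Hence the pure tensors span
  additively, and inductions over the tensor product need no case for scalars.\<close>

lemma tclass_single:
  assumes "a \<in> bigr A \<alpha> \<gamma>" "b \<in> bigr B \<gamma> \<beta>" "c \<odot>\<^bsub>A\<^esub> a \<in> bigr A \<alpha> \<gamma>"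
  shows "tclass A B (Poly_Mapping.single (a, b) c) = tensor A B (c \<odot>\<^bsub>A\<^esub> a) b"
proof -
  have "Poly_Mapping.single (a, b) c - Poly_Mapping.single (c \<odot>\<^bsub>A\<^esub> a, b) 1 \<in> tensor_rel A B"
    using tensor_rel_uminus[OF tensor_rel.smult_left[OF assms(1,2), of c]] by simp
  then show ?thesis by (simp add: tensor_matched[OF assms(3,2)] tclass_eq_iff)
qed

lemma bigr_closedD:
  assumes "bigr_closed A"
  shows "\<zero>\<^bsub>A\<^esub> \<in> bigr A \<alpha> \<beta>"
    "x \<in> bigr A \<alpha> \<beta> \<Longrightarrow> x \<in> carrier A"
    "x \<in> bigr A \<alpha> \<beta> \<Longrightarrow> y \<in> bigr A \<alpha> \<beta> \<Longrightarrow> x \<oplus>\<^bsub>A\<^esub> y \<in> bigr A \<alpha> \<beta>"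
    "x \<in> bigr A \<alpha> \<beta> \<Longrightarrow> c \<odot>\<^bsub>A\<^esub> x \<in> bigr A \<alpha> \<beta>"
    "x \<in> bigr A \<alpha> \<beta> \<Longrightarrow> \<mu>\<^sub>l\<^bsub>A\<^esub> f \<otimes>\<^bsub>A\<^esub> x \<in> bigr A \<alpha> \<beta>"
    "x \<in> bigr A \<alpha> \<beta> \<Longrightarrow> \<mu>\<^sub>r\<^bsub>A\<^esub> f \<otimes>\<^bsub>A\<^esub> x \<in> bigr A \<alpha> \<beta>"
  using assms unfolding bigr_closed_def by blast+

lemma balancedD:
  assumes "balanced C A B \<phi>" "a \<in> bigr A \<alpha> \<gamma>" "b \<in> bigr B \<gamma> \<beta>"
  shows "\<phi> a b \<in> carrier C"
    "a' \<in> bigr A \<alpha> \<gamma> \<Longrightarrow> \<phi> (a \<oplus>\<^bsub>A\<^esub> a') b = \<phi> a b \<oplus>\<^bsub>C\<^esub> \<phi> a' b"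
    "b' \<in> bigr B \<gamma> \<beta> \<Longrightarrow> \<phi> a (b \<oplus>\<^bsub>B\<^esub> b') = \<phi> a b \<oplus>\<^bsub>C\<^esub> \<phi> a b'"
    "\<phi> (c \<odot>\<^bsub>A\<^esub> a) b = c \<odot>\<^bsub>C\<^esub> \<phi> a b"
    "\<phi> a (c \<odot>\<^bsub>B\<^esub> b) = c \<odot>\<^bsub>C\<^esub> \<phi> a b"
    "\<phi> (\<mu>\<^sub>r\<^bsub>A\<^esub> f \<otimes>\<^bsub>A\<^esub> a) b = \<phi> a (\<mu>\<^sub>l\<^bsub>B\<^esub> f \<otimes>\<^bsub>B\<^esub> b)"
proof -
  note * = assms(1)[unfolded balanced_def, rule_format, OF assms(2,3)]
  show "\<phi> a b \<in> carrier C" using * by blast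
  show "a' \<in> bigr A \<alpha> \<gamma> \<Longrightarrow> \<phi> (a \<oplus>\<^bsub>A\<^esub> a') b = \<phi> a b \<oplus>\<^bsub>C\<^esub> \<phi> a' b" using * by blast
  show "b' \<in> bigr B \<gamma> \<beta> \<Longrightarrow> \<phi> a (b \<oplus>\<^bsub>B\<^esub> b') = \<phi> a b \<oplus>\<^bsub>C\<^esub> \<phi> a b'" using * by blast
  show "\<phi> (c \<odot>\<^bsub>A\<^esub> a) b = c \<odot>\<^bsub>C\<^esub> \<phi> a b" "\<phi> a (c \<odot>\<^bsub>B\<^esub> b) = c \<odot>\<^bsub>C\<^esub> \<phi> a b" using * by blast+
  show "\<phi> (\<mu>\<^sub>r\<^bsub>A\<^esub> f \<otimes>\<^bsub>A\<^esub> a) b = \<phi> a (\<mu>\<^sub>l\<^bsub>B\<^esub> f \<otimes>\<^bsub>B\<^esub> b)" using * by blast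
qed

lemma balancedI:
  assumes "\<And>\<alpha> \<gamma> \<beta> a b. a \<in> bigr A \<alpha> \<gamma> \<Longrightarrow> b \<in> bigr B \<gamma> \<beta> \<Longrightarrow> \<phi> a b \<in> carrier C"
    "\<And>\<alpha> \<gamma> \<beta> a a' b. a \<in> bigr A \<alpha> \<gamma> \<Longrightarrow> b \<in> bigr B \<gamma> \<beta> \<Longrightarrow> a' \<in> bigr A \<alpha> \<gamma> \<Longrightarrow>
       \<phi> (a \<oplus>\<^bsub>A\<^esub> a') b = \<phi> a b \<oplus>\<^bsub>C\<^esub> \<phi> a' b"
    "\<And>\<alpha> \<gamma> \<beta> a b b'. a \<in> bigr A \<alpha> \<gamma> \<Longrightarrow> b \<in> bigr B \<gamma> \<beta> \<Longrightarrow> b' \<in> bigr B \<gamma> \<beta> \<Longrightarrow>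
       \<phi> a (b \<oplus>\<^bsub>B\<^esub> b') = \<phi> a b \<oplus>\<^bsub>C\<^esub> \<phi> a b'"
    "\<And>\<alpha> \<gamma> \<beta> a b c. a \<in> bigr A \<alpha> \<gamma> \<Longrightarrow> b \<in> bigr B \<gamma> \<beta> \<Longrightarrow> \<phi> (c \<odot>\<^bsub>A\<^esub> a) b = c \<odot>\<^bsub>C\<^esub> \<phi> a b"
    "\<And>\<alpha> \<gamma> \<beta> a b c. a \<in> bigr A \<alpha> \<gamma> \<Longrightarrow> b \<in> bigr B \<gamma> \<beta> \<Longrightarrow> \<phi> a (c \<odot>\<^bsub>B\<^esub> b) = c \<odot>\<^bsub>C\<^esub> \<phi> a b"
    "\<And>\<alpha> \<gamma> \<beta> a b f. a \<in> bigr A \<alpha> \<gamma> \<Longrightarrow> b \<in> bigr B \<gamma> \<beta> \<Longrightarrow>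
       \<phi> (\<mu>\<^sub>r\<^bsub>A\<^esub> f \<otimes>\<^bsub>A\<^esub> a) b = \<phi> a (\<mu>\<^sub>l\<^bsub>B\<^esub> f \<otimes>\<^bsub>B\<^esub> b)"
  shows "balanced C A B \<phi>"
  unfolding balanced_def by (intro allI ballI conjI; rule assms; assumption)

context
  fixes A :: "('v::complex_fd_space, 'a, 'm) h_alg_scheme"
    and B :: "('v, 'b, 'n) h_alg_scheme"
  assumes A: "bigr_closed A" and B: "bigr_closed B"
begin

text \<open>A coset consists of arbitrary functions on pairs. This lemma shows that one
  representative with matched support forces matched support on all of them, so a balanced map can
  be evaluated on each.\<close>

lemma tensor_rel_keys: "p \<in> tensor_rel A B \<Longrightarrow> Poly_Mapping.keys p \<subseteq> matched A B"
proof (induction rule: tensor_rel.induct)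
  case (smult p c)
  show ?case by (rule order_trans[OF keys_cscale smult(2)])
next
  case (add_left a \<alpha> \<gamma> a' b \<beta>)
  then show ?case
    by (intro keys_diff_subset keys_single_subset matchedI[where \<alpha> = \<alpha> and \<gamma> = \<gamma> and \<beta> = \<beta>]
        bigr_closedD(3)[OF A])
next
  case (add_right a \<alpha> \<gamma> b \<beta> b')
  then show ?case
    by (intro keys_diff_subset keys_single_subset matchedI[where \<alpha> = \<alpha> and \<gamma> = \<gamma> and \<beta> = \<beta>]
        bigr_closedD(3)[OF B])
next
  case (smult_left a \<alpha> \<gamma> b \<beta> c)
  then show ?case
    by (intro keys_diff_subset keys_single_subset matchedI[where \<alpha> = \<alpha> and \<gamma> = \<gamma> and \<beta> = \<beta>]
        bigr_closedD(4)[OF A])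
next
  case (smult_right a \<alpha> \<gamma> b \<beta> c)
  then show ?case
    by (intro keys_diff_subset keys_single_subset matchedI[where \<alpha> = \<alpha> and \<gamma> = \<gamma> and \<beta> = \<beta>]
        bigr_closedD(4)[OF B])
next
  case (balance a \<alpha> \<gamma> b \<beta> f)
  then show ?case
    by (intro keys_diff_subset keys_single_subset matchedI[where \<alpha> = \<alpha> and \<gamma> = \<gamma> and \<beta> = \<beta>]
        bigr_closedD(6)[OF A] bigr_closedD(5)[OF B])
qed (simp_all add: keys_add_subset)

lemma balanced_tensor: "balanced (mtensor A B) A B (tensor A B)"
proof (rule balancedI)
  fix \<alpha> \<gamma> \<beta> a b a' b' c f
  assume a: "a \<in> bigr A \<alpha> \<gamma>" and b: "b \<in> bigr B \<gamma> \<beta>"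
  note [simp] = tensor_matched[where \<alpha> = \<alpha> and \<gamma> = \<gamma> and \<beta> = \<beta>] a b
    bigr_closedD[OF A, where \<alpha> = \<alpha> and \<beta> = \<gamma>] bigr_closedD[OF B, where \<alpha> = \<gamma> and \<beta> = \<beta>]
  show "tensor A B (c \<odot>\<^bsub>A\<^esub> a) b = c \<odot>\<^bsub>mtensor A B\<^esub> tensor A B a b"
    "tensor A B a (c \<odot>\<^bsub>B\<^esub> b) = c \<odot>\<^bsub>mtensor A B\<^esub> tensor A B a b"
    "tensor A B (\<mu>\<^sub>r\<^bsub>A\<^esub> f \<otimes>\<^bsub>A\<^esub> a) b = tensor A B a (\<mu>\<^sub>l\<^bsub>B\<^esub> f \<otimes>\<^bsub>B\<^esub> b)"
    using tensor_rel.smult_left[OF a b] tensor_rel.smult_right[OF a b] tensor_rel.balance[OF a b]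
    by (simp_all add: mtensor_smult tclass_eq_iff cscale_single)
  show "a' \<in> bigr A \<alpha> \<gamma> \<Longrightarrow> tensor A B (a \<oplus>\<^bsub>A\<^esub> a') b = tensor A B a b \<oplus>\<^bsub>mtensor A B\<^esub> tensor A B a' b"
    using tensor_rel.add_left[OF a _ b, of a'] by (simp add: mtensor_add tclass_eq_iff diff_diff_eq)
  show "b' \<in> bigr B \<gamma> \<beta> \<Longrightarrow> tensor A B a (b \<oplus>\<^bsub>B\<^esub> b') = tensor A B a b \<oplus>\<^bsub>mtensor A B\<^esub> tensor A B a b'"
    using tensor_rel.add_right[OF a b, of b'] by (simp add: mtensor_add tclass_eq_iff diff_diff_eq)
qed (rule tensor_carrier)

lemma mtensor_bigr_zero: "\<zero>\<^bsub>mtensor A B\<^esub> \<in> bigr (mtensor A B) \<alpha> \<beta>"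
  by (auto simp: mtensor_zero mtensor_bigr intro!: exI[of _ 0])

lemma mtensor_bigr_add:
  "X \<in> bigr (mtensor A B) \<alpha> \<beta> \<Longrightarrow> Y \<in> bigr (mtensor A B) \<alpha> \<beta> \<Longrightarrow>
   X \<oplus>\<^bsub>mtensor A B\<^esub> Y \<in> bigr (mtensor A B) \<alpha> \<beta>"
  by (elim mtensor_bigrE) (simp add: mtensor_add tclass_bigr keys_add_subset)

lemma mtensor_bigr_smult:
  "X \<in> bigr (mtensor A B) \<alpha> \<beta> \<Longrightarrow> c \<odot>\<^bsub>mtensor A B\<^esub> X \<in> bigr (mtensor A B) \<alpha> \<beta>"
  by (elim mtensor_bigrE) (simp add: mtensor_smult tclass_bigr order_trans[OF keys_cscale])

end

text \<open>\<open>D\<close> is a set of degree triples, so the whole tensor product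
  (\<open>UNIV\<close>) and its bihomogeneous parts share one induction rule and one comparison
  principle.\<close>

definition tensor_span ::
  "('v::complex_fd_space, 'a, 'm) h_alg_scheme \<Rightarrow> ('v, 'b, 'n) h_alg_scheme \<Rightarrow> ('v \<times> 'v \<times> 'v) set \<Rightarrow>
   ('a \<times> 'b \<Rightarrow>\<^sub>0 complex) set set" where
  "tensor_span A B D =
     {tclass A B p |p. Poly_Mapping.keys p \<subseteq> (\<Union>(\<alpha>, \<gamma>, \<beta>)\<in>D. bigr A \<alpha> \<gamma> \<times> bigr B \<gamma> \<beta>)}"

lemma mtensor_carrier_span: "carrier (mtensor A B) = tensor_span A B UNIV"
proof -
  have "matched A B = (\<Union>(\<alpha>, \<gamma>, \<beta>)\<in>UNIV. bigr A \<alpha> \<gamma> \<times> bigr B \<gamma> \<beta>)" by (auto simp: matched_def)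
  then show ?thesis by (simp add: mtensor_carrier tensor_span_def)
qed

lemma mtensor_bigr_span: "bigr (mtensor A B) \<alpha> \<beta> = tensor_span A B {(\<xi>, \<gamma>, \<eta>). \<xi> = \<alpha> \<and> \<eta> = \<beta>}"
proof -
  have "(\<Union>\<gamma>. bigr A \<alpha> \<gamma> \<times> bigr B \<gamma> \<beta>) =
      (\<Union>(\<xi>, \<gamma>, \<eta>)\<in>{(\<xi>, \<gamma>, \<eta>). \<xi> = \<alpha> \<and> \<eta> = \<beta>}. bigr A \<xi> \<gamma> \<times> bigr B \<gamma> \<eta>)" by auto
  then show ?thesis by (simp add: mtensor_bigr tensor_span_def)
qed

lemma degree_span_matched: "(\<Union>(\<alpha>, \<gamma>, \<beta>)\<in>D. bigr A \<alpha> \<gamma> \<times> bigr B \<gamma> \<beta>) \<subseteq> matched A B"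
  by (auto simp: matched_def)

lemma tensor_span_carrier: "X \<in> tensor_span A B D \<Longrightarrow> X \<in> carrier (mtensor A B)"
  unfolding tensor_span_def using degree_span_matched[of A B D] by (force intro: tclass_carrier)

lemma tensor_span_induct [consumes 3, case_names zero tensor add]:
  assumes A: "bigr_closed A" and B: "bigr_closed B" and X: "X \<in> tensor_span A B D"
    and z: "P \<zero>\<^bsub>mtensor A B\<^esub>"
    and t: "\<And>\<alpha> \<gamma> \<beta> a b. (\<alpha>, \<gamma>, \<beta>) \<in> D \<Longrightarrow> a \<in> bigr A \<alpha> \<gamma> \<Longrightarrow> b \<in> bigr B \<gamma> \<beta> \<Longrightarrow> P (tensor A B a b)"
    and ad: "\<And>X Y. X \<in> carrier (mtensor A B) \<Longrightarrow> Y \<in> carrier (mtensor A B) \<Longrightarrow> P X \<Longrightarrow> P Y \<Longrightarrow>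
       P (X \<oplus>\<^bsub>mtensor A B\<^esub> Y)"
  shows "P X"
proof -
  obtain p where p: "X = tclass A B p" "Poly_Mapping.keys p \<subseteq> (\<Union>(\<alpha>, \<gamma>, \<beta>)\<in>D. bigr A \<alpha> \<gamma> \<times> bigr B \<gamma> \<beta>)"
    using X by (auto simp: tensor_span_def)
  from p(2) have "P (tclass A B p)"
  proof (induction p rule: poly_mapping_linear_induct)
    case zero
    then show ?case using z by (simp add: mtensor_zero)
  next
    case (single x c)
    then obtain a b \<alpha> \<gamma> \<beta> where x: "x = (a, b)" "(\<alpha>, \<gamma>, \<beta>) \<in> D" "a \<in> bigr A \<alpha> \<gamma>" "b \<in> bigr B \<gamma> \<beta>" by auto
    note ca = bigr_closedD(4)[OF A x(3), of c]
    show ?case unfolding x(1) tclass_single[OF x(3,4) ca] by (rule t[OF x(2) ca x(4)])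
  next
    case (add p q)
    then show ?case
      unfolding mtensor_add[symmetric] by (intro ad tclass_carrier order_trans[OF _ degree_span_matched])
  qed
  then show ?thesis by (simp add: p)
qed

lemmas mtensor_induct [consumes 3, case_names zero tensor add] =
  tensor_span_induct[where D = UNIV, simplified, folded mtensor_carrier_span]

lemma mtensor_bigr_induct [consumes 3, case_names zero tensor add]:
  assumes "bigr_closed A" "bigr_closed B" "X \<in> bigr (mtensor A B) \<alpha> \<beta>" "P \<zero>\<^bsub>mtensor A B\<^esub>"
    and "\<And>\<gamma> a b. a \<in> bigr A \<alpha> \<gamma> \<Longrightarrow> b \<in> bigr B \<gamma> \<beta> \<Longrightarrow> P (tensor A B a b)"
    and "\<And>X Y. X \<in> carrier (mtensor A B) \<Longrightarrow> Y \<in> carrier (mtensor A B) \<Longrightarrow> P X \<Longrightarrow> P Y \<Longrightarrow>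
       P (X \<oplus>\<^bsub>mtensor A B\<^esub> Y)"
  shows "P X"
  using assms(1-3) unfolding mtensor_bigr_span
  by (induction rule: tensor_span_induct) (auto intro: assms(4-6))

section \<open>Universal property of the matrix tensor product\<close>

locale tensor_lift = cvector_space C
  for A :: "('v::complex_fd_space, 'a, 'm) h_alg_scheme"
    and B :: "('v, 'b, 'n) h_alg_scheme"
    and C :: "('v, 'c, 'k) h_alg_scheme" (structure) +
  fixes \<phi> :: "'a \<Rightarrow> 'b \<Rightarrow> 'c"
  assumes bigr_closed_left: "bigr_closed A" and bigr_closed_right: "bigr_closed B"
    and balanced: "balanced C A B \<phi>"
begin

lemma matched_closed: "(x, y) \<in> matched A B \<Longrightarrow> \<phi> x y \<in> carrier C"
  using balancedD(1)[OF balanced] by (auto simp: matched_def)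

lemmas lin_ext_diff_matched = lin_ext_diff[where K = "matched A B", OF _ _ matched_closed]
lemmas lin_ext_add_matched = lin_ext_add[where K = "matched A B", OF _ _ matched_closed]
lemmas lin_ext_cscale_matched = lin_ext_cscale[where K = "matched A B", OF _ matched_closed]
lemmas lin_ext_closed_matched = lin_ext_closed[where K = "matched A B", OF _ matched_closed]

lemma lin_ext_single_matched:
  "(a, b) \<in> matched A B \<Longrightarrow> lin_ext C \<phi> (Poly_Mapping.single (a, b) c) = c \<odot> \<phi> a b"
  by (rule lin_ext_single) (rule matched_closed)

text \<open>This is the well-definedness of \<open>lift_tensor\<close>: each generator of the
  relations is killed by the matching clause of \<open>balanced\<close>, and linearity does the
  rest.\<close>

lemma lin_ext_rel: "p \<in> tensor_rel A B \<Longrightarrow> lin_ext C \<phi> p = \<zero>"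
proof (induction rule: tensor_rel.induct)
  case zero
  then show ?case by simp
next
  case (add p q)
  then show ?case
    by (simp add: lin_ext_add[of _ "matched A B"] matched_closed
        tensor_rel_keys[OF bigr_closed_left bigr_closed_right])
next
  case (smult p c)
  then show ?case using smult_r_null[of c]
    by (simp add: lin_ext_cscale[of _ "matched A B"] matched_closed
        tensor_rel_keys[OF bigr_closed_left bigr_closed_right])
next
  case (add_left a \<alpha> \<gamma> a' b \<beta>)
  let ?s = "\<lambda>x. Poly_Mapping.single x (1::complex)"
  have k: "(a, b) \<in> matched A B" "(a', b) \<in> matched A B" "(a \<oplus>\<^bsub>A\<^esub> a', b) \<in> matched A B"
    using add_left bigr_closedD(3)[OF bigr_closed_left add_left(1,2)] by (auto intro: matchedI)
  have "lin_ext C \<phi> (?s (a \<oplus>\<^bsub>A\<^esub> a', b) - ?s (a, b) - ?s (a', b)) =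
      \<phi> (a \<oplus>\<^bsub>A\<^esub> a') b \<ominus> \<phi> a b \<ominus> \<phi> a' b"
    using k by (simp add: lin_ext_diff_matched lin_ext_single_matched keys_diff_subset matched_closed)
  also have "\<dots> = \<zero>"
    using k matched_closed add_left balancedD(2)[OF balanced add_left(1,3,2)]
    by (simp add: a_minus_def a_ac r_neg r_neg1)
  finally show ?case .
next
  case (add_right a \<alpha> \<gamma> b \<beta> b')
  let ?s = "\<lambda>x. Poly_Mapping.single x (1::complex)"
  have k: "(a, b) \<in> matched A B" "(a, b') \<in> matched A B" "(a, b \<oplus>\<^bsub>B\<^esub> b') \<in> matched A B"
    using add_right bigr_closedD(3)[OF bigr_closed_right add_right(2,3)] by (auto intro: matchedI)
  have "lin_ext C \<phi> (?s (a, b \<oplus>\<^bsub>B\<^esub> b') - ?s (a, b) - ?s (a, b')) =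
      \<phi> a (b \<oplus>\<^bsub>B\<^esub> b') \<ominus> \<phi> a b \<ominus> \<phi> a b'"
    using k by (simp add: lin_ext_diff_matched lin_ext_single_matched keys_diff_subset matched_closed)
  also have "\<dots> = \<zero>"
    using k matched_closed add_right balancedD(3)[OF balanced add_right(1,2,3)]
    by (simp add: a_minus_def a_ac r_neg r_neg1)
  finally show ?case .
next
  case (smult_left a \<alpha> \<gamma> b \<beta> c)
  have k: "(a, b) \<in> matched A B" "(c \<odot>\<^bsub>A\<^esub> a, b) \<in> matched A B"
    using smult_left bigr_closedD(4)[OF bigr_closed_left smult_left(1)] by (auto intro: matchedI)
  show ?case using k matched_closed balancedD(4)[OF balanced smult_left]
    by (simp add: lin_ext_diff_matched lin_ext_single_matched a_minus_def r_neg)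
next
  case (smult_right a \<alpha> \<gamma> b \<beta> c)
  have k: "(a, b) \<in> matched A B" "(a, c \<odot>\<^bsub>B\<^esub> b) \<in> matched A B"
    using smult_right bigr_closedD(4)[OF bigr_closed_right smult_right(2)] by (auto intro: matchedI)
  show ?case using k matched_closed balancedD(5)[OF balanced smult_right]
    by (simp add: lin_ext_diff_matched lin_ext_single_matched a_minus_def r_neg)
next
  case (balance a \<alpha> \<gamma> b \<beta> f)
  have k: "(\<mu>\<^sub>r\<^bsub>A\<^esub> f \<otimes>\<^bsub>A\<^esub> a, b) \<in> matched A B" "(a, \<mu>\<^sub>l\<^bsub>B\<^esub> f \<otimes>\<^bsub>B\<^esub> b) \<in> matched A B"
    using balance bigr_closedD(6)[OF bigr_closed_left balance(1)]
      bigr_closedD(5)[OF bigr_closed_right balance(2)]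
    by (auto intro: matchedI)
  show ?case using k matched_closed balancedD(6)[OF balanced balance]
    by (simp add: lin_ext_diff_matched lin_ext_single_matched a_minus_def r_neg)
qed

text \<open>All representatives give the same value, so the image in the definition of
  \<open>lift_tensor\<close> is a singleton and \<open>the_elem\<close> picks its element.\<close>

lemma lift_tclass:
  assumes p: "Poly_Mapping.keys p \<subseteq> matched A B"
  shows "lift_tensor C \<phi> (tclass A B p) = lin_ext C \<phi> p"
proof -
  have "lin_ext C \<phi> q = lin_ext C \<phi> p" if "q \<in> tclass A B p" for q
  proof -
    have r: "q - p \<in> tensor_rel A B" using that by (simp add: tclass_def)
    have "lin_ext C \<phi> (p + (q - p)) = lin_ext C \<phi> p \<oplus> lin_ext C \<phi> (q - p)"
      using p tensor_rel_keys[OF bigr_closed_left bigr_closed_right r] matched_closed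
      by (intro lin_ext_add)
    then show ?thesis using lin_ext_rel[OF r] lin_ext_closed[OF p matched_closed] by simp
  qed
  then have "lin_ext C \<phi> ` tclass A B p = (\<lambda>_. lin_ext C \<phi> p) ` tclass A B p"
    by (rule image_cong[OF refl])
  then show ?thesis
    unfolding lift_tensor_def lin_ext_def[symmetric] by (simp add: image_constant[OF tclass_self])
qed

lemma lift_closed: "X \<in> carrier (mtensor A B) \<Longrightarrow> lift_tensor C \<phi> X \<in> carrier C"
  by (elim mtensor_carrierE) (simp add: lift_tclass lin_ext_closed_matched)

lemma lift_add:
  "X \<in> carrier (mtensor A B) \<Longrightarrow> Y \<in> carrier (mtensor A B) \<Longrightarrow>
   lift_tensor C \<phi> (X \<oplus>\<^bsub>mtensor A B\<^esub> Y) = lift_tensor C \<phi> X \<oplus> lift_tensor C \<phi> Y"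
  by (elim mtensor_carrierE) (simp add: mtensor_add lift_tclass keys_add_subset lin_ext_add_matched)

lemma lift_smult:
  "X \<in> carrier (mtensor A B) \<Longrightarrow> lift_tensor C \<phi> (c \<odot>\<^bsub>mtensor A B\<^esub> X) = c \<odot> lift_tensor C \<phi> X"
  by (elim mtensor_carrierE)
     (simp add: mtensor_smult lift_tclass order_trans[OF keys_cscale] lin_ext_cscale_matched)

lemma lift_zero: "lift_tensor C \<phi> \<zero>\<^bsub>mtensor A B\<^esub> = \<zero>"
  by (simp add: mtensor_zero lift_tclass)

lemma lift_tensor_tensor:
  "a \<in> bigr A \<alpha> \<gamma> \<Longrightarrow> b \<in> bigr B \<gamma> \<beta> \<Longrightarrow> lift_tensor C \<phi> (tensor A B a b) = \<phi> a b"
  using balancedD(1)[OF balanced]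
  by (simp add: tensor_matched lift_tclass matchedI lin_ext_single)

lemma clinear_lift: "clinear_on (mtensor A B) C (lift_tensor C \<phi>)"
  by (simp add: clinear_on_def lift_closed lift_add lift_smult)

end

section \<open>Naturality of induced maps and their dependence on the balanced map\<close>

lemma clinear_onD:
  assumes "clinear_on A B h"
  shows "x \<in> carrier A \<Longrightarrow> h x \<in> carrier B"
    "x \<in> carrier A \<Longrightarrow> y \<in> carrier A \<Longrightarrow> h (x \<oplus>\<^bsub>A\<^esub> y) = h x \<oplus>\<^bsub>B\<^esub> h y"
    "x \<in> carrier A \<Longrightarrow> h (c \<odot>\<^bsub>A\<^esub> x) = c \<odot>\<^bsub>B\<^esub> h x"
  using assms unfolding clinear_on_def by auto

lemma clinear_on_zero:
  assumes "clinear_on A B h" "cvector_space A" "cvector_space B"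
  shows "h \<zero>\<^bsub>A\<^esub> = \<zero>\<^bsub>B\<^esub>"
proof -
  interpret A: cvector_space A by fact
  interpret B: cvector_space B by fact
  have "h (0 \<odot>\<^bsub>A\<^esub> \<zero>\<^bsub>A\<^esub>) = 0 \<odot>\<^bsub>B\<^esub> h \<zero>\<^bsub>A\<^esub>" by (rule clinear_onD(3)[OF assms(1)]) simp
  then show ?thesis using clinear_onD(1)[OF assms(1), of "\<zero>\<^bsub>A\<^esub>"] by simp
qed

lemma balanced_comp:
  assumes "balanced C A B \<phi>" "clinear_on C C' h"
  shows "balanced C' A B (\<lambda>a b. h (\<phi> a b))"
  using assms(1) by (intro balancedI) (auto simp: balancedD clinear_onD[OF assms(2)] balancedD[OF assms(1)])

text \<open>Two linear maps that agree on pure tensors are equal. This is the rule by which a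
  factor, a projection, the antipode or the coproduct is moved into or out of a Sweedler
  sum.\<close>

lemma lift_comp:
  assumes "bigr_closed A" "bigr_closed B" "cvector_space C" "cvector_space C'"
    and \<phi>: "balanced C A B \<phi>" and h: "clinear_on C C' h"
    and X: "X \<in> carrier (mtensor A B)"
  shows "lift_tensor C' (\<lambda>a b. h (\<phi> a b)) X = h (lift_tensor C \<phi> X)"
proof -
  interpret L: tensor_lift A B C \<phi> using assms by (simp add: tensor_lift_def tensor_lift_axioms_def)
  interpret L': tensor_lift A B C' "\<lambda>a b. h (\<phi> a b)"
    using assms balanced_comp[OF \<phi> h] by (simp add: tensor_lift_def tensor_lift_axioms_def)
  show ?thesis using assms(1,2) X
  proof (induction rule: mtensor_induct)
    case zero
    then show ?case using assms by (simp add: L.lift_zero L'.lift_zero clinear_on_zero[OF h])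
  next
    case (tensor \<alpha> \<gamma> \<beta> a b)
    then show ?case by (simp add: L.lift_tensor_tensor L'.lift_tensor_tensor)
  next
    case (add X Y)
    then show ?case by (simp add: L.lift_add L'.lift_add clinear_onD[OF h] L.lift_closed)
  qed
qed

lemma tensor_liftI:
  "bigr_closed A \<Longrightarrow> bigr_closed B \<Longrightarrow> cvector_space C \<Longrightarrow> balanced C A B \<phi> \<Longrightarrow> tensor_lift A B C \<phi>"
  by (simp add: tensor_lift_def tensor_lift_axioms_def)

text \<open>The induced map depends additively on the balanced map. The relation between summands is
  demanded only in the degrees \<open>D\<close> in which \<open>X\<close> can be written, although
  each of the maps must be balanced in all degrees for its sum to exist.\<close>

lemma lift_fun_add:
  assumes bc: "bigr_closed A" "bigr_closed B" and C: "cvector_space C"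
    and \<phi>: "balanced C A B \<phi>" and \<psi>: "balanced C A B \<psi>" and \<theta>: "balanced C A B \<theta>"
    and eq: "\<And>\<alpha> \<gamma> \<beta> a b. (\<alpha>, \<gamma>, \<beta>) \<in> D \<Longrightarrow> a \<in> bigr A \<alpha> \<gamma> \<Longrightarrow> b \<in> bigr B \<gamma> \<beta> \<Longrightarrow>
      \<theta> a b = \<phi> a b \<oplus>\<^bsub>C\<^esub> \<psi> a b"
    and X: "X \<in> tensor_span A B D"
  shows "lift_tensor C \<theta> X = lift_tensor C \<phi> X \<oplus>\<^bsub>C\<^esub> lift_tensor C \<psi> X"
proof -
  interpret F: tensor_lift A B C \<phi> by (rule tensor_liftI[OF bc C \<phi>])
  interpret G: tensor_lift A B C \<psi> by (rule tensor_liftI[OF bc C \<psi>])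
  interpret H: tensor_lift A B C \<theta> by (rule tensor_liftI[OF bc C \<theta>])
  show ?thesis using bc X
  proof (induction rule: tensor_span_induct)
    case zero
    then show ?case by (simp add: F.lift_zero G.lift_zero H.lift_zero)
  next
    case (tensor \<alpha> \<gamma> \<beta> a b)
    then show ?case by (simp add: F.lift_tensor_tensor G.lift_tensor_tensor H.lift_tensor_tensor eq)
  next
    case (add X Y)
    then show ?case
      by (simp add: F.lift_add G.lift_add H.lift_add F.lift_closed G.lift_closed F.a_ac)
  qed
qed

lemma lift_fun_smult:
  assumes bc: "bigr_closed A" "bigr_closed B" and C: "cvector_space C"
    and \<phi>: "balanced C A B \<phi>" and \<psi>: "balanced C A B \<psi>"
    and eq: "\<And>\<alpha> \<gamma> \<beta> a b. (\<alpha>, \<gamma>, \<beta>) \<in> D \<Longrightarrow> a \<in> bigr A \<alpha> \<gamma> \<Longrightarrow> b \<in> bigr B \<gamma> \<beta> \<Longrightarrow>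
      \<psi> a b = c \<odot>\<^bsub>C\<^esub> \<phi> a b"
    and X: "X \<in> tensor_span A B D"
  shows "lift_tensor C \<psi> X = c \<odot>\<^bsub>C\<^esub> lift_tensor C \<phi> X"
proof -
  interpret F: tensor_lift A B C \<phi> by (rule tensor_liftI[OF bc C \<phi>])
  interpret G: tensor_lift A B C \<psi> by (rule tensor_liftI[OF bc C \<psi>])
  show ?thesis using bc X
  proof (induction rule: tensor_span_induct)
    case zero
    then show ?case using F.smult_r_null[of c] by (simp add: F.lift_zero G.lift_zero)
  next
    case (tensor \<alpha> \<gamma> \<beta> a b)
    then show ?case by (simp add: F.lift_tensor_tensor G.lift_tensor_tensor eq)
  next
    case (add X Y)
    then show ?case by (simp add: F.lift_add G.lift_add F.lift_closed F.smult_add_vec)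
  qed
qed

lemma lift_cong_span:
  assumes bc: "bigr_closed A" "bigr_closed B" and C: "cvector_space C"
    and \<phi>: "balanced C A B \<phi>" and \<psi>: "balanced C A B \<psi>"
    and eq: "\<And>\<alpha> \<gamma> \<beta> a b. (\<alpha>, \<gamma>, \<beta>) \<in> D \<Longrightarrow> a \<in> bigr A \<alpha> \<gamma> \<Longrightarrow> b \<in> bigr B \<gamma> \<beta> \<Longrightarrow> \<phi> a b = \<psi> a b"
    and X: "X \<in> tensor_span A B D"
  shows "lift_tensor C \<phi> X = lift_tensor C \<psi> X"
proof -
  interpret G: tensor_lift A B C \<psi> by (rule tensor_liftI[OF bc C \<psi>])
  have "X \<in> carrier (mtensor A B)" by (rule tensor_span_carrier[OF X])
  \<comment> \<open>Equality of summands is the case of the scalar 1 in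
    \<open>lift_fun_smult\<close>.\<close>
  moreover have "lift_tensor C \<phi> X = 1 \<odot>\<^bsub>C\<^esub> lift_tensor C \<psi> X"
    by (rule lift_fun_smult[OF bc C \<psi> \<phi> _ X]) (simp add: eq balancedD(1)[OF \<psi>])
  ultimately show ?thesis by (simp add: G.lift_closed)
qed

lemma lift_cong_carrier:
  assumes "bigr_closed A" "bigr_closed B" "cvector_space C" "balanced C A B \<phi>" "balanced C A B \<psi>"
    and "\<And>\<alpha> \<gamma> \<beta> a b. a \<in> bigr A \<alpha> \<gamma> \<Longrightarrow> b \<in> bigr B \<gamma> \<beta> \<Longrightarrow> \<phi> a b = \<psi> a b"
    and "X \<in> carrier (mtensor A B)"
  shows "lift_tensor C \<phi> X = lift_tensor C \<psi> X"
  by (rule lift_cong_span[OF assms(1-5) _ assms(7)[unfolded mtensor_carrier_span]]) (rule assms(6))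

text \<open>For homogeneous \<open>X\<close> the outer degrees of the summands are fixed and only
  the inner degree varies. Arguments in which a shift or a projection depends on the outer degrees
  rely on this form.\<close>

lemma lift_cong:
  assumes "bigr_closed A" "bigr_closed B" "cvector_space C" "balanced C A B \<phi>" "balanced C A B \<psi>"
    and "\<And>\<gamma> a b. a \<in> bigr A \<alpha> \<gamma> \<Longrightarrow> b \<in> bigr B \<gamma> \<beta> \<Longrightarrow> \<phi> a b = \<psi> a b"
    and "X \<in> bigr (mtensor A B) \<alpha> \<beta>"
  shows "lift_tensor C \<phi> X = lift_tensor C \<psi> X"
  by (rule lift_cong_span[OF assms(1-5) _ assms(7)[unfolded mtensor_bigr_span]]) (auto intro: assms(6))

lemma shift_shift: "shift \<alpha> (shift \<beta> f) = shift (\<alpha> + \<beta>) f"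
  by transfer (simp add: mero_rel_def is_mero_shift ae_eq_refl add.assoc)

lemma shift_zero: "shift 0 f = f"
  by transfer (simp add: mero_rel_def)

section \<open>Homogeneous elements\<close>

context h_algebra
begin

sublocale cvector_space A
  by (simp add: cvector_space_def module_axioms)

lemma bigr_in_carrier: "x \<in> bigr A \<alpha> \<beta> \<Longrightarrow> x \<in> carrier A"
  using bigr_carrier by blast

lemma lmom_carrier [simp, intro]: "\<mu>\<^sub>l f \<in> carrier A"
  using lmom_bigr bigr_in_carrier by blast

lemma rmom_carrier [simp, intro]: "\<mu>\<^sub>r f \<in> carrier A"
  using rmom_bigr bigr_in_carrier by blast

lemma mero_const_one: "mero_const 1 = 1"
  by transfer (simp add: mero_rel_def is_mero_const ae_eq_refl)

lemma mero_const_zero: "mero_const 0 = 0"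
  by transfer (simp add: mero_rel_def is_mero_const ae_eq_refl)

lemma lmom_one: "\<mu>\<^sub>l 1 = \<one>"
  using lmom_const[of 1] by (simp add: mero_const_one)

lemma rmom_one: "\<mu>\<^sub>r 1 = \<one>"
  using rmom_const[of 1] by (simp add: mero_const_one)

lemma one_bigr: "\<one> \<in> bigr A 0 0"
  using lmom_bigr[of 1] by (simp add: lmom_one)

lemma lmom_zero: "\<mu>\<^sub>l 0 = \<zero>"
  using lmom_const[of 0] by (simp add: mero_const_zero)

lemma rmom_zero: "\<mu>\<^sub>r 0 = \<zero>"
  using rmom_const[of 0] by (simp add: mero_const_zero)

lemma bigr_lmom_left: "x \<in> bigr A \<alpha> \<beta> \<Longrightarrow> \<mu>\<^sub>l f \<otimes> x \<in> bigr A \<alpha> \<beta>"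
  using bigr_mult[OF lmom_bigr[of f], of x \<alpha> \<beta>] by simp

lemma bigr_rmom_left: "x \<in> bigr A \<alpha> \<beta> \<Longrightarrow> \<mu>\<^sub>r f \<otimes> x \<in> bigr A \<alpha> \<beta>"
  using bigr_mult[OF rmom_bigr[of f], of x \<alpha> \<beta>] by simp

lemma bigr_lmom_right: "x \<in> bigr A \<alpha> \<beta> \<Longrightarrow> x \<otimes> \<mu>\<^sub>l f \<in> bigr A \<alpha> \<beta>"
  using bigr_mult[OF _ lmom_bigr[of f], of x \<alpha> \<beta>] by simp

lemma bigr_rmom_right: "x \<in> bigr A \<alpha> \<beta> \<Longrightarrow> x \<otimes> \<mu>\<^sub>r f \<in> bigr A \<alpha> \<beta>"
  using bigr_mult[OF _ rmom_bigr[of f], of x \<alpha> \<beta>] by simp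

lemma bigr_closed: "bigr_closed A"
  by (simp add: bigr_closed_def bigr_zero bigr_add bigr_smult bigr_in_carrier bigr_lmom_left bigr_rmom_left)

lemma lmom_comm': "a \<in> bigr A \<alpha> \<beta> \<Longrightarrow> a \<otimes> \<mu>\<^sub>l f = \<mu>\<^sub>l (shift (- \<alpha>) f) \<otimes> a"
  using lmom_comm[of a \<alpha> \<beta> "shift (- \<alpha>) f"] by (simp add: shift_shift shift_zero)

lemma rmom_comm': "a \<in> bigr A \<alpha> \<beta> \<Longrightarrow> a \<otimes> \<mu>\<^sub>r f = \<mu>\<^sub>r (shift (- \<beta>) f) \<otimes> a"
  using rmom_comm[of a \<alpha> \<beta> "shift (- \<beta>) f"] by (simp add: shift_shift shift_zero)

text \<open>Otherwise \<open>x\<close> would have two decompositions, each concentrated in a single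
  bidegree, against uniqueness.\<close>

lemma bigr_unique:
  assumes "x \<in> bigr A \<alpha> \<beta>" "x \<in> bigr A \<gamma> \<delta>" "x \<noteq> \<zero>"
  shows "\<alpha> = \<gamma> \<and> \<beta> = \<delta>"
proof -
  have dec: "decomposition A x (\<lambda>\<xi> \<eta>. if \<xi> = a \<and> \<eta> = b then x else \<zero>)" if "x \<in> bigr A a b" for a b
  proof -
    have "{(\<xi>, \<eta>). (if \<xi> = a \<and> \<eta> = b then x else \<zero>) \<noteq> \<zero>} = {(a, b)}" using assms(3) by auto
    then show ?thesis unfolding decomposition_def using that bigr_zero bigr_in_carrier[OF that]
      by simp
  qed
  have "(\<lambda>\<xi> \<eta>. if \<xi> = \<alpha> \<and> \<eta> = \<beta> then x else \<zero>) = (\<lambda>\<xi> \<eta>. if \<xi> = \<gamma> \<and> \<eta> = \<delta> then x else \<zero>)"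
    using direct_sum[OF bigr_in_carrier[OF assms(1)]] dec[OF assms(1)] dec[OF assms(2)] by auto
  from fun_cong[OF fun_cong[OF this, of \<alpha>], of \<beta>] show ?thesis
    using assms(3) by (auto split: if_splits)
qed

lemma carrier_induct [consumes 1, case_names homogeneous add]:
  assumes "x \<in> carrier A"
    and hom: "\<And>\<alpha> \<beta> x. x \<in> bigr A \<alpha> \<beta> \<Longrightarrow> P x"
    and add: "\<And>x y. x \<in> carrier A \<Longrightarrow> y \<in> carrier A \<Longrightarrow> P x \<Longrightarrow> P y \<Longrightarrow> P (x \<oplus> y)"
  shows "P x"
proof -
  obtain c where c: "decomposition A x c" using direct_sum[OF assms(1)] by blast
  define D where "D = {(\<alpha>, \<beta>). c \<alpha> \<beta> \<noteq> \<zero>}"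
  have fin: "finite D" and b: "\<And>\<alpha> \<beta>. c \<alpha> \<beta> \<in> bigr A \<alpha> \<beta>"
    and x: "x = (\<Oplus>d \<in> D. c (fst d) (snd d))"
    using c unfolding decomposition_def D_def by auto
  have car: "c \<alpha> \<beta> \<in> carrier A" for \<alpha> \<beta> using b bigr_in_carrier by blast
  from fin have "P (\<Oplus>d \<in> D. c (fst d) (snd d))"
  proof (induction D rule: finite_induct)
    case empty
    then show ?case using hom[OF bigr_zero] by simp
  next
    case (insert d D)
    then show ?case using car hom[OF b] by (auto intro!: add finsum_closed)
  qed
  then show ?thesis by (simp add: x)
qed

section \<open>Tensors of homogeneous elements with arbitrary inner degrees\<close>

abbreviation AA where "AA \<equiv> mtensor A A"

lemma tensor_zero_left: "b \<in> bigr A \<gamma> \<beta> \<Longrightarrow> tensor A A \<zero> b = \<zero>\<^bsub>AA\<^esub>"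
proof -
  assume b: "b \<in> bigr A \<gamma> \<beta>"
  interpret M: cvector_space AA by (rule mtensor_cvector_space)
  have "tensor A A (0 \<odot> \<zero>) b = 0 \<odot>\<^bsub>AA\<^esub> tensor A A \<zero> b"
    by (rule balancedD(4)[OF balanced_tensor[OF bigr_closed bigr_closed] bigr_zero b])
  then show ?thesis using tensor_carrier[of A A \<zero> b] by simp
qed

lemma tensor_zero_right: "a \<in> bigr A \<alpha> \<gamma> \<Longrightarrow> tensor A A a \<zero> = \<zero>\<^bsub>AA\<^esub>"
proof -
  assume a: "a \<in> bigr A \<alpha> \<gamma>"
  interpret M: cvector_space AA by (rule mtensor_cvector_space)
  have "tensor A A a (0 \<odot> \<zero>) = 0 \<odot>\<^bsub>AA\<^esub> tensor A A a \<zero>"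
    by (rule balancedD(5)[OF balanced_tensor[OF bigr_closed bigr_closed] a bigr_zero])
  then show ?thesis using tensor_carrier[of A A a \<zero>] by simp
qed

text \<open>Either the pair is not matched and \<open>tensor\<close> takes its default value, or it
  is matched through other degrees. Since a nonzero element has only one bidegree, some entry is
  then zero, and bilinearity applies.\<close>

lemma tensor_unmatched:
  assumes "a \<in> bigr A \<alpha> \<gamma>" "b \<in> bigr A \<delta> \<beta>" "\<gamma> \<noteq> \<delta>"
  shows "tensor A A a b = \<zero>\<^bsub>AA\<^esub>"
proof (cases "(a, b) \<in> matched A A")
  case True
  then obtain \<alpha>' \<gamma>' \<beta>' where m: "a \<in> bigr A \<alpha>' \<gamma>'" "b \<in> bigr A \<gamma>' \<beta>'" by (auto simp: matched_def)
  then have "a = \<zero> \<or> b = \<zero>" using assms bigr_unique by blast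
  then show ?thesis using assms tensor_zero_left tensor_zero_right by blast
next
  case False
  then show ?thesis by (simp add: tensor_def mtensor_zero)
qed

lemma tensor_hom_cases:
  assumes "a \<in> bigr A \<alpha> \<gamma>" "b \<in> bigr A \<delta> \<beta>"
  shows "tensor A A a b \<in> bigr AA \<alpha> \<beta>"
  using assms tensor_unmatched[OF assms] tensor_bigr[of a A \<alpha> \<gamma> b A \<beta>] mtensor_bigr_zero[OF bigr_closed bigr_closed]
  by metis

text \<open>The rules of \<open>balanced_tensor\<close> survive for unequal inner degrees because
  all terms vanish there. The last rule balances from the right: if the inner degrees agree, moving
  \<open>f\<close> to the left of \<open>a\<close> and of \<open>b\<close> shifts it by the same
  amount, so it reduces to balancing from the left.\<close>

lemma tensor_homogeneous:
  assumes a: "a \<in> bigr A \<alpha> \<gamma>" and b: "b \<in> bigr A \<delta> \<beta>"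
  shows "a' \<in> bigr A \<alpha> \<gamma> \<Longrightarrow> tensor A A (a \<oplus> a') b = tensor A A a b \<oplus>\<^bsub>AA\<^esub> tensor A A a' b"
    "b' \<in> bigr A \<delta> \<beta> \<Longrightarrow> tensor A A a (b \<oplus> b') = tensor A A a b \<oplus>\<^bsub>AA\<^esub> tensor A A a b'"
    "tensor A A (c \<odot> a) b = c \<odot>\<^bsub>AA\<^esub> tensor A A a b"
    "tensor A A a (c \<odot> b) = c \<odot>\<^bsub>AA\<^esub> tensor A A a b"
    "tensor A A (\<mu>\<^sub>r f \<otimes> a) b = tensor A A a (\<mu>\<^sub>l f \<otimes> b)"
    "tensor A A (a \<otimes> \<mu>\<^sub>r f) b = tensor A A a (b \<otimes> \<mu>\<^sub>l f)"
proof -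
  interpret M: cvector_space AA by (rule mtensor_cvector_space)
  note t = balancedD[OF balanced_tensor[OF bigr_closed bigr_closed] a]
  have z: "\<zero>\<^bsub>AA\<^esub> \<oplus>\<^bsub>AA\<^esub> \<zero>\<^bsub>AA\<^esub> = \<zero>\<^bsub>AA\<^esub>" "c \<odot>\<^bsub>AA\<^esub> \<zero>\<^bsub>AA\<^esub> = \<zero>\<^bsub>AA\<^esub>"
    using M.smult_r_null[of c] by auto
  show "a' \<in> bigr A \<alpha> \<gamma> \<Longrightarrow> tensor A A (a \<oplus> a') b = tensor A A a b \<oplus>\<^bsub>AA\<^esub> tensor A A a' b"
    using t(2)[of b \<beta> a'] a b z by (cases "\<gamma> = \<delta>") (auto simp: tensor_unmatched[OF _ b] tensor_unmatched[OF bigr_add[OF a] b])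
  show "b' \<in> bigr A \<delta> \<beta> \<Longrightarrow> tensor A A a (b \<oplus> b') = tensor A A a b \<oplus>\<^bsub>AA\<^esub> tensor A A a b'"
    using t(3)[of b \<beta> b'] a b z by (cases "\<gamma> = \<delta>") (auto simp: tensor_unmatched[OF a] tensor_unmatched[OF a bigr_add[OF b]])
  show "tensor A A (c \<odot> a) b = c \<odot>\<^bsub>AA\<^esub> tensor A A a b"
    using t(4)[of b \<beta>] a b z by (cases "\<gamma> = \<delta>") (auto simp: tensor_unmatched[OF a b] tensor_unmatched[OF bigr_smult[OF a] b])
  show "tensor A A a (c \<odot> b) = c \<odot>\<^bsub>AA\<^esub> tensor A A a b"
    using t(5)[of b \<beta>] a b z by (cases "\<gamma> = \<delta>") (auto simp: tensor_unmatched[OF a b] tensor_unmatched[OF a bigr_smult[OF b]])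
  have bal: "tensor A A (\<mu>\<^sub>r f \<otimes> a) b = tensor A A a (\<mu>\<^sub>l f \<otimes> b)" for f
    using t(6)[of b \<beta>] b tensor_unmatched[OF bigr_rmom_left[OF a] b] tensor_unmatched[OF a bigr_lmom_left[OF b]]
    by (cases "\<gamma> = \<delta>") auto
  show "tensor A A (\<mu>\<^sub>r f \<otimes> a) b = tensor A A a (\<mu>\<^sub>l f \<otimes> b)" by (rule bal)
  show "tensor A A (a \<otimes> \<mu>\<^sub>r f) b = tensor A A a (b \<otimes> \<mu>\<^sub>l f)"
  proof (cases "\<gamma> = \<delta>")
    case True
    then show ?thesis using bal by (simp add: rmom_comm'[OF a] lmom_comm'[OF b])
  next
    case False
    then show ?thesis
      using tensor_unmatched[OF bigr_rmom_right[OF a] b] tensor_unmatched[OF a bigr_lmom_right[OF b]] by simp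
  qed
qed

section \<open>The tensor square as an algebra\<close>

lemma free_mult_superset:
  assumes "finite K" "Poly_Mapping.keys p \<subseteq> K" "finite L" "Poly_Mapping.keys q \<subseteq> L"
  shows "free_mult A A p q = (\<Sum>x\<in>K. \<Sum>y\<in>L. Poly_Mapping.single (fst x \<otimes> fst y, snd x \<otimes> snd y)
    (Poly_Mapping.lookup p x * Poly_Mapping.lookup q y))"
proof -
  have "free_mult A A p q = (\<Sum>x\<in>Poly_Mapping.keys p. \<Sum>y\<in>Poly_Mapping.keys q.
      Poly_Mapping.single (fst x \<otimes> fst y, snd x \<otimes> snd y)
      (Poly_Mapping.lookup p x * Poly_Mapping.lookup q y))"
    by (simp add: free_mult_def split_beta)
  also have "\<dots> = (\<Sum>x\<in>Poly_Mapping.keys p. \<Sum>y\<in>L. Poly_Mapping.single (fst x \<otimes> fst y, snd x \<otimes> snd y)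
      (Poly_Mapping.lookup p x * Poly_Mapping.lookup q y))"
    using assms by (intro sum.cong refl sum.mono_neutral_left) (auto simp: in_keys_iff)
  also have "\<dots> = (\<Sum>x\<in>K. \<Sum>y\<in>L. Poly_Mapping.single (fst x \<otimes> fst y, snd x \<otimes> snd y)
      (Poly_Mapping.lookup p x * Poly_Mapping.lookup q y))"
    using assms by (intro sum.mono_neutral_left) (auto simp: in_keys_iff)
  finally show ?thesis .
qed

lemma free_mult_single:
  "free_mult A A (Poly_Mapping.single (a, b) c) (Poly_Mapping.single (a', b') c') =
   Poly_Mapping.single (a \<otimes> a', b \<otimes> b') (c * c')"
  using free_mult_superset[of "{(a, b)}" "Poly_Mapping.single (a, b) c" "{(a', b')}"
      "Poly_Mapping.single (a', b') c'"] by simp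

lemma free_mult_add_left: "free_mult A A (p + p') q = free_mult A A p q + free_mult A A p' q"
proof -
  let ?K = "Poly_Mapping.keys p \<union> Poly_Mapping.keys p'" and ?L = "Poly_Mapping.keys q"
  have K: "finite ?K" "Poly_Mapping.keys p \<subseteq> ?K" "Poly_Mapping.keys p' \<subseteq> ?K"
    "Poly_Mapping.keys (p + p') \<subseteq> ?K" "finite ?L" "Poly_Mapping.keys q \<subseteq> ?L"
    using Poly_Mapping.keys_add[of p p'] by auto
  show ?thesis
    unfolding free_mult_superset[OF K(1,4,5,6)] free_mult_superset[OF K(1,2,5,6)]
      free_mult_superset[OF K(1,3,5,6)]
    by (simp add: lookup_add distrib_right single_add sum.distrib)
qed

lemma free_mult_add_right: "free_mult A A q (p + p') = free_mult A A q p + free_mult A A q p'"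
proof -
  let ?K = "Poly_Mapping.keys p \<union> Poly_Mapping.keys p'" and ?L = "Poly_Mapping.keys q"
  have K: "finite ?K" "Poly_Mapping.keys p \<subseteq> ?K" "Poly_Mapping.keys p' \<subseteq> ?K"
    "Poly_Mapping.keys (p + p') \<subseteq> ?K" "finite ?L" "Poly_Mapping.keys q \<subseteq> ?L"
    using Poly_Mapping.keys_add[of p p'] by auto
  show ?thesis
    unfolding free_mult_superset[OF K(5,6,1,4)] free_mult_superset[OF K(5,6,1,2)]
      free_mult_superset[OF K(5,6,1,3)]
    by (simp add: lookup_add distrib_left single_add sum.distrib)
qed

lemma free_mult_zero: "free_mult A A 0 q = 0" "free_mult A A q 0 = 0"
  by (simp_all add: free_mult_def split_beta)

lemma free_mult_diff_left: "free_mult A A (p - p') q = free_mult A A p q - free_mult A A p' q"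
  using free_mult_add_left[of "p - p'" p' q] by (simp add: algebra_simps)

lemma free_mult_diff_right: "free_mult A A q (p - p') = free_mult A A q p - free_mult A A q p'"
  using free_mult_add_right[of q "p - p'" p'] by (simp add: algebra_simps)

lemma cscale_sum: "cscale c (sum f I) = (\<Sum>i\<in>I. cscale c (f i))"
  by (induction I rule: infinite_finite_induct) (auto simp: cscale_zero cscale_add_right)

lemma free_mult_cscale:
  "free_mult A A (cscale c p) q = cscale c (free_mult A A p q)"
  "free_mult A A p (cscale c q) = cscale c (free_mult A A p q)"
proof -
  have K: "finite (Poly_Mapping.keys p)" "Poly_Mapping.keys p \<subseteq> Poly_Mapping.keys p"
    "Poly_Mapping.keys (cscale c p) \<subseteq> Poly_Mapping.keys p"
    "finite (Poly_Mapping.keys q)" "Poly_Mapping.keys q \<subseteq> Poly_Mapping.keys q"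
    "Poly_Mapping.keys (cscale c q) \<subseteq> Poly_Mapping.keys q"
    by (simp_all add: keys_cscale)
  show "free_mult A A (cscale c p) q = cscale c (free_mult A A p q)"
    unfolding free_mult_superset[OF K(1,2,4,5)] free_mult_superset[OF K(1,3,4,5)]
    by (simp add: cscale_sum cscale_single lookup_cscale mult.assoc)
  show "free_mult A A p (cscale c q) = cscale c (free_mult A A p q)"
    unfolding free_mult_superset[OF K(1,2,4,5)] free_mult_superset[OF K(1,2,4,6)]
    by (simp add: cscale_sum cscale_single lookup_cscale mult_ac)
qed

lemma matched_mult: "(a, b) \<in> matched A A \<Longrightarrow> (c, d) \<in> matched A A \<Longrightarrow> (a \<otimes> c, b \<otimes> d) \<in> matched A A"
  by (auto simp: matched_def intro: bigr_mult)

lemma free_mult_keys: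
  assumes "Poly_Mapping.keys p \<subseteq> matched A A" "Poly_Mapping.keys q \<subseteq> matched A A"
  shows "Poly_Mapping.keys (free_mult A A p q) \<subseteq> matched A A"
  using assms(1)
proof (induction p rule: poly_mapping_linear_induct)
  case zero
  then show ?case by (simp add: free_mult_zero)
next
  case (single x c)
  show ?case using assms(2)
  proof (induction q rule: poly_mapping_linear_induct)
    case zero
    then show ?case by (simp add: free_mult_zero)
  next
    case (single y d)
    obtain a b where x: "x = (a, b)" by (cases x)
    obtain a' b' where y: "y = (a', b')" by (cases y)
    have "(a \<otimes> a', b \<otimes> b') \<in> matched A A"
      using matched_mult \<open>x \<in> _\<close> \<open>y \<in> _\<close> by (simp add: x y)
    then show ?case unfolding x y free_mult_single by (rule keys_single_subset)
  next
    case (add p q)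
    then show ?case by (simp add: free_mult_add_right keys_add_subset)
  qed
next
  case (add p q)
  then show ?case by (simp add: free_mult_add_left keys_add_subset)
qed

text \<open>Apart from distributivity, the point is the balancing relation multiplied from the left.
  The entries \<open>u\<close> and \<open>v\<close> share the inner degree \<gamma>', so moving the
  function past \<open>u\<close> on one side and past \<open>v\<close> on the other shifts it
  equally, and a balancing relation for the shifted function results.\<close>

lemma tensor_rel_single:
  assumes "p \<in> tensor_rel A A" "(u, v) \<in> matched A A"
  shows "free_mult A A p (Poly_Mapping.single (u, v) 1) \<in> tensor_rel A A"
    and "free_mult A A (Poly_Mapping.single (u, v) 1) p \<in> tensor_rel A A"
proof -
  let ?s = "Poly_Mapping.single (u, v) 1"
  obtain \<alpha>' \<gamma>' \<beta>' where uv: "u \<in> bigr A \<alpha>' \<gamma>'" "v \<in> bigr A \<gamma>' \<beta>'"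
    using assms(2) by (auto simp: matched_def)
  note car = bigr_in_carrier[OF uv(1)] bigr_in_carrier[OF uv(2)]
  note simps = free_mult_diff_left free_mult_diff_right free_mult_single car
    l_distr r_distr smult_mult_left smult_mult_right
  have "free_mult A A p ?s \<in> tensor_rel A A \<and> free_mult A A ?s p \<in> tensor_rel A A"
    using assms(1)
  proof (induction rule: tensor_rel.induct)
    case zero
    then show ?case by (simp add: free_mult_zero tensor_rel.zero)
  next
    case (add p q)
    then show ?case by (simp add: free_mult_add_left free_mult_add_right tensor_rel.add)
  next
    case (smult p c)
    then show ?case by (simp add: free_mult_cscale tensor_rel.smult)
  next
    case (add_left a \<alpha> \<gamma> a' b \<beta>)
    show ?case
      using tensor_rel.add_left[OF bigr_mult[OF add_left(1) uv(1)] bigr_mult[OF add_left(2) uv(1)]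
          bigr_mult[OF add_left(3) uv(2)]]
        tensor_rel.add_left[OF bigr_mult[OF uv(1) add_left(1)] bigr_mult[OF uv(1) add_left(2)]
          bigr_mult[OF uv(2) add_left(3)]]
        add_left[THEN bigr_in_carrier] by (simp add: simps)
  next
    case (add_right a \<alpha> \<gamma> b \<beta> b')
    show ?case
      using tensor_rel.add_right[OF bigr_mult[OF add_right(1) uv(1)] bigr_mult[OF add_right(2) uv(2)]
          bigr_mult[OF add_right(3) uv(2)]]
        tensor_rel.add_right[OF bigr_mult[OF uv(1) add_right(1)] bigr_mult[OF uv(2) add_right(2)]
          bigr_mult[OF uv(2) add_right(3)]]
        add_right[THEN bigr_in_carrier] by (simp add: simps)
  next
    case (smult_left a \<alpha> \<gamma> b \<beta> c)
    show ?case
      using tensor_rel.smult_left[OF bigr_mult[OF smult_left(1) uv(1)] bigr_mult[OF smult_left(2) uv(2)], of c]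
        tensor_rel.smult_left[OF bigr_mult[OF uv(1) smult_left(1)] bigr_mult[OF uv(2) smult_left(2)], of c]
        smult_left[THEN bigr_in_carrier] by (simp add: simps)
  next
    case (smult_right a \<alpha> \<gamma> b \<beta> c)
    show ?case
      using tensor_rel.smult_right[OF bigr_mult[OF smult_right(1) uv(1)] bigr_mult[OF smult_right(2) uv(2)], of c]
        tensor_rel.smult_right[OF bigr_mult[OF uv(1) smult_right(1)] bigr_mult[OF uv(2) smult_right(2)], of c]
        smult_right[THEN bigr_in_carrier] by (simp add: simps)
  next
    case (balance a \<alpha> \<gamma> b \<beta> f)
    have c: "a \<in> carrier A" "b \<in> carrier A" using balance[THEN bigr_in_carrier] .
    have "u \<otimes> (\<mu>\<^sub>r f \<otimes> a) = \<mu>\<^sub>r (shift (- \<gamma>') f) \<otimes> (u \<otimes> a)"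
      using c car by (simp flip: m_assoc add: rmom_comm'[OF uv(1)])
    moreover have "v \<otimes> (\<mu>\<^sub>l f \<otimes> b) = \<mu>\<^sub>l (shift (- \<gamma>') f) \<otimes> (v \<otimes> b)"
      using c car by (simp flip: m_assoc add: lmom_comm'[OF uv(2)])
    ultimately show ?case
      using tensor_rel.balance[OF bigr_mult[OF balance(1) uv(1)] bigr_mult[OF balance(2) uv(2)], of f]
        tensor_rel.balance[OF bigr_mult[OF uv(1) balance(1)] bigr_mult[OF uv(2) balance(2)], of "shift (- \<gamma>') f"] c
      by (simp add: simps m_assoc)
  qed
  then show "free_mult A A p ?s \<in> tensor_rel A A" "free_mult A A ?s p \<in> tensor_rel A A" by blast+
qed

lemma tensor_rel_ideal:
  assumes "p \<in> tensor_rel A A" "Poly_Mapping.keys q \<subseteq> matched A A"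
  shows "free_mult A A p q \<in> tensor_rel A A" "free_mult A A q p \<in> tensor_rel A A"
proof -
  have "free_mult A A p q \<in> tensor_rel A A \<and> free_mult A A q p \<in> tensor_rel A A"
    using assms(2)
  proof (induction q rule: poly_mapping_linear_induct)
    case zero
    then show ?case by (simp add: free_mult_zero tensor_rel.zero)
  next
    case (single x c)
    obtain u v where x: "x = (u, v)" by (cases x)
    have "Poly_Mapping.single x c = cscale c (Poly_Mapping.single (u, v) 1)"
      by (simp add: cscale_single x)
    then show ?case using tensor_rel_single[OF assms(1), of u v] single
      by (simp add: x free_mult_cscale tensor_rel.smult)
  next
    case (add p q)
    then show ?case by (simp add: free_mult_add_left free_mult_add_right tensor_rel.add)
  qed
  then show "free_mult A A p q \<in> tensor_rel A A" "free_mult A A q p \<in> tensor_rel A A" by blast+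
qed

text \<open>The relations form a two-sided ideal among the functions with matched support, so the
  product is independent of representatives by the usual splitting of p'q' - pq into p'(q' - q) and
  (p' - p)q.\<close>

lemma mtensor_mult:
  assumes p: "Poly_Mapping.keys p \<subseteq> matched A A" and q: "Poly_Mapping.keys q \<subseteq> matched A A"
  shows "tclass A A p \<otimes>\<^bsub>AA\<^esub> tclass A A q = tclass A A (free_mult A A p q)"
proof -
  have "tclass A A (free_mult A A p' q') = tclass A A (free_mult A A p q)"
    if "p' \<in> tclass A A p" "q' \<in> tclass A A q" for p' q'
  proof -
    have r: "p' - p \<in> tensor_rel A A" "q' - q \<in> tensor_rel A A" using that by (auto simp: tclass_def)
    \<comment> \<open>The ideal property requires matched support of the other factor;
      \<open>p'\<close> has it because it differs from \<open>p\<close> by a relation.\<close>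
    have "Poly_Mapping.keys (p + (p' - p)) \<subseteq> matched A A"
      by (rule keys_add_subset[OF p tensor_rel_keys[OF bigr_closed bigr_closed r(1)]])
    then have p': "Poly_Mapping.keys p' \<subseteq> matched A A" by simp
    have "free_mult A A p' q' - free_mult A A p q = free_mult A A p' (q' - q) + free_mult A A (p' - p) q"
      by (simp add: free_mult_diff_left free_mult_diff_right)
    then show ?thesis
      unfolding tclass_eq_iff
      using tensor_rel_ideal(2)[OF r(2) p'] tensor_rel_ideal(1)[OF r(1) q] tensor_rel.add by metis
  qed
  then have "tclass A A p \<otimes>\<^bsub>AA\<^esub> tclass A A q =
      (\<Union>p'\<in>tclass A A p. \<Union>q'\<in>tclass A A q. tclass A A (free_mult A A p q))"
    by (simp add: mtensor_def)
  then show ?thesis using tclass_self by blast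
qed

lemma tensor_mult:
  assumes "a \<in> bigr A \<alpha> \<gamma>" "b \<in> bigr A \<gamma> \<beta>" "c \<in> bigr A \<alpha>' \<gamma>'" "d \<in> bigr A \<gamma>' \<beta>'"
  shows "tensor A A a b \<otimes>\<^bsub>AA\<^esub> tensor A A c d = tensor A A (a \<otimes> c) (b \<otimes> d)"
  using mtensor_mult[OF keys_single_subset keys_single_subset, OF matchedI[OF assms(1,2)] matchedI[OF assms(3,4)], of 1 1]
  by (simp add: tensor_matched[OF assms(1,2)] tensor_matched[OF assms(3,4)] free_mult_single
      tensor_matched[OF bigr_mult[OF assms(1,3)] bigr_mult[OF assms(2,4)]])

lemma mtensor_one: "\<one>\<^bsub>AA\<^esub> = tensor A A \<one> \<one>"
  by (simp add: mtensor_def)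

lemma mtensor_lmom: "\<mu>\<^sub>l\<^bsub>AA\<^esub> f = tensor A A (\<mu>\<^sub>l f) \<one>"
  by (simp add: mtensor_def)

lemma mtensor_rmom: "\<mu>\<^sub>r\<^bsub>AA\<^esub> f = tensor A A \<one> (\<mu>\<^sub>r f)"
  by (simp add: mtensor_def)

lemma mtensor_mult_closed:
  "X \<in> carrier AA \<Longrightarrow> Y \<in> carrier AA \<Longrightarrow> X \<otimes>\<^bsub>AA\<^esub> Y \<in> carrier AA"
  by (elim mtensor_carrierE) (simp add: mtensor_mult free_mult_keys tclass_carrier)

lemma mtensor_distrib:
  assumes "X \<in> carrier AA" "Y \<in> carrier AA" "Z \<in> carrier AA"
  shows "(X \<oplus>\<^bsub>AA\<^esub> Y) \<otimes>\<^bsub>AA\<^esub> Z = X \<otimes>\<^bsub>AA\<^esub> Z \<oplus>\<^bsub>AA\<^esub> Y \<otimes>\<^bsub>AA\<^esub> Z"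
    "Z \<otimes>\<^bsub>AA\<^esub> (X \<oplus>\<^bsub>AA\<^esub> Y) = Z \<otimes>\<^bsub>AA\<^esub> X \<oplus>\<^bsub>AA\<^esub> Z \<otimes>\<^bsub>AA\<^esub> Y"
  using assms
  by (auto elim!: mtensor_carrierE
      simp: mtensor_mult mtensor_add keys_add_subset free_mult_add_left free_mult_add_right)

lemma mtensor_mult_smult:
  assumes "X \<in> carrier AA" "Y \<in> carrier AA"
  shows "(c \<odot>\<^bsub>AA\<^esub> X) \<otimes>\<^bsub>AA\<^esub> Y = c \<odot>\<^bsub>AA\<^esub> (X \<otimes>\<^bsub>AA\<^esub> Y)"
    "X \<otimes>\<^bsub>AA\<^esub> (c \<odot>\<^bsub>AA\<^esub> Y) = c \<odot>\<^bsub>AA\<^esub> (X \<otimes>\<^bsub>AA\<^esub> Y)"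
  using assms
  by (auto elim!: mtensor_carrierE
      simp: mtensor_mult mtensor_smult order_trans[OF keys_cscale] free_mult_cscale)

lemma mtensor_mult_zero:
  assumes "X \<in> carrier AA"
  shows "\<zero>\<^bsub>AA\<^esub> \<otimes>\<^bsub>AA\<^esub> X = \<zero>\<^bsub>AA\<^esub>" "X \<otimes>\<^bsub>AA\<^esub> \<zero>\<^bsub>AA\<^esub> = \<zero>\<^bsub>AA\<^esub>"
  using assms by (auto elim!: mtensor_carrierE simp: mtensor_mult mtensor_zero free_mult_zero)

lemma mtensor_assoc:
  assumes "X \<in> carrier AA" "Y \<in> carrier AA" "Z \<in> carrier AA"
  shows "X \<otimes>\<^bsub>AA\<^esub> Y \<otimes>\<^bsub>AA\<^esub> Z = X \<otimes>\<^bsub>AA\<^esub> (Y \<otimes>\<^bsub>AA\<^esub> Z)"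
  using bigr_closed bigr_closed assms(1)
proof (induction rule: mtensor_induct)
  case zero
  then show ?case using assms by (simp add: mtensor_mult_zero mtensor_mult_closed)
next
  case (add X X')
  then show ?case using assms by (simp add: mtensor_distrib mtensor_mult_closed)
next
  case (tensor \<alpha> \<gamma> \<beta> a b)
  note t1 = this
  show ?case using bigr_closed bigr_closed assms(2)
  proof (induction rule: mtensor_induct)
    case zero
    then show ?case using assms by (simp add: mtensor_mult_zero mtensor_mult_closed tensor_carrier)
  next
    case (add X X')
    then show ?case using assms by (simp add: mtensor_distrib mtensor_mult_closed tensor_carrier)
  next
    case (tensor \<alpha>' \<gamma>' \<beta>' a' b')
    note t2 = this
    show ?case using bigr_closed bigr_closed assms(3)
    proof (induction rule: mtensor_induct)
      case zero
      then show ?case using assms by (simp add: mtensor_mult_zero mtensor_mult_closed tensor_carrier)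
    next
      case (add X X')
      then show ?case using assms by (simp add: mtensor_distrib mtensor_mult_closed tensor_carrier)
    next
      case (tensor \<alpha>'' \<gamma>'' \<beta>'' a'' b'')
      show ?case
        using t1[THEN bigr_in_carrier] t2[THEN bigr_in_carrier] tensor[THEN bigr_in_carrier]
        by (simp add: tensor_mult[OF t1 t2] tensor_mult[OF t2 tensor] m_assoc
            tensor_mult[OF bigr_mult[OF t1(1) t2(1)] bigr_mult[OF t1(2) t2(2)] tensor]
            tensor_mult[OF t1 bigr_mult[OF t2(1) tensor(1)] bigr_mult[OF t2(2) tensor(2)]])
    qed
  qed
qed

lemma mtensor_mult_one:
  assumes "X \<in> carrier AA"
  shows "\<one>\<^bsub>AA\<^esub> \<otimes>\<^bsub>AA\<^esub> X = X \<and> X \<otimes>\<^bsub>AA\<^esub> \<one>\<^bsub>AA\<^esub> = X"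
  using bigr_closed bigr_closed assms
proof (induction rule: mtensor_induct)
  case zero
  then show ?case by (simp add: mtensor_mult_zero mtensor_one tensor_carrier)
next
  case (tensor \<alpha> \<gamma> \<beta> a b)
  then show ?case
    by (simp add: mtensor_one tensor_mult[OF one_bigr one_bigr tensor]
        tensor_mult[OF tensor one_bigr one_bigr] bigr_in_carrier)
next
  case (add X Y)
  then show ?case by (simp add: mtensor_distrib mtensor_one tensor_carrier)
qed

lemma mtensor_ring: "ring AA"
proof (rule ringI)
  interpret M: cvector_space AA by (rule mtensor_cvector_space)
  show "abelian_group AA" by (rule M.abelian_group_axioms)
  show "monoid AA"
    by (rule monoidI) (simp_all add: mtensor_mult_closed mtensor_assoc mtensor_mult_one[unfolded mtensor_one] mtensor_one tensor_carrier)
qed (simp_all add: mtensor_distrib)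

text \<open>For unequal inner degrees both sides are zero. The triple tensors in the coassociativity
  argument meet this case.\<close>

lemma mtensor_lmom_mult_tensor:
  assumes "a \<in> bigr A \<alpha> \<gamma>" "b \<in> bigr A \<delta> \<beta>"
  shows "\<mu>\<^sub>l\<^bsub>AA\<^esub> f \<otimes>\<^bsub>AA\<^esub> tensor A A a b = tensor A A (\<mu>\<^sub>l f \<otimes> a) b"
proof (cases "\<gamma> = \<delta>")
  case True
  then show ?thesis using assms bigr_in_carrier
    by (simp add: mtensor_lmom tensor_mult[OF lmom_bigr one_bigr])
next
  case False
  then show ?thesis using tensor_unmatched[OF assms] tensor_unmatched[OF bigr_lmom_left[OF assms(1)] assms(2)]
    by (simp add: mtensor_lmom mtensor_mult_zero tensor_carrier)
qed

lemma mtensor_rmom_mult_tensor: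
  assumes "a \<in> bigr A \<alpha> \<gamma>" "b \<in> bigr A \<delta> \<beta>"
  shows "\<mu>\<^sub>r\<^bsub>AA\<^esub> f \<otimes>\<^bsub>AA\<^esub> tensor A A a b = tensor A A a (\<mu>\<^sub>r f \<otimes> b)"
proof (cases "\<gamma> = \<delta>")
  case True
  then show ?thesis using assms bigr_in_carrier
    by (simp add: mtensor_rmom tensor_mult[OF one_bigr rmom_bigr])
next
  case False
  then show ?thesis using tensor_unmatched[OF assms] tensor_unmatched[OF assms(1) bigr_rmom_left[OF assms(2)]]
    by (simp add: mtensor_rmom mtensor_mult_zero tensor_carrier)
qed

lemma mtensor_mom_carrier: "\<mu>\<^sub>l\<^bsub>AA\<^esub> f \<in> carrier AA" "\<mu>\<^sub>r\<^bsub>AA\<^esub> f \<in> carrier AA"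
  by (simp_all add: mtensor_lmom mtensor_rmom tensor_carrier)

text \<open>This admits the tensor square as a factor of a further tensor product, so both
  bracketings of the triple product fall under the same theory.\<close>

lemma mtensor_bigr_closed: "bigr_closed AA"
proof -
  note c = mtensor_bigr_carrier[THEN subsetD]
  note z = mtensor_bigr_zero[OF bigr_closed bigr_closed]
  have "\<mu>\<^sub>l\<^bsub>AA\<^esub> f \<otimes>\<^bsub>AA\<^esub> X \<in> bigr AA \<alpha> \<beta> \<and> \<mu>\<^sub>r\<^bsub>AA\<^esub> f \<otimes>\<^bsub>AA\<^esub> X \<in> bigr AA \<alpha> \<beta>"
    if "X \<in> bigr AA \<alpha> \<beta>" for X \<alpha> \<beta> f
    using bigr_closed bigr_closed that
  proof (induction rule: mtensor_bigr_induct)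
    case zero
    then show ?case by (simp add: mtensor_mult_zero mtensor_mom_carrier z)
  next
    case (tensor \<gamma> a b)
    then show ?case
      by (simp add: mtensor_lmom_mult_tensor[OF tensor] mtensor_rmom_mult_tensor[OF tensor]
          tensor_bigr[OF bigr_lmom_left] tensor_bigr[OF _ bigr_rmom_left])
  next
    case (add X Y)
    then show ?case
      by (simp add: mtensor_distrib mtensor_mom_carrier mtensor_bigr_add[OF bigr_closed bigr_closed])
  qed
  then show ?thesis
    by (simp add: bigr_closed_def z c mtensor_bigr_add[OF bigr_closed bigr_closed]
        mtensor_bigr_smult[OF bigr_closed bigr_closed])
qed

end

context h_algebra
begin

section \<open>Iterated linear extensions\<close>

text \<open>For a map of two pairs, \<open>h1\<close> makes the sum over the inner pair meaningful,
  and \<open>h2\<close> transfers each balancing clause for the outer pair from the summands to the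
  sum.\<close>

lemma balanced_lift_param:
  assumes C: "cvector_space C"
    and h1: "\<And>\<alpha> \<gamma> \<beta> x y. x \<in> bigr A \<alpha> \<gamma> \<Longrightarrow> y \<in> bigr A \<gamma> \<beta> \<Longrightarrow> balanced C A A (\<Phi> x y)"
    and h2: "\<And>\<alpha> \<gamma> \<beta> x' y'. x' \<in> bigr A \<alpha> \<gamma> \<Longrightarrow> y' \<in> bigr A \<gamma> \<beta> \<Longrightarrow> balanced C A A (\<lambda>x y. \<Phi> x y x' y')"
    and Y: "Y \<in> carrier AA"
  shows "balanced C A A (\<lambda>x y. lift_tensor C (\<Phi> x y) Y)"
proof (rule balancedI)
  note bc = bigr_closed bigr_closed and Y' = Y[unfolded mtensor_carrier_span]
  fix \<alpha> \<gamma> \<beta> a b a' b' c f assume a: "a \<in> bigr A \<alpha> \<gamma>" and b: "b \<in> bigr A \<gamma> \<beta>"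
  show "lift_tensor C (\<Phi> a b) Y \<in> carrier C"
    by (rule tensor_lift.lift_closed[OF tensor_liftI[OF bc C h1[OF a b]] Y])
  show "lift_tensor C (\<Phi> (a \<oplus> a') b) Y = lift_tensor C (\<Phi> a b) Y \<oplus>\<^bsub>C\<^esub> lift_tensor C (\<Phi> a' b) Y"
    if a': "a' \<in> bigr A \<alpha> \<gamma>"
    by (rule lift_fun_add[OF bc C h1[OF a b] h1[OF a' b] h1[OF bigr_add[OF a a'] b] _ Y'])
       (rule balancedD(2)[OF h2 a b a'])
  show "lift_tensor C (\<Phi> a (b \<oplus> b')) Y = lift_tensor C (\<Phi> a b) Y \<oplus>\<^bsub>C\<^esub> lift_tensor C (\<Phi> a b') Y"
    if b': "b' \<in> bigr A \<gamma> \<beta>"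
    by (rule lift_fun_add[OF bc C h1[OF a b] h1[OF a b'] h1[OF a bigr_add[OF b b']] _ Y'])
       (rule balancedD(3)[OF h2 a b b'])
  show "lift_tensor C (\<Phi> (c \<odot> a) b) Y = c \<odot>\<^bsub>C\<^esub> lift_tensor C (\<Phi> a b) Y"
    by (rule lift_fun_smult[OF bc C h1[OF a b] h1[OF bigr_smult[OF a] b] _ Y']) (rule balancedD(4)[OF h2 a b])
  show "lift_tensor C (\<Phi> a (c \<odot> b)) Y = c \<odot>\<^bsub>C\<^esub> lift_tensor C (\<Phi> a b) Y"
    by (rule lift_fun_smult[OF bc C h1[OF a b] h1[OF a bigr_smult[OF b]] _ Y']) (rule balancedD(5)[OF h2 a b])
  show "lift_tensor C (\<Phi> (\<mu>\<^sub>r f \<otimes> a) b) Y = lift_tensor C (\<Phi> a (\<mu>\<^sub>l f \<otimes> b)) Y"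
    by (rule lift_cong_carrier[OF bc C h1[OF bigr_rmom_left[OF a] b] h1[OF a bigr_lmom_left[OF b]] _ Y])
       (rule balancedD(6)[OF h2 a b])
qed

text \<open>Fubini for two independent Sweedler sums: both sides are additive in \<open>X\<close>,
  and for a pure tensor the sum over \<open>X\<close> is a single value.\<close>

lemma lift_swap:
  assumes C: "cvector_space C"
    and h1: "\<And>\<alpha> \<gamma> \<beta> x y. x \<in> bigr A \<alpha> \<gamma> \<Longrightarrow> y \<in> bigr A \<gamma> \<beta> \<Longrightarrow> balanced C A A (\<Phi> x y)"
    and h2: "\<And>\<alpha> \<gamma> \<beta> x' y'. x' \<in> bigr A \<alpha> \<gamma> \<Longrightarrow> y' \<in> bigr A \<gamma> \<beta> \<Longrightarrow> balanced C A A (\<lambda>x y. \<Phi> x y x' y')"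
    and X: "X \<in> carrier AA" and Y: "Y \<in> carrier AA"
  shows "lift_tensor C (\<lambda>x y. lift_tensor C (\<Phi> x y) Y) X =
    lift_tensor C (\<lambda>x' y'. lift_tensor C (\<lambda>x y. \<Phi> x y x' y') X) Y"
proof -
  interpret C: cvector_space C by fact
  interpret AA: cvector_space AA by (rule mtensor_cvector_space)
  note bc = bigr_closed bigr_closed and Y' = Y[unfolded mtensor_carrier_span]
  note L = tensor_liftI[OF bc C]
  note p1 = balanced_lift_param[OF C h1 h2 Y]
  have p2: "balanced C A A (\<lambda>x' y'. lift_tensor C (\<lambda>x y. \<Phi> x y x' y') X)" if "X \<in> carrier AA" for X
    by (rule balanced_lift_param[OF C, of "\<lambda>x' y' x y. \<Phi> x y x' y'", OF h2 h1 that])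
  show ?thesis using bc X
  proof (induction rule: mtensor_induct)
    case zero
    \<comment> \<open>Every summand is zero, hence 0 times itself; in this form
      \<open>lift_fun_smult\<close> shows that the sum over \<open>Y\<close> vanishes.\<close>
    have "lift_tensor C (\<lambda>x' y'. lift_tensor C (\<lambda>x y. \<Phi> x y x' y') \<zero>\<^bsub>AA\<^esub>) Y =
        0 \<odot>\<^bsub>C\<^esub> lift_tensor C (\<lambda>x' y'. lift_tensor C (\<lambda>x y. \<Phi> x y x' y') \<zero>\<^bsub>AA\<^esub>) Y"
      by (rule lift_fun_smult[OF bc C p2 p2 _ Y']) (simp_all add: tensor_lift.lift_zero[OF L[OF h2]])
    then show ?case
      by (simp add: tensor_lift.lift_zero[OF L[OF p1]] tensor_lift.lift_closed[OF L[OF p2] Y])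
  next
    case (tensor \<alpha> \<gamma> \<beta> a b)
    have "lift_tensor C (\<lambda>x' y'. lift_tensor C (\<lambda>x y. \<Phi> x y x' y') (tensor A A a b)) Y =
        lift_tensor C (\<Phi> a b) Y"
      by (rule lift_cong_carrier[OF bc C p2[OF tensor_carrier] h1[OF tensor] _ Y])
         (rule tensor_lift.lift_tensor_tensor[OF L[OF h2] tensor])
    then show ?case by (simp add: tensor_lift.lift_tensor_tensor[OF L[OF p1] tensor])
  next
    case (add X X')
    have "lift_tensor C (\<lambda>x' y'. lift_tensor C (\<lambda>x y. \<Phi> x y x' y') (X \<oplus>\<^bsub>AA\<^esub> X')) Y =
        lift_tensor C (\<lambda>x' y'. lift_tensor C (\<lambda>x y. \<Phi> x y x' y') X) Y \<oplus>\<^bsub>C\<^esub>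
        lift_tensor C (\<lambda>x' y'. lift_tensor C (\<lambda>x y. \<Phi> x y x' y') X') Y"
      by (rule lift_fun_add[OF bc C p2[OF add(1)] p2[OF add(2)] p2[OF AA.a_closed[OF add(1,2)]] _ Y'])
         (rule tensor_lift.lift_add[OF L[OF h2] add(1,2)])
    then show ?case using add by (simp add: tensor_lift.lift_add[OF L[OF p1]])
  qed
qed

text \<open>Evaluates a trilinear map on tensors bracketed to the left. Assumption \<open>h\<close>
  ranges over all homogeneous \<open>c\<close>, whatever the right degree of \<open>b\<close>,
  because a representative of \<open>t\<close> may contain relations in degrees that do not match
  \<open>c\<close>. Balancing over the square works since its right moment map acts on the second
  factor only.\<close>

lemma balanced_lift_left:
  assumes C: "cvector_space C"
    and h: "\<And>\<delta> \<beta> c. c \<in> bigr A \<delta> \<beta> \<Longrightarrow> balanced C A A (\<lambda>a b. \<phi> a b c)"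
    and add: "\<And>\<alpha> \<gamma> \<delta> \<beta> a b c c'. a \<in> bigr A \<alpha> \<gamma> \<Longrightarrow> b \<in> bigr A \<gamma> \<delta> \<Longrightarrow> c \<in> bigr A \<delta> \<beta> \<Longrightarrow>
      c' \<in> bigr A \<delta> \<beta> \<Longrightarrow> \<phi> a b (c \<oplus> c') = \<phi> a b c \<oplus>\<^bsub>C\<^esub> \<phi> a b c'"
    and smult: "\<And>\<alpha> \<gamma> \<delta> \<beta> a b c k. a \<in> bigr A \<alpha> \<gamma> \<Longrightarrow> b \<in> bigr A \<gamma> \<delta> \<Longrightarrow> c \<in> bigr A \<delta> \<beta> \<Longrightarrow>
      \<phi> a b (k \<odot> c) = k \<odot>\<^bsub>C\<^esub> \<phi> a b c"
    and bal: "\<And>\<alpha> \<gamma> \<delta> \<beta> a b c f. a \<in> bigr A \<alpha> \<gamma> \<Longrightarrow> b \<in> bigr A \<gamma> \<delta> \<Longrightarrow> c \<in> bigr A \<delta> \<beta> \<Longrightarrow>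
      \<phi> a (\<mu>\<^sub>r f \<otimes> b) c = \<phi> a b (\<mu>\<^sub>l f \<otimes> c)"
  shows "balanced C AA A (\<lambda>t c. lift_tensor C (\<lambda>a b. \<phi> a b c) t)"
proof (rule balancedI)
  note bc = bigr_closed bigr_closed
  note L = tensor_liftI[OF bc C h]
  fix \<alpha> \<delta> \<beta> t c t' c' k f
  assume t: "t \<in> bigr AA \<alpha> \<delta>" and c: "c \<in> bigr A \<delta> \<beta>"
  note car = mtensor_bigr_carrier[THEN subsetD] and tspan = t[unfolded mtensor_bigr_span]
  note mc = bigr_lmom_left[OF c, of f]
  interpret L: tensor_lift A A C "\<lambda>a b. \<phi> a b c" by (rule L[OF c])
  interpret Lm: tensor_lift A A C "\<lambda>a b. \<phi> a b (\<mu>\<^sub>l f \<otimes> c)" by (rule L[OF mc])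
  show "lift_tensor C (\<lambda>a b. \<phi> a b c) t \<in> carrier C" by (rule L.lift_closed[OF car[OF t]])
  show "lift_tensor C (\<lambda>a b. \<phi> a b c) (t \<oplus>\<^bsub>AA\<^esub> t') =
      lift_tensor C (\<lambda>a b. \<phi> a b c) t \<oplus>\<^bsub>C\<^esub> lift_tensor C (\<lambda>a b. \<phi> a b c) t'" if "t' \<in> bigr AA \<alpha> \<delta>"
    by (rule L.lift_add[OF car[OF t] car[OF that]])
  show "lift_tensor C (\<lambda>a b. \<phi> a b c) (k \<odot>\<^bsub>AA\<^esub> t) = k \<odot>\<^bsub>C\<^esub> lift_tensor C (\<lambda>a b. \<phi> a b c) t"
    by (rule L.lift_smult[OF car[OF t]])
  show "lift_tensor C (\<lambda>a b. \<phi> a b (c \<oplus> c')) t =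
      lift_tensor C (\<lambda>a b. \<phi> a b c) t \<oplus>\<^bsub>C\<^esub> lift_tensor C (\<lambda>a b. \<phi> a b c') t" if c': "c' \<in> bigr A \<delta> \<beta>"
    by (rule lift_fun_add[OF bc C h[OF c] h[OF c'] h[OF bigr_add[OF c c']] _ tspan]) (use add[OF _ _ c c'] in auto)
  show "lift_tensor C (\<lambda>a b. \<phi> a b (k \<odot> c)) t = k \<odot>\<^bsub>C\<^esub> lift_tensor C (\<lambda>a b. \<phi> a b c) t"
    by (rule lift_fun_smult[OF bc C h[OF c] h[OF bigr_smult[OF c]] _ tspan]) (use smult[OF _ _ c] in auto)
  show "lift_tensor C (\<lambda>a b. \<phi> a b c) (\<mu>\<^sub>r\<^bsub>AA\<^esub> f \<otimes>\<^bsub>AA\<^esub> t) = lift_tensor C (\<lambda>a b. \<phi> a b (\<mu>\<^sub>l f \<otimes> c)) t"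
    using bc t
  proof (induction rule: mtensor_bigr_induct)
    case zero
    then show ?case by (simp add: L.lift_zero Lm.lift_zero mtensor_mult_zero mtensor_mom_carrier)
  next
    case (tensor \<gamma> a b)
    then show ?case using bal[OF tensor(1,2) c]
      by (simp add: mtensor_rmom_mult_tensor[OF tensor] Lm.lift_tensor_tensor[OF tensor]
          L.lift_tensor_tensor[OF tensor(1) bigr_rmom_left[OF tensor(2)]])
  next
    case (add X Y)
    then show ?case
      by (simp add: L.lift_add Lm.lift_add mtensor_distrib mtensor_mom_carrier mtensor_mult_closed)
  qed
qed

text \<open>The counterpart for bracketing to the right; here the left moment map of the square acts
  on the first factor of \<open>t\<close>.\<close>

lemma balanced_lift_right:
  assumes C: "cvector_space C"
    and h: "\<And>\<alpha> \<gamma> a. a \<in> bigr A \<alpha> \<gamma> \<Longrightarrow> balanced C A A (\<phi> a)"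
    and left: "\<And>\<delta> \<beta> c. c \<in> bigr A \<delta> \<beta> \<Longrightarrow> balanced C A A (\<lambda>a b. \<phi> a b c)"
  shows "balanced C A AA (\<lambda>a. lift_tensor C (\<phi> a))"
proof (rule balancedI)
  note bc = bigr_closed bigr_closed
  note L = tensor_liftI[OF bc C h]
  fix \<alpha> \<delta> \<beta> a t a' t' k f
  assume a: "a \<in> bigr A \<alpha> \<delta>" and t: "t \<in> bigr AA \<delta> \<beta>"
  note car = mtensor_bigr_carrier[THEN subsetD] and tspan = t[unfolded mtensor_bigr_span]
  note ma = bigr_rmom_left[OF a, of f]
  interpret L: tensor_lift A A C "\<phi> a" by (rule L[OF a])
  interpret Lm: tensor_lift A A C "\<phi> (\<mu>\<^sub>r f \<otimes> a)" by (rule L[OF ma])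
  show "lift_tensor C (\<phi> a) t \<in> carrier C" by (rule L.lift_closed[OF car[OF t]])
  show "lift_tensor C (\<phi> a) (t \<oplus>\<^bsub>AA\<^esub> t') = lift_tensor C (\<phi> a) t \<oplus>\<^bsub>C\<^esub> lift_tensor C (\<phi> a) t'"
    if "t' \<in> bigr AA \<delta> \<beta>"
    by (rule L.lift_add[OF car[OF t] car[OF that]])
  show "lift_tensor C (\<phi> a) (k \<odot>\<^bsub>AA\<^esub> t) = k \<odot>\<^bsub>C\<^esub> lift_tensor C (\<phi> a) t"
    by (rule L.lift_smult[OF car[OF t]])
  show "lift_tensor C (\<phi> (a \<oplus> a')) t = lift_tensor C (\<phi> a) t \<oplus>\<^bsub>C\<^esub> lift_tensor C (\<phi> a') t"
    if a': "a' \<in> bigr A \<alpha> \<delta>"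
    by (rule lift_fun_add[OF bc C h[OF a] h[OF a'] h[OF bigr_add[OF a a']] _ tspan])
       (use balancedD(2)[OF left a _ a'] in auto)
  show "lift_tensor C (\<phi> (k \<odot> a)) t = k \<odot>\<^bsub>C\<^esub> lift_tensor C (\<phi> a) t"
    by (rule lift_fun_smult[OF bc C h[OF a] h[OF bigr_smult[OF a]] _ tspan]) (use balancedD(4)[OF left a] in auto)
  show "lift_tensor C (\<phi> (\<mu>\<^sub>r f \<otimes> a)) t = lift_tensor C (\<phi> a) (\<mu>\<^sub>l\<^bsub>AA\<^esub> f \<otimes>\<^bsub>AA\<^esub> t)"
    using bc t
  proof (induction rule: mtensor_bigr_induct)
    case zero
    then show ?case by (simp add: L.lift_zero Lm.lift_zero mtensor_mult_zero mtensor_mom_carrier)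
  next
    case (tensor \<gamma> b c)
    then show ?case using balancedD(6)[OF left[OF tensor(2)] a tensor(1)]
      by (simp add: mtensor_lmom_mult_tensor[OF tensor] Lm.lift_tensor_tensor[OF tensor]
          L.lift_tensor_tensor[OF bigr_lmom_left[OF tensor(1)] tensor(2)])
  next
    case (add X Y)
    then show ?case
      by (simp add: L.lift_add Lm.lift_add mtensor_distrib mtensor_mom_carrier mtensor_mult_closed)
  qed
qed

text \<open>The entries of a matched pair share the inner degree \<gamma>, so a function that has to
  pass \<open>x\<close> in one slot and \<open>y\<close> in the other is shifted equally in both,
  and balancing is preserved.\<close>

lemma balanced_mult:
  assumes \<phi>: "balanced C A A \<phi>" and x: "x \<in> bigr A \<alpha> \<gamma>" and y: "y \<in> bigr A \<gamma> \<beta>"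
  shows "balanced C A A (\<lambda>u v. \<phi> (x \<otimes> u) (y \<otimes> v))" "balanced C A A (\<lambda>u v. \<phi> (u \<otimes> x) (v \<otimes> y))"
proof -
  note xy = bigr_in_carrier[OF x] bigr_in_carrier[OF y]
  show "balanced C A A (\<lambda>u v. \<phi> (x \<otimes> u) (y \<otimes> v))"
  proof (rule balancedI)
    fix \<alpha>' \<gamma>' \<beta>' u v u' v' c f assume u: "u \<in> bigr A \<alpha>' \<gamma>'" and v: "v \<in> bigr A \<gamma>' \<beta>'"
    note t = balancedD[OF \<phi> bigr_mult[OF x u] bigr_mult[OF y v]] and uv = bigr_in_carrier[OF u] bigr_in_carrier[OF v]
    show "\<phi> (x \<otimes> u) (y \<otimes> v) \<in> carrier C" by (rule t(1))
    show "\<phi> (x \<otimes> (u \<oplus> u')) (y \<otimes> v) = \<phi> (x \<otimes> u) (y \<otimes> v) \<oplus>\<^bsub>C\<^esub> \<phi> (x \<otimes> u') (y \<otimes> v)" if "u' \<in> bigr A \<alpha>' \<gamma>'"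
      using t(2)[OF bigr_mult[OF x that]] xy uv bigr_in_carrier[OF that] by (simp add: r_distr)
    show "\<phi> (x \<otimes> u) (y \<otimes> (v \<oplus> v')) = \<phi> (x \<otimes> u) (y \<otimes> v) \<oplus>\<^bsub>C\<^esub> \<phi> (x \<otimes> u) (y \<otimes> v')" if "v' \<in> bigr A \<gamma>' \<beta>'"
      using t(3)[OF bigr_mult[OF y that]] xy uv bigr_in_carrier[OF that] by (simp add: r_distr)
    show "\<phi> (x \<otimes> (c \<odot> u)) (y \<otimes> v) = c \<odot>\<^bsub>C\<^esub> \<phi> (x \<otimes> u) (y \<otimes> v)"
      "\<phi> (x \<otimes> u) (y \<otimes> (c \<odot> v)) = c \<odot>\<^bsub>C\<^esub> \<phi> (x \<otimes> u) (y \<otimes> v)"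
      using t(4,5) xy uv by (simp_all add: smult_mult_right)
    have "x \<otimes> (\<mu>\<^sub>r f \<otimes> u) = \<mu>\<^sub>r (shift (- \<gamma>) f) \<otimes> (x \<otimes> u)"
      using xy uv by (simp flip: m_assoc add: rmom_comm'[OF x])
    moreover have "y \<otimes> (\<mu>\<^sub>l f \<otimes> v) = \<mu>\<^sub>l (shift (- \<gamma>) f) \<otimes> (y \<otimes> v)"
      using xy uv by (simp flip: m_assoc add: lmom_comm'[OF y])
    ultimately show "\<phi> (x \<otimes> (\<mu>\<^sub>r f \<otimes> u)) (y \<otimes> v) = \<phi> (x \<otimes> u) (y \<otimes> (\<mu>\<^sub>l f \<otimes> v))"
      using t(6) by simp
  qed
  show "balanced C A A (\<lambda>u v. \<phi> (u \<otimes> x) (v \<otimes> y))"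
  proof (rule balancedI)
    fix \<alpha>' \<gamma>' \<beta>' u v u' v' c f assume u: "u \<in> bigr A \<alpha>' \<gamma>'" and v: "v \<in> bigr A \<gamma>' \<beta>'"
    note t = balancedD[OF \<phi> bigr_mult[OF u x] bigr_mult[OF v y]] and uv = bigr_in_carrier[OF u] bigr_in_carrier[OF v]
    show "\<phi> (u \<otimes> x) (v \<otimes> y) \<in> carrier C" by (rule t(1))
    show "\<phi> ((u \<oplus> u') \<otimes> x) (v \<otimes> y) = \<phi> (u \<otimes> x) (v \<otimes> y) \<oplus>\<^bsub>C\<^esub> \<phi> (u' \<otimes> x) (v \<otimes> y)" if "u' \<in> bigr A \<alpha>' \<gamma>'"
      using t(2)[OF bigr_mult[OF that x]] xy uv bigr_in_carrier[OF that] by (simp add: l_distr)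
    show "\<phi> (u \<otimes> x) ((v \<oplus> v') \<otimes> y) = \<phi> (u \<otimes> x) (v \<otimes> y) \<oplus>\<^bsub>C\<^esub> \<phi> (u \<otimes> x) (v' \<otimes> y)" if "v' \<in> bigr A \<gamma>' \<beta>'"
      using t(3)[OF bigr_mult[OF that y]] xy uv bigr_in_carrier[OF that] by (simp add: l_distr)
    show "\<phi> ((c \<odot> u) \<otimes> x) (v \<otimes> y) = c \<odot>\<^bsub>C\<^esub> \<phi> (u \<otimes> x) (v \<otimes> y)"
      "\<phi> (u \<otimes> x) ((c \<odot> v) \<otimes> y) = c \<odot>\<^bsub>C\<^esub> \<phi> (u \<otimes> x) (v \<otimes> y)"
      using t(4,5) xy uv by (simp_all add: smult_mult_left)
    show "\<phi> (\<mu>\<^sub>r f \<otimes> u \<otimes> x) (v \<otimes> y) = \<phi> (u \<otimes> x) (\<mu>\<^sub>l f \<otimes> v \<otimes> y)"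
      using t(6) xy uv by (simp add: m_assoc)
  qed
qed

text \<open>Turns a Sweedler sum over a coproduct of a product into a double sum over the two
  coproducts.\<close>

lemma lift_mult:
  assumes C: "cvector_space C" and \<phi>: "balanced C A A \<phi>"
    and X: "X \<in> carrier AA" and Y: "Y \<in> carrier AA"
  shows "lift_tensor C \<phi> (X \<otimes>\<^bsub>AA\<^esub> Y) =
    lift_tensor C (\<lambda>x y. lift_tensor C (\<lambda>x' y'. \<phi> (x \<otimes> x') (y \<otimes> y')) Y) X"
proof -
  interpret C: cvector_space C by fact
  note bc = bigr_closed bigr_closed
  interpret P: tensor_lift A A C \<phi> by (rule tensor_liftI[OF bc C \<phi>])
  interpret Q: tensor_lift A A C "\<lambda>x y. lift_tensor C (\<lambda>x' y'. \<phi> (x \<otimes> x') (y \<otimes> y')) Y"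
    by (rule tensor_liftI[OF bc C balanced_lift_param[OF C balanced_mult[OF \<phi>] Y]])
  show ?thesis using bc X
  proof (induction rule: mtensor_induct)
    case zero
    then show ?case using Y by (simp add: P.lift_zero Q.lift_zero mtensor_mult_zero)
  next
    case (tensor \<alpha> \<gamma> \<beta> x y)
    interpret R: tensor_lift A A C "\<lambda>x' y'. \<phi> (x \<otimes> x') (y \<otimes> y')"
      by (rule tensor_liftI[OF bc C balanced_mult(1)[OF \<phi> tensor]])
    have "lift_tensor C \<phi> (tensor A A x y \<otimes>\<^bsub>AA\<^esub> Y) = lift_tensor C (\<lambda>x' y'. \<phi> (x \<otimes> x') (y \<otimes> y')) Y"
      using bc Y
    proof (induction rule: mtensor_induct)
      case zero
      then show ?case by (simp add: P.lift_zero R.lift_zero mtensor_mult_zero tensor_carrier)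
    next
      case (tensor \<alpha>' \<gamma>' \<beta>' x' y')
      note t = \<open>x \<in> bigr A \<alpha> \<gamma>\<close> \<open>y \<in> bigr A \<gamma> \<beta>\<close>
      show ?case
        by (simp add: tensor_mult[OF t tensor] R.lift_tensor_tensor[OF tensor]
            P.lift_tensor_tensor[OF bigr_mult[OF t(1) tensor(1)] bigr_mult[OF t(2) tensor(2)]])
    next
      case (add X Y)
      then show ?case
        by (simp add: mtensor_distrib tensor_carrier mtensor_mult_closed P.lift_add R.lift_add)
    qed
    then show ?case by (simp add: Q.lift_tensor_tensor[OF tensor])
  next
    case (add X X')
    then show ?case using Y by (simp add: mtensor_distrib mtensor_mult_closed P.lift_add Q.lift_add)
  qed
qed

end

text \<open>Balanced maps may be pulled back along such maps. The notion covers the identity,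
  \<open>\<Delta>\<close> and \<open>\<epsilon>\<close> at once, as multiplicativity enters only
  through left multiplication by the moment maps.\<close>

definition hmod_hom ::
  "('v::complex_fd_space, 'a, 'm) h_alg_scheme \<Rightarrow> ('v, 'b, 'n) h_alg_scheme \<Rightarrow> ('a \<Rightarrow> 'b) \<Rightarrow> bool" where
  "hmod_hom A B h \<longleftrightarrow> (\<forall>\<alpha> \<beta>. \<forall>x\<in>bigr A \<alpha> \<beta>. h x \<in> bigr B \<alpha> \<beta> \<and>
     (\<forall>y\<in>bigr A \<alpha> \<beta>. h (x \<oplus>\<^bsub>A\<^esub> y) = h x \<oplus>\<^bsub>B\<^esub> h y) \<and> (\<forall>c. h (c \<odot>\<^bsub>A\<^esub> x) = c \<odot>\<^bsub>B\<^esub> h x) \<and>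
     (\<forall>f. h (\<mu>\<^sub>l\<^bsub>A\<^esub> f \<otimes>\<^bsub>A\<^esub> x) = \<mu>\<^sub>l\<^bsub>B\<^esub> f \<otimes>\<^bsub>B\<^esub> h x \<and> h (\<mu>\<^sub>r\<^bsub>A\<^esub> f \<otimes>\<^bsub>A\<^esub> x) = \<mu>\<^sub>r\<^bsub>B\<^esub> f \<otimes>\<^bsub>B\<^esub> h x))"

lemma hmod_homD:
  assumes "hmod_hom A B h" "x \<in> bigr A \<alpha> \<beta>"
  shows "h x \<in> bigr B \<alpha> \<beta>" "y \<in> bigr A \<alpha> \<beta> \<Longrightarrow> h (x \<oplus>\<^bsub>A\<^esub> y) = h x \<oplus>\<^bsub>B\<^esub> h y"
    "h (c \<odot>\<^bsub>A\<^esub> x) = c \<odot>\<^bsub>B\<^esub> h x" "h (\<mu>\<^sub>l\<^bsub>A\<^esub> f \<otimes>\<^bsub>A\<^esub> x) = \<mu>\<^sub>l\<^bsub>B\<^esub> f \<otimes>\<^bsub>B\<^esub> h x"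
    "h (\<mu>\<^sub>r\<^bsub>A\<^esub> f \<otimes>\<^bsub>A\<^esub> x) = \<mu>\<^sub>r\<^bsub>B\<^esub> f \<otimes>\<^bsub>B\<^esub> h x"
  using assms(1)[unfolded hmod_hom_def, rule_format, OF assms(2)] by blast+

lemma hmod_hom_id: "hmod_hom A A id"
  by (simp add: hmod_hom_def)

lemma balanced_hmod_hom:
  assumes \<phi>: "balanced C B B' \<phi>" and h: "hmod_hom A B h" and k: "hmod_hom A' B' k"
  shows "balanced C A A' (\<lambda>x y. \<phi> (h x) (k y))"
proof (rule balancedI)
  fix \<alpha> \<gamma> \<beta> a b a' b' c f
  assume a: "a \<in> bigr A \<alpha> \<gamma>" and b: "b \<in> bigr A' \<gamma> \<beta>"
  note t = balancedD[OF \<phi> hmod_homD(1)[OF h a] hmod_homD(1)[OF k b]]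
  note H = hmod_homD[OF h a] and K = hmod_homD[OF k b]
  show "\<phi> (h a) (k b) \<in> carrier C" by (rule t)
  show "\<phi> (h (a \<oplus>\<^bsub>A\<^esub> a')) (k b) = \<phi> (h a) (k b) \<oplus>\<^bsub>C\<^esub> \<phi> (h a') (k b)" if "a' \<in> bigr A \<alpha> \<gamma>"
    using t(2)[OF hmod_homD(1)[OF h that]] H(2)[OF that] by simp
  show "\<phi> (h a) (k (b \<oplus>\<^bsub>A'\<^esub> b')) = \<phi> (h a) (k b) \<oplus>\<^bsub>C\<^esub> \<phi> (h a) (k b')" if "b' \<in> bigr A' \<gamma> \<beta>"
    using t(3)[OF hmod_homD(1)[OF k that]] K(2)[OF that] by simp
  show "\<phi> (h (c \<odot>\<^bsub>A\<^esub> a)) (k b) = c \<odot>\<^bsub>C\<^esub> \<phi> (h a) (k b)" "\<phi> (h a) (k (c \<odot>\<^bsub>A'\<^esub> b)) = c \<odot>\<^bsub>C\<^esub> \<phi> (h a) (k b)"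
    using t(4,5) H(3) K(3) by simp_all
  show "\<phi> (h (\<mu>\<^sub>r\<^bsub>A\<^esub> f \<otimes>\<^bsub>A\<^esub> a)) (k b) = \<phi> (h a) (k (\<mu>\<^sub>l\<^bsub>A'\<^esub> f \<otimes>\<^bsub>A'\<^esub> b))"
    using t(6) H(5) K(4) by simp
qed

lemma (in h_algebra) h_hom_hmod_hom:
  assumes "\<phi> \<in> h_hom A B"
  shows "hmod_hom A B \<phi>"
proof -
  have "\<phi> ` bigr A \<alpha> \<beta> \<subseteq> bigr B \<alpha> \<beta>" for \<alpha> \<beta> using assms by (simp add: h_hom_def)
  then have "x \<in> bigr A \<alpha> \<beta> \<Longrightarrow> \<phi> x \<in> bigr B \<alpha> \<beta>" for x \<alpha> \<beta> by blast
  then show ?thesis using assms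
    unfolding hmod_hom_def h_hom_def ring_hom_def clinear_on_def by (auto simp: bigr_in_carrier)
qed

section \<open>Difference operators\<close>

lemma diff_alg_simps:
  "carrier D\<^sub>\<hh> = {diff_sum F f |F f. finite F}" "mult D\<^sub>\<hh> P Q = P \<circ> Q" "one D\<^sub>\<hh> = id"
  "add D\<^sub>\<hh> P Q = (\<lambda>g. P g + Q g)" "smult D\<^sub>\<hh> c P = (\<lambda>g. mero_const c * P g)"
  "zero D\<^sub>\<hh> = (\<lambda>_. 0)"
  "bigr D\<^sub>\<hh> \<alpha> \<beta> = (if \<alpha> = \<beta> then {\<lambda>g. f * shift (- \<beta>) g |f. True} else {\<lambda>_. 0})"
  "lmom D\<^sub>\<hh> f = (\<lambda>g. f * g)" "rmom D\<^sub>\<hh> f = (\<lambda>g. f * g)"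
  by (simp_all add: diff_alg_def)

lemma diff_alg_bigr_closed: "bigr_closed (D\<^sub>\<hh> :: ('v::complex_fd_space, 'v diff_op) h_alg)"
proof -
  have zc: "(\<lambda>_. 0 :: 'v mero) \<in> carrier D\<^sub>\<hh>"
    by (auto simp: diff_alg_simps diff_sum_def intro!: exI[of _ "{}"])
  have car: "(\<lambda>g. f * shift (- \<beta>) g) \<in> carrier D\<^sub>\<hh>" for f :: "'v mero" and \<beta>
    by (auto simp: diff_alg_simps diff_sum_def intro!: exI[of _ "{- \<beta>}"] exI[of _ "\<lambda>_. f"])
  show ?thesis
    unfolding bigr_closed_def
  proof (intro allI conjI ballI)
    fix \<alpha> \<beta> :: 'v and x
    show "\<zero>\<^bsub>D\<^sub>\<hh>\<^esub> \<in> bigr D\<^sub>\<hh> \<alpha> \<beta>"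
      by (auto simp: diff_alg_simps intro!: exI[of _ "0 :: 'v mero"])
    assume x: "x \<in> bigr (D\<^sub>\<hh> :: ('v, 'v diff_op) h_alg) \<alpha> \<beta>"
    then show "x \<in> carrier D\<^sub>\<hh>" using zc car by (auto simp: diff_alg_simps(7) split: if_splits)
    show "x \<oplus>\<^bsub>D\<^sub>\<hh>\<^esub> y \<in> bigr D\<^sub>\<hh> \<alpha> \<beta>" if y: "y \<in> bigr D\<^sub>\<hh> \<alpha> \<beta>" for y
    proof (cases "\<alpha> = \<beta>")
      case True
      then obtain f g where "x = (\<lambda>h. f * shift (- \<beta>) h)" "y = (\<lambda>h. g * shift (- \<beta>) h)"
        using x y by (auto simp: diff_alg_simps)
      then show ?thesis using True by (auto simp: diff_alg_simps algebra_simps intro!: exI[of _ "f + g"])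
    qed (use x y in \<open>auto simp: diff_alg_simps\<close>)
    have "(\<lambda>g. k * x g) \<in> bigr D\<^sub>\<hh> \<alpha> \<beta>" for k
    proof (cases "\<alpha> = \<beta>")
      case True
      then obtain f where "x = (\<lambda>h. f * shift (- \<beta>) h)" using x by (auto simp: diff_alg_simps)
      then show ?thesis using True by (auto simp: diff_alg_simps algebra_simps intro!: exI[of _ "k * f"])
    qed (use x in \<open>auto simp: diff_alg_simps\<close>)
    then show "c \<odot>\<^bsub>D\<^sub>\<hh>\<^esub> x \<in> bigr D\<^sub>\<hh> \<alpha> \<beta>" "\<mu>\<^sub>l\<^bsub>D\<^sub>\<hh>\<^esub> k \<otimes>\<^bsub>D\<^sub>\<hh>\<^esub> x \<in> bigr D\<^sub>\<hh> \<alpha> \<beta>" "\<mu>\<^sub>r\<^bsub>D\<^sub>\<hh>\<^esub> k \<otimes>\<^bsub>D\<^sub>\<hh>\<^esub> x \<in> bigr D\<^sub>\<hh> \<alpha> \<beta>" for c k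
      by (simp_all add: diff_alg_simps o_def)
  qed
qed

lemma shift_mult: "shift \<alpha> (f * g) = shift \<alpha> f * shift \<alpha> g"
  by transfer (auto simp: mero_rel_def intro!: is_mero_mult is_mero_shift ae_eq_refl)

lemma shift_add: "shift \<alpha> (f + g) = shift \<alpha> f + shift \<alpha> g"
  by transfer (auto simp: mero_rel_def intro!: is_mero_add is_mero_shift ae_eq_refl)

lemma shift_one [simp]: "shift \<alpha> 1 = 1"
  by transfer (auto simp: mero_rel_def intro!: is_mero_const ae_eq_refl)

lemma shift_0 [simp]: "shift \<alpha> 0 = 0"
  by transfer (auto simp: mero_rel_def intro!: is_mero_const ae_eq_refl)

lemma shift_mero_const [simp]: "shift \<alpha> (mero_const c) = mero_const c"
  by transfer (auto simp: mero_rel_def intro!: is_mero_const ae_eq_refl)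

context h_algebra
begin

lemma lmom_mult_smult: "x \<in> carrier A \<Longrightarrow> \<mu>\<^sub>l (mero_const c * f) \<otimes> x = c \<odot> (\<mu>\<^sub>l f \<otimes> x)"
  by (simp add: lmom_mult lmom_const smult_mult_left)

lemma rmom_mult_smult: "x \<in> carrier A \<Longrightarrow> \<mu>\<^sub>r (mero_const c * f) \<otimes> x = c \<odot> (\<mu>\<^sub>r f \<otimes> x)"
  by (simp add: rmom_mult rmom_const smult_mult_left)

text \<open>Inverses of the canonical isomorphisms \<open>x \<simeq> T\<^sub>-\<^sub>\<alpha> \<otimes> x \<simeq> x \<otimes> T\<^sub>-\<^sub>\<beta>\<close>: the coefficient of a homogeneous
  difference operator is its value at \<open>1\<close>.\<close>

lemma balanced_diff_left: "balanced A D\<^sub>\<hh> A (\<lambda>P y. \<mu>\<^sub>l (P 1) \<otimes> y)"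
proof (rule balancedI)
  fix \<alpha> \<gamma> \<beta> and P P' :: "'v diff_op" and b b' c f
  assume "b \<in> bigr A \<gamma> \<beta>"
  then have b: "b \<in> carrier A" by (rule bigr_in_carrier)
  then show "\<mu>\<^sub>l (P 1) \<otimes> b \<in> carrier A" by simp
  show "\<mu>\<^sub>l ((P \<oplus>\<^bsub>D\<^sub>\<hh>\<^esub> P') 1) \<otimes> b = \<mu>\<^sub>l (P 1) \<otimes> b \<oplus> \<mu>\<^sub>l (P' 1) \<otimes> b"
    using b by (simp add: diff_alg_simps lmom_add l_distr)
  show "b' \<in> bigr A \<gamma> \<beta> \<Longrightarrow> \<mu>\<^sub>l (P 1) \<otimes> (b \<oplus> b') = \<mu>\<^sub>l (P 1) \<otimes> b \<oplus> \<mu>\<^sub>l (P 1) \<otimes> b'"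
    using b by (simp add: bigr_in_carrier r_distr)
  show "\<mu>\<^sub>l ((c \<odot>\<^bsub>D\<^sub>\<hh>\<^esub> P) 1) \<otimes> b = c \<odot> (\<mu>\<^sub>l (P 1) \<otimes> b)"
    using b by (simp add: diff_alg_simps lmom_mult_smult)
  show "\<mu>\<^sub>l (P 1) \<otimes> (c \<odot> b) = c \<odot> (\<mu>\<^sub>l (P 1) \<otimes> b)"
    using b by (simp add: smult_mult_right)
  show "\<mu>\<^sub>l ((\<mu>\<^sub>r\<^bsub>D\<^sub>\<hh>\<^esub> f \<otimes>\<^bsub>D\<^sub>\<hh>\<^esub> P) 1) \<otimes> b = \<mu>\<^sub>l (P 1) \<otimes> (\<mu>\<^sub>l f \<otimes> b)"
    using b by (simp add: diff_alg_simps mult.commute[of f] lmom_mult m_assoc)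
qed

lemma balanced_diff_right: "balanced A A D\<^sub>\<hh> (\<lambda>x P. \<mu>\<^sub>r (P 1) \<otimes> x)"
proof (rule balancedI)
  fix \<alpha> \<gamma> \<beta> and P P' :: "'v diff_op" and b b' c f
  assume "b \<in> bigr A \<alpha> \<gamma>"
  then have b: "b \<in> carrier A" by (rule bigr_in_carrier)
  then show "\<mu>\<^sub>r (P 1) \<otimes> b \<in> carrier A" by simp
  show "\<mu>\<^sub>r ((P \<oplus>\<^bsub>D\<^sub>\<hh>\<^esub> P') 1) \<otimes> b = \<mu>\<^sub>r (P 1) \<otimes> b \<oplus> \<mu>\<^sub>r (P' 1) \<otimes> b"
    using b by (simp add: diff_alg_simps rmom_add l_distr)
  show "b' \<in> bigr A \<alpha> \<gamma> \<Longrightarrow> \<mu>\<^sub>r (P 1) \<otimes> (b \<oplus> b') = \<mu>\<^sub>r (P 1) \<otimes> b \<oplus> \<mu>\<^sub>r (P 1) \<otimes> b'"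
    using b by (simp add: bigr_in_carrier r_distr)
  show "\<mu>\<^sub>r ((c \<odot>\<^bsub>D\<^sub>\<hh>\<^esub> P) 1) \<otimes> b = c \<odot> (\<mu>\<^sub>r (P 1) \<otimes> b)"
    using b by (simp add: diff_alg_simps rmom_mult_smult)
  show "\<mu>\<^sub>r (P 1) \<otimes> (c \<odot> b) = c \<odot> (\<mu>\<^sub>r (P 1) \<otimes> b)"
    using b by (simp add: smult_mult_right)
  show "\<mu>\<^sub>r (P 1) \<otimes> (\<mu>\<^sub>r f \<otimes> b) = \<mu>\<^sub>r ((\<mu>\<^sub>l\<^bsub>D\<^sub>\<hh>\<^esub> f \<otimes>\<^bsub>D\<^sub>\<hh>\<^esub> P) 1) \<otimes> b"
    using b by (simp add: diff_alg_simps mult.commute[of f] rmom_mult m_assoc)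
qed

end

section \<open>Sweedler sums in a bialgebroid\<close>

context h_bialgebroid
begin

lemma comult_hmod_hom: "hmod_hom A AA \<Delta>"
  by (rule h_hom_hmod_hom[OF comult_hom])

lemma counit_hmod_hom: "hmod_hom A D\<^sub>\<hh> \<epsilon>"
  by (rule h_hom_hmod_hom[OF counit_hom])

lemma comult_clinear: "clinear_on A AA \<Delta>"
  using comult_hom by (simp add: h_hom_def)

lemma comult_carrier: "a \<in> carrier A \<Longrightarrow> \<Delta> a \<in> carrier AA"
  using clinear_onD[OF comult_clinear] by blast

lemma comult_mult: "a \<in> carrier A \<Longrightarrow> b \<in> carrier A \<Longrightarrow> \<Delta> (a \<otimes> b) = \<Delta> a \<otimes>\<^bsub>AA\<^esub> \<Delta> b"
  using comult_hom by (simp add: h_hom_def ring_hom_def)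

lemma comult_one: "\<Delta> \<one> = tensor A A \<one> \<one>"
  using comult_hom by (simp add: h_hom_def ring_hom_def mtensor_one)

lemma comult_lmom: "\<Delta> (\<mu>\<^sub>l f) = tensor A A (\<mu>\<^sub>l f) \<one>"
  using comult_hom by (simp add: h_hom_def mtensor_lmom)

lemma comult_rmom: "\<Delta> (\<mu>\<^sub>r f) = tensor A A \<one> (\<mu>\<^sub>r f)"
  using comult_hom by (simp add: h_hom_def mtensor_rmom)

lemma counit_one: "\<epsilon> \<one> = id"
  using counit_hom by (simp add: h_hom_def ring_hom_def diff_alg_simps)

lemma counit_mult: "a \<in> carrier A \<Longrightarrow> b \<in> carrier A \<Longrightarrow> \<epsilon> (a \<otimes> b) = \<epsilon> a \<circ> \<epsilon> b"
  using counit_hom by (simp add: h_hom_def ring_hom_def diff_alg_simps)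

lemma counit_add: "a \<in> carrier A \<Longrightarrow> b \<in> carrier A \<Longrightarrow> \<epsilon> (a \<oplus> b) = (\<lambda>g. \<epsilon> a g + \<epsilon> b g)"
  using counit_hom by (simp add: h_hom_def ring_hom_def diff_alg_simps)

lemma counit_smult: "a \<in> carrier A \<Longrightarrow> \<epsilon> (c \<odot> a) 1 = mero_const c * \<epsilon> a 1"
  using counit_hom by (simp add: h_hom_def clinear_on_def diff_alg_simps)

lemma counit_lmom: "\<epsilon> (\<mu>\<^sub>l f) = (\<lambda>g. f * g)"
  using counit_hom by (simp add: h_hom_def diff_alg_simps)

lemma counit_rmom: "\<epsilon> (\<mu>\<^sub>r f) = (\<lambda>g. f * g)"
  using counit_hom by (simp add: h_hom_def diff_alg_simps)

text \<open>The difference operators live in diagonal degrees, and there an operator is its value at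
  1 times a fixed shift. The vanishing off the diagonal is behind all later case distinctions on
  whether two degrees agree.\<close>

lemma counit_homogeneous:
  assumes "a \<in> bigr A \<alpha> \<beta>"
  shows "\<epsilon> a = (\<lambda>g. \<epsilon> a 1 * shift (- \<beta>) g)" "\<alpha> \<noteq> \<beta> \<Longrightarrow> \<epsilon> a = (\<lambda>_. 0)"
  using hmod_homD(1)[OF counit_hmod_hom assms]
  by (auto simp: diff_alg_simps split: if_splits)

lemma counit_mult_one:
  assumes "a \<in> bigr A \<alpha> \<beta>" "b \<in> carrier A"
  shows "\<epsilon> (a \<otimes> b) 1 = \<epsilon> a 1 * shift (- \<beta>) (\<epsilon> b 1)"
  using counit_mult[OF bigr_in_carrier[OF assms(1)] assms(2)] fun_cong[OF counit_homogeneous(1)[OF assms(1)], of "\<epsilon> b 1"]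
  by simp

lemma clinear_sweedler:
  assumes "cvector_space C" "balanced C A A \<phi>"
  shows "clinear_on A C (\<lambda>a. lift_tensor C \<phi> (\<Delta> a))"
proof -
  interpret L: tensor_lift A A C \<phi> by (rule tensor_liftI[OF bigr_closed bigr_closed assms])
  show ?thesis
    using clinear_onD[OF comult_clinear] clinear_onD[OF L.clinear_lift] by (auto simp: clinear_on_def)
qed

section \<open>Counit and coassociativity axioms in terms of Sweedler sums\<close>

lemma cvector_space: "cvector_space A"
  by (rule cvector_space_axioms)

lemma balanced_counit_left: "balanced A A A (\<lambda>x y. \<mu>\<^sub>l (\<epsilon> x 1) \<otimes> y)"
  using balanced_hmod_hom[OF balanced_diff_left counit_hmod_hom hmod_hom_id[of A]] by simp

lemma balanced_counit_right: "balanced A A A (\<lambda>x y. \<mu>\<^sub>r (\<epsilon> y 1) \<otimes> x)"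
  using balanced_hmod_hom[OF balanced_diff_right hmod_hom_id[of A] counit_hmod_hom] by simp

text \<open>The inverse of the canonical isomorphism is applied to both sides of the counit axiom.
  On the right it returns \<open>a\<close> itself, because a pure shift has value 1 at 1.\<close>

lemma counit_sum_left:
  assumes "a \<in> carrier A"
  shows "lift_tensor A (\<lambda>x y. \<mu>\<^sub>l (\<epsilon> x 1) \<otimes> y) (\<Delta> a) = a"
proof -
  note D = diff_alg_bigr_closed and bc = bigr_closed
  interpret L: tensor_lift "D\<^sub>\<hh>" A A "\<lambda>P y. \<mu>\<^sub>l (P 1) \<otimes> y"
    by (rule tensor_liftI[OF D bc cvector_space balanced_diff_left])
  have tb: "balanced (mtensor D\<^sub>\<hh> A) A A (\<lambda>x y. tensor D\<^sub>\<hh> A (\<epsilon> x) (id y))"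
    by (rule balanced_hmod_hom[OF balanced_tensor[OF D bc] counit_hmod_hom hmod_hom_id])
  have *: "lift_tensor A (\<lambda>x y. \<mu>\<^sub>l (\<epsilon> x 1) \<otimes> y) (\<Delta> a) = a" if a: "a \<in> bigr A \<alpha> \<beta>" for a \<alpha> \<beta>
  proof -
    note ca = comult_carrier[OF bigr_in_carrier[OF a]]
    have "lift_tensor A (\<lambda>x y. \<mu>\<^sub>l (\<epsilon> x 1) \<otimes> y) (\<Delta> a) =
        lift_tensor A (\<lambda>x y. lift_tensor A (\<lambda>P y. \<mu>\<^sub>l (P 1) \<otimes> y) (tensor D\<^sub>\<hh> A (\<epsilon> x) (id y))) (\<Delta> a)"
    proof (rule lift_cong_carrier[OF bc bc cvector_space balanced_counit_left balanced_comp[OF tb L.clinear_lift] _ ca])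
      fix \<alpha> \<gamma> \<beta> x y assume x: "x \<in> bigr A \<alpha> \<gamma>" and y: "y \<in> bigr A \<gamma> \<beta>"
      show "\<mu>\<^sub>l (\<epsilon> x 1) \<otimes> y = lift_tensor A (\<lambda>P y. \<mu>\<^sub>l (P 1) \<otimes> y) (tensor D\<^sub>\<hh> A (\<epsilon> x) (id y))"
        using L.lift_tensor_tensor[OF hmod_homD(1)[OF counit_hmod_hom x] y] by simp
    qed
    also have "\<dots> = lift_tensor A (\<lambda>P y. \<mu>\<^sub>l (P 1) \<otimes> y) (map_tensor D\<^sub>\<hh> A \<epsilon> id (\<Delta> a))"
      unfolding map_tensor_def
      by (rule lift_comp[OF bc bc mtensor_cvector_space cvector_space tb L.clinear_lift ca])
    also have "\<dots> = lift_tensor A (\<lambda>P y. \<mu>\<^sub>l (P 1) \<otimes> y) (tensor D\<^sub>\<hh> A (shift (- \<alpha>)) a)"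
      by (simp add: counit_left[OF a])
    also have "\<dots> = \<mu>\<^sub>l (shift (- \<alpha>) 1) \<otimes> a"
      by (rule L.lift_tensor_tensor[OF _ a]) (auto simp: diff_alg_simps intro: exI[of _ 1])
    finally show ?thesis using bigr_in_carrier[OF a] by (simp add: lmom_one)
  qed
  show ?thesis using assms
  proof (induction rule: carrier_induct)
    case (homogeneous \<alpha> \<beta> x)
    then show ?case by (rule *)
  next
    case (add x y)
    then show ?case using clinear_onD(2)[OF clinear_sweedler[OF cvector_space balanced_counit_left]] by simp
  qed
qed

lemma counit_sum_right:
  assumes "a \<in> carrier A"
  shows "lift_tensor A (\<lambda>x y. \<mu>\<^sub>r (\<epsilon> y 1) \<otimes> x) (\<Delta> a) = a"
proof -
  note D = diff_alg_bigr_closed and bc = bigr_closed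
  interpret L: tensor_lift A "D\<^sub>\<hh>" A "\<lambda>y P. \<mu>\<^sub>r (P 1) \<otimes> y"
    by (rule tensor_liftI[OF bc D cvector_space balanced_diff_right])
  have tb: "balanced (mtensor A D\<^sub>\<hh>) A A (\<lambda>x y. tensor A D\<^sub>\<hh> (id x) (\<epsilon> y))"
    by (rule balanced_hmod_hom[OF balanced_tensor[OF bc D] hmod_hom_id counit_hmod_hom])
  have *: "lift_tensor A (\<lambda>x y. \<mu>\<^sub>r (\<epsilon> y 1) \<otimes> x) (\<Delta> a) = a" if a: "a \<in> bigr A \<alpha> \<beta>" for a \<alpha> \<beta>
  proof -
    note ca = comult_carrier[OF bigr_in_carrier[OF a]]
    have "lift_tensor A (\<lambda>x y. \<mu>\<^sub>r (\<epsilon> y 1) \<otimes> x) (\<Delta> a) =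
        lift_tensor A (\<lambda>x y. lift_tensor A (\<lambda>y P. \<mu>\<^sub>r (P 1) \<otimes> y) (tensor A D\<^sub>\<hh> (id x) (\<epsilon> y))) (\<Delta> a)"
    proof (rule lift_cong_carrier[OF bc bc cvector_space balanced_counit_right balanced_comp[OF tb L.clinear_lift] _ ca])
      fix \<alpha> \<gamma> \<beta> x y assume x: "x \<in> bigr A \<alpha> \<gamma>" and y: "y \<in> bigr A \<gamma> \<beta>"
      show "\<mu>\<^sub>r (\<epsilon> y 1) \<otimes> x = lift_tensor A (\<lambda>y P. \<mu>\<^sub>r (P 1) \<otimes> y) (tensor A D\<^sub>\<hh> (id x) (\<epsilon> y))"
        using L.lift_tensor_tensor[OF x hmod_homD(1)[OF counit_hmod_hom y]] by simp
    qed
    also have "\<dots> = lift_tensor A (\<lambda>y P. \<mu>\<^sub>r (P 1) \<otimes> y) (map_tensor A D\<^sub>\<hh> id \<epsilon> (\<Delta> a))"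
      unfolding map_tensor_def
      by (rule lift_comp[OF bc bc mtensor_cvector_space cvector_space tb L.clinear_lift ca])
    also have "\<dots> = lift_tensor A (\<lambda>y P. \<mu>\<^sub>r (P 1) \<otimes> y) (tensor A D\<^sub>\<hh> a (shift (- \<beta>)))"
      by (simp add: counit_right[OF a])
    also have "\<dots> = \<mu>\<^sub>r (shift (- \<beta>) 1) \<otimes> a"
      by (rule L.lift_tensor_tensor[OF a, of _ \<beta>]) (auto simp: diff_alg_simps intro: exI[of _ 1])
    finally show ?thesis using bigr_in_carrier[OF a] by (simp add: rmom_one)
  qed
  show ?thesis using assms
  proof (induction rule: carrier_induct)
    case (homogeneous \<alpha> \<beta> x)
    then show ?case by (rule *)
  next
    case (add x y)
    then show ?case using clinear_onD(2)[OF clinear_sweedler[OF cvector_space balanced_counit_right]] by simp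
  qed
qed

text \<open>The universal triple tensor is balanced in its first two entries for any homogeneous
  \<open>c\<close>, also when the right degree of \<open>b\<close> differs from \<delta>. In that
  case the inner tensor is zero but still counts as an element of the degree that \<open>a\<close>
  requires.\<close>

lemma balanced_tensor_tensor:
  assumes "c \<in> bigr A \<delta> \<beta>"
  shows "balanced (mtensor A AA) A A (\<lambda>a b. tensor A AA a (tensor A A b c))"
proof (rule balancedI)
  fix \<alpha> \<gamma> \<beta>' a b a' b' k f
  assume a: "a \<in> bigr A \<alpha> \<gamma>" and b: "b \<in> bigr A \<gamma> \<beta>'"
  have bc: "tensor A A x c \<in> bigr AA \<gamma> \<beta>" if "x \<in> bigr A \<gamma> \<beta>'" for x
    by (rule tensor_hom_cases[OF that assms])
  note t = balancedD[OF balanced_tensor[OF bigr_closed mtensor_bigr_closed] a bc[OF b]]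
  note th = tensor_homogeneous[OF b assms]
  show "tensor A AA a (tensor A A b c) \<in> carrier (mtensor A AA)" by (rule t(1))
  show "a' \<in> bigr A \<alpha> \<gamma> \<Longrightarrow> tensor A AA (a \<oplus> a') (tensor A A b c) =
      tensor A AA a (tensor A A b c) \<oplus>\<^bsub>mtensor A AA\<^esub> tensor A AA a' (tensor A A b c)"
    by (rule t(2))
  show "tensor A AA a (tensor A A (b \<oplus> b') c) =
      tensor A AA a (tensor A A b c) \<oplus>\<^bsub>mtensor A AA\<^esub> tensor A AA a (tensor A A b' c)"
    if b': "b' \<in> bigr A \<gamma> \<beta>'"
    by (simp add: th(1)[OF b'] t(3)[OF bc[OF b']])
  show "tensor A AA (k \<odot> a) (tensor A A b c) = k \<odot>\<^bsub>mtensor A AA\<^esub> tensor A AA a (tensor A A b c)"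
    by (rule t(4))
  show "tensor A AA a (tensor A A (k \<odot> b) c) = k \<odot>\<^bsub>mtensor A AA\<^esub> tensor A AA a (tensor A A b c)"
    by (simp add: th(3) t(5))
  show "tensor A AA (\<mu>\<^sub>r f \<otimes> a) (tensor A A b c) = tensor A AA a (tensor A A (\<mu>\<^sub>l f \<otimes> b) c)"
    by (simp add: t(6) mtensor_lmom_mult_tensor[OF b assms])
qed

text \<open>A trilinear map \<open>\<phi>\<close> factors through the universal triple tensor, so
  coassociativity can be tested by applying the induced linear map to both sides of the axiom. The
  balancedness of the two grouped summands is returned as well, since callers go on to rewrite
  them.\<close>

lemma coassoc_lift:
  assumes C: "cvector_space C"
    and hl: "\<And>\<delta> \<beta> c. c \<in> bigr A \<delta> \<beta> \<Longrightarrow> balanced C A A (\<lambda>a b. \<phi> a b c)"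
    and hr: "\<And>\<alpha> \<gamma> a. a \<in> bigr A \<alpha> \<gamma> \<Longrightarrow> balanced C A A (\<phi> a)"
    and a: "a \<in> carrier A"
  shows "lift_tensor C (\<lambda>x z. lift_tensor C (\<lambda>u v. \<phi> u v z) (\<Delta> x)) (\<Delta> a) =
    lift_tensor C (\<lambda>x z. lift_tensor C (\<phi> x) (\<Delta> z)) (\<Delta> a)"
    and "balanced C A A (\<lambda>x z. lift_tensor C (\<lambda>u v. \<phi> u v z) (\<Delta> x))"
    and "balanced C A A (\<lambda>x z. lift_tensor C (\<phi> x) (\<Delta> z))"
proof -
  note bc = bigr_closed bigr_closed
  let ?C0 = "mtensor A AA"
  let ?\<phi>0 = "\<lambda>a b c. tensor A AA a (tensor A A b c)"
  have left: "balanced C AA A (\<lambda>t c. lift_tensor C (\<lambda>a b. \<phi> a b c) t)"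
    by (rule balanced_lift_left[OF C hl]) (auto intro: balancedD[OF hr])
  have right: "balanced C A AA (\<lambda>a. lift_tensor C (\<phi> a))"
    by (rule balanced_lift_right[OF C hr hl])
  show bl: "balanced C A A (\<lambda>x z. lift_tensor C (\<lambda>u v. \<phi> u v z) (\<Delta> x))"
    using balanced_hmod_hom[OF left comult_hmod_hom hmod_hom_id] by simp
  show br: "balanced C A A (\<lambda>x z. lift_tensor C (\<phi> x) (\<Delta> z))"
    using balanced_hmod_hom[OF right hmod_hom_id comult_hmod_hom] by simp
  have tC0: "balanced ?C0 A AA (tensor A AA)" by (rule balanced_tensor[OF bigr_closed mtensor_bigr_closed])
  have left0: "balanced ?C0 AA A (\<lambda>t c. lift_tensor ?C0 (\<lambda>a b. ?\<phi>0 a b c) t)"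
  proof (rule balanced_lift_left[OF mtensor_cvector_space balanced_tensor_tensor])
    fix \<alpha> \<gamma> \<delta> \<beta> a b c c' k f
    assume a: "a \<in> bigr A \<alpha> \<gamma>" and b: "b \<in> bigr A \<gamma> \<delta>" and c: "c \<in> bigr A \<delta> \<beta>"
    note t = balancedD[OF tC0 a tensor_bigr[OF b c]] and t' = balancedD[OF balanced_tensor[OF bc] b c]
    show "?\<phi>0 a b (c \<oplus> c') = ?\<phi>0 a b c \<oplus>\<^bsub>?C0\<^esub> ?\<phi>0 a b c'" if "c' \<in> bigr A \<delta> \<beta>"
      using t(3)[OF tensor_bigr[OF b that]] t'(3)[OF that] by simp
    show "?\<phi>0 a b (k \<odot> c) = k \<odot>\<^bsub>?C0\<^esub> ?\<phi>0 a b c" using t(5) t'(5) by simp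
    show "?\<phi>0 a (\<mu>\<^sub>r f \<otimes> b) c = ?\<phi>0 a b (\<mu>\<^sub>l f \<otimes> c)" using t'(6) by simp
  qed
  interpret L: tensor_lift A AA C "\<lambda>a. lift_tensor C (\<phi> a)"
    by (rule tensor_liftI[OF bigr_closed mtensor_bigr_closed C right])
  interpret L0: tensor_lift AA A ?C0 "\<lambda>t c. lift_tensor ?C0 (\<lambda>a b. ?\<phi>0 a b c) t"
    by (rule tensor_liftI[OF mtensor_bigr_closed bigr_closed mtensor_cvector_space left0])
  \<comment> \<open>The linear map on the triple tensor product, bracketed to the right, that is
    induced by \<open>\<phi>\<close>; the left bracketing reaches it through
    \<open>assoc_tensor\<close>.\<close>
  let ?L = "lift_tensor C (\<lambda>a. lift_tensor C (\<phi> a))"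
  note ca = comult_carrier[OF a]
  have tM: "balanced (mtensor AA A) A A (\<lambda>x z. tensor AA A (\<Delta> x) (id z))"
    by (rule balanced_hmod_hom[OF balanced_tensor[OF mtensor_bigr_closed bigr_closed] comult_hmod_hom hmod_hom_id])
  have tM': "balanced ?C0 A A (\<lambda>x z. tensor A AA (id x) (\<Delta> z))"
    by (rule balanced_hmod_hom[OF tC0 hmod_hom_id comult_hmod_hom])
  have "?L (map_tensor A AA id \<Delta> (\<Delta> a)) = lift_tensor C (\<lambda>x z. ?L (tensor A AA (id x) (\<Delta> z))) (\<Delta> a)"
    unfolding map_tensor_def
    by (rule lift_comp[symmetric, OF bc mtensor_cvector_space C tM' L.clinear_lift ca])
  also have "\<dots> = lift_tensor C (\<lambda>x z. lift_tensor C (\<phi> x) (\<Delta> z)) (\<Delta> a)"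
  proof (rule lift_cong_carrier[OF bc C balanced_comp[OF tM' L.clinear_lift] br _ ca])
    fix \<alpha> \<gamma> \<beta> x z assume x: "x \<in> bigr A \<alpha> \<gamma>" and z: "z \<in> bigr A \<gamma> \<beta>"
    show "?L (tensor A AA (id x) (\<Delta> z)) = lift_tensor C (\<phi> x) (\<Delta> z)"
      using L.lift_tensor_tensor[OF x hmod_homD(1)[OF comult_hmod_hom z]] by simp
  qed
  finally have R: "?L (map_tensor A AA id \<Delta> (\<Delta> a)) = lift_tensor C (\<lambda>x z. lift_tensor C (\<phi> x) (\<Delta> z)) (\<Delta> a)" .
  have bl0: "balanced ?C0 A A (\<lambda>x z. lift_tensor ?C0 (\<lambda>u v. ?\<phi>0 u v z) (\<Delta> x))"
    using balanced_hmod_hom[OF left0 comult_hmod_hom hmod_hom_id] by simp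
  have ass: "assoc_tensor A A A = lift_tensor ?C0 (\<lambda>t c. lift_tensor ?C0 (\<lambda>a b. ?\<phi>0 a b c) t)"
    by (simp add: assoc_tensor_def)
  have "assoc_tensor A A A (map_tensor AA A \<Delta> id (\<Delta> a)) =
      lift_tensor ?C0 (\<lambda>x z. assoc_tensor A A A (tensor AA A (\<Delta> x) (id z))) (\<Delta> a)"
    unfolding map_tensor_def ass
    by (rule lift_comp[symmetric, OF bc mtensor_cvector_space mtensor_cvector_space tM L0.clinear_lift ca])
  also have "\<dots> = lift_tensor ?C0 (\<lambda>x z. lift_tensor ?C0 (\<lambda>u v. ?\<phi>0 u v z) (\<Delta> x)) (\<Delta> a)"
    unfolding ass
  proof (rule lift_cong_carrier[OF bc mtensor_cvector_space balanced_comp[OF tM L0.clinear_lift] bl0 _ ca])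
    fix \<alpha> \<gamma> \<beta> x z assume x: "x \<in> bigr A \<alpha> \<gamma>" and z: "z \<in> bigr A \<gamma> \<beta>"
    show "lift_tensor ?C0 (\<lambda>t c. lift_tensor ?C0 (\<lambda>a b. ?\<phi>0 a b c) t) (tensor AA A (\<Delta> x) (id z)) =
        lift_tensor ?C0 (\<lambda>u v. ?\<phi>0 u v z) (\<Delta> x)"
      using L0.lift_tensor_tensor[OF hmod_homD(1)[OF comult_hmod_hom x] z] by simp
  qed
  finally have "?L (assoc_tensor A A A (map_tensor AA A \<Delta> id (\<Delta> a))) =
      ?L (lift_tensor ?C0 (\<lambda>x z. lift_tensor ?C0 (\<lambda>u v. ?\<phi>0 u v z) (\<Delta> x)) (\<Delta> a))"
    by simp
  also have "\<dots> = lift_tensor C (\<lambda>x z. ?L (lift_tensor ?C0 (\<lambda>u v. ?\<phi>0 u v z) (\<Delta> x))) (\<Delta> a)"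
    by (rule lift_comp[symmetric, OF bc mtensor_cvector_space C bl0 L.clinear_lift ca])
  also have "\<dots> = lift_tensor C (\<lambda>x z. lift_tensor C (\<lambda>u v. \<phi> u v z) (\<Delta> x)) (\<Delta> a)"
  proof (rule lift_cong_carrier[OF bc C balanced_comp[OF bl0 L.clinear_lift] bl _ ca])
    fix \<alpha> \<gamma> \<beta> x z assume x: "x \<in> bigr A \<alpha> \<gamma>" and z: "z \<in> bigr A \<gamma> \<beta>"
    have "?L (lift_tensor ?C0 (\<lambda>u v. ?\<phi>0 u v z) (\<Delta> x)) = lift_tensor C (\<lambda>u v. ?L (?\<phi>0 u v z)) (\<Delta> x)"
      by (rule lift_comp[symmetric, OF bc mtensor_cvector_space C balanced_tensor_tensor[OF z] L.clinear_lift
            comult_carrier[OF bigr_in_carrier[OF x]]])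
    also have "\<dots> = lift_tensor C (\<lambda>u v. \<phi> u v z) (\<Delta> x)"
    proof (rule lift_cong[OF bc C balanced_comp[OF balanced_tensor_tensor[OF z] L.clinear_lift] hl[OF z] _
          hmod_homD(1)[OF comult_hmod_hom x]])
      fix \<xi> u v assume u: "u \<in> bigr A \<alpha> \<xi>" and v: "v \<in> bigr A \<xi> \<gamma>"
      show "?L (?\<phi>0 u v z) = \<phi> u v z"
        by (simp add: L.lift_tensor_tensor[OF u tensor_bigr[OF v z]]
            tensor_lift.lift_tensor_tensor[OF tensor_liftI[OF bc C hr[OF u]] v z])
    qed
    finally show "?L (lift_tensor ?C0 (\<lambda>u v. ?\<phi>0 u v z) (\<Delta> x)) = lift_tensor C (\<lambda>u v. \<phi> u v z) (\<Delta> x)" .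
  qed
  finally show "lift_tensor C (\<lambda>x z. lift_tensor C (\<lambda>u v. \<phi> u v z) (\<Delta> x)) (\<Delta> a) =
      lift_tensor C (\<lambda>x z. lift_tensor C (\<phi> x) (\<Delta> z)) (\<Delta> a)"
    using R coassoc[OF a] by simp
qed

end

section \<open>The antipode of the algebra of difference operators\<close>

text \<open>Dedekind's independence of characters. The relation at \<open>h * x\<close> minus
  \<tau>(h) times the relation at \<open>x\<close> removes the term of \<open>\<tau>\<close>, which
  leaves a shorter relation.\<close>

lemma multiplicative_maps_independent:
  fixes c :: "('k \<Rightarrow> 'k::field) \<Rightarrow> 'k"
  assumes "finite G" "\<And>\<sigma> x y. \<sigma> \<in> G \<Longrightarrow> \<sigma> (x * y) = \<sigma> x * \<sigma> y" "\<And>\<sigma>. \<sigma> \<in> G \<Longrightarrow> \<sigma> 1 = 1"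
    and "\<And>x. (\<Sum>\<sigma>\<in>G. c \<sigma> * \<sigma> x) = 0"
  shows "\<forall>\<sigma>\<in>G. c \<sigma> = 0"
  using assms
proof (induction G arbitrary: c rule: finite_induct)
  case empty
  then show ?case by simp
next
  case (insert \<tau> G)
  have G0: "c \<sigma> = 0" if \<sigma>: "\<sigma> \<in> G" for \<sigma>
  proof -
    have "\<sigma> \<noteq> \<tau>" using \<sigma> insert by auto
    then obtain h where h: "\<sigma> h \<noteq> \<tau> h" by auto
    \<comment> \<open>These new coefficients vanish at \<open>\<tau>\<close>, and at the chosen
      \<open>\<sigma>\<close> the second factor is nonzero.\<close>
    have "\<forall>\<sigma>\<in>G. c \<sigma> * (\<sigma> h - \<tau> h) = 0"
    proof (rule insert.IH)
      fix x
      have "(\<Sum>\<sigma>\<in>G. c \<sigma> * (\<sigma> h - \<tau> h) * \<sigma> x) = (\<Sum>\<sigma>\<in>insert \<tau> G. c \<sigma> * (\<sigma> h - \<tau> h) * \<sigma> x)"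
        using insert.hyps by simp
      also have "\<dots> = (\<Sum>\<sigma>\<in>insert \<tau> G. c \<sigma> * \<sigma> (h * x) - \<tau> h * (c \<sigma> * \<sigma> x))"
        using insert.prems(1) by (intro sum.cong refl) (simp add: algebra_simps)
      also have "\<dots> = (\<Sum>\<sigma>\<in>insert \<tau> G. c \<sigma> * \<sigma> (h * x)) - \<tau> h * (\<Sum>\<sigma>\<in>insert \<tau> G. c \<sigma> * \<sigma> x)"
        by (simp only: sum_subtractf sum_distrib_left)
      finally have "(\<Sum>\<sigma>\<in>G. c \<sigma> * (\<sigma> h - \<tau> h) * \<sigma> x) =
          (\<Sum>\<sigma>\<in>insert \<tau> G. c \<sigma> * \<sigma> (h * x)) - \<tau> h * (\<Sum>\<sigma>\<in>insert \<tau> G. c \<sigma> * \<sigma> x)" .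
      then show "(\<Sum>\<sigma>\<in>G. c \<sigma> * (\<sigma> h - \<tau> h) * \<sigma> x) = 0" by (simp only: insert.prems(3)) simp
    qed (use insert.prems in auto)
    then show ?thesis using h \<sigma> by auto
  qed
  moreover have "c \<tau> = 0"
    using insert.prems(3)[of 1] insert.prems(2)[of \<tau>] insert.hyps G0 by simp
  ultimately show ?case by simp
qed

text \<open>Distinct points might a priori give the same shift; this does not matter, since the
  coefficients of equal shifts enter both sides only through their sum.\<close>

lemma diff_sum_zero_flip:
  fixes f :: "'v::complex_fd_space \<Rightarrow> 'v mero"
  assumes F: "finite F" and z: "\<And>g. (\<Sum>\<beta>\<in>F. f \<beta> * shift \<beta> g) = 0"
  shows "(\<Sum>\<beta>\<in>F. shift (- \<beta>) (f \<beta> * g)) = 0"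
proof -
  define c where "c = (\<lambda>\<sigma>. \<Sum>\<beta>\<in>{\<beta>\<in>F. shift \<beta> = \<sigma>}. f \<beta>)"
  have "(\<Sum>\<sigma>\<in>shift ` F. c \<sigma> * \<sigma> g) = (\<Sum>\<beta>\<in>F. f \<beta> * shift \<beta> g)" for g
    by (subst sum.image_gen[OF F, of _ shift]) (auto simp: c_def sum_distrib_right intro!: sum.cong)
  then have c0: "\<forall>\<sigma>\<in>shift ` F. c \<sigma> = 0"
    using F z by (intro multiplicative_maps_independent) (auto simp: shift_mult)
  have "(\<Sum>\<beta>\<in>{\<beta>\<in>F. shift \<beta> = \<sigma>}. shift (- \<beta>) (f \<beta> * g)) = 0" if \<sigma>: "\<sigma> \<in> shift ` F" for \<sigma>
  proof -
    obtain \<gamma> where \<gamma>: "\<gamma> \<in> F" "\<sigma> = shift \<gamma>" using \<sigma> by auto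
    \<comment> \<open>Equal shifts have equal inverses, so the opposite shifts agree along each
      fibre of \<open>shift\<close> and can be pulled out of the sum.\<close>
    have inv: "shift (- \<beta>) h = shift (- \<gamma>) h" if "shift \<beta> = \<sigma>" for \<beta> h
    proof -
      have "shift (- \<beta>) (shift \<beta> (shift (- \<gamma>) h)) = shift (- \<beta>) (shift \<gamma> (shift (- \<gamma>) h))"
        using that \<gamma> by simp
      then show ?thesis by (simp add: shift_shift shift_zero)
    qed
    have sum0: "shift (- \<gamma>) (\<Sum>\<beta>\<in>I. h \<beta>) = (\<Sum>\<beta>\<in>I. shift (- \<gamma>) (h \<beta>))" for I and h :: "'v \<Rightarrow> 'v mero"
      by (induction I rule: infinite_finite_induct) (auto simp: shift_add)
    have "(\<Sum>\<beta>\<in>{\<beta>\<in>F. shift \<beta> = \<sigma>}. shift (- \<beta>) (f \<beta> * g)) = shift (- \<gamma>) (c \<sigma> * g)"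
      by (auto simp: c_def sum_distrib_right sum0 inv intro!: sum.cong)
    then show ?thesis using c0 \<sigma> by simp
  qed
  then show ?thesis by (subst sum.image_gen[OF F, of _ shift]) simp
qed

lemma sum_extend:
  fixes G :: "'v \<Rightarrow> 'k::comm_ring_1 \<Rightarrow> 'l::comm_monoid_add"
  assumes "finite H" "F \<subseteq> H" "\<And>\<beta>. G \<beta> 0 = 0"
  shows "(\<Sum>\<beta>\<in>F. G \<beta> (f \<beta>)) = (\<Sum>\<beta>\<in>H. G \<beta> (if \<beta> \<in> F then f \<beta> else 0))"
proof -
  have "(\<Sum>\<beta>\<in>F. G \<beta> (f \<beta>)) = (\<Sum>\<beta>\<in>F. G \<beta> (if \<beta> \<in> F then f \<beta> else 0))" by (rule sum.cong) auto
  also have "\<dots> = (\<Sum>\<beta>\<in>H. G \<beta> (if \<beta> \<in> F then f \<beta> else 0))"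
    using assms by (intro sum.mono_neutral_left) auto
  finally show ?thesis .
qed

lemma shift_uminus: "shift \<alpha> (- f) = - shift \<alpha> f"
  using shift_add[of \<alpha> f "- f"] by (simp add: eq_neg_iff_add_eq_0 add.commute)

lemma shift_diff: "shift \<alpha> (f - g) = shift \<alpha> f - shift \<alpha> g"
  using shift_add[of \<alpha> f "- g"] by (simp add: shift_uminus)

text \<open>The difference of two presentations, taken over the union of their index sets, is a
  presentation of the zero operator, and \<open>diff_sum_zero_flip\<close> carries this over to the
  flipped sums. So the description in the definition is unique.\<close>

lemma diff_antipode_sum:
  fixes f :: "'v::complex_fd_space \<Rightarrow> 'v mero"
  assumes "finite F"
  shows "diff_antipode (diff_sum F f) = (\<lambda>g. \<Sum>\<beta>\<in>F. shift (- \<beta>) (f \<beta> * g))"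
  unfolding diff_antipode_def
proof (rule the_equality)
  fix Q assume "\<exists>F' f'. finite F' \<and> diff_sum F f = diff_sum F' f' \<and>
    Q = (\<lambda>g. \<Sum>\<beta>\<in>F'. shift (- \<beta>) (f' \<beta> * g))"
  then obtain F' f' where F': "finite F'" "diff_sum F f = diff_sum F' f'"
    and Q: "Q = (\<lambda>g. \<Sum>\<beta>\<in>F'. shift (- \<beta>) (f' \<beta> * g))" by blast
  define H where "H = F \<union> F'"
  have H: "finite H" "F \<subseteq> H" "F' \<subseteq> H" using assms F' by (auto simp: H_def)
  define d where "d \<beta> = (if \<beta> \<in> F then f \<beta> else 0) - (if \<beta> \<in> F' then f' \<beta> else 0)" for \<beta>
  have "(\<Sum>\<beta>\<in>H. d \<beta> * shift \<beta> g) = diff_sum F f g - diff_sum F' f' g" for g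
    unfolding diff_sum_def d_def
    using sum_extend[OF H(1,2), of "\<lambda>\<beta> x. x * shift \<beta> g" f] sum_extend[OF H(1,3), of "\<lambda>\<beta> x. x * shift \<beta> g" f']
    by (simp add: left_diff_distrib sum_subtractf)
  then have "(\<Sum>\<beta>\<in>H. d \<beta> * shift \<beta> g) = 0" for g using F' by simp
  then have "(\<Sum>\<beta>\<in>H. shift (- \<beta>) (d \<beta> * g)) = 0" for g by (rule diff_sum_zero_flip[OF H(1)])
  moreover have "(\<Sum>\<beta>\<in>H. shift (- \<beta>) (d \<beta> * g)) =
      (\<Sum>\<beta>\<in>F. shift (- \<beta>) (f \<beta> * g)) - (\<Sum>\<beta>\<in>F'. shift (- \<beta>) (f' \<beta> * g))" for g
    unfolding d_def
    using sum_extend[OF H(1,2), of "\<lambda>\<beta> x. shift (- \<beta>) (x * g)" f]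
      sum_extend[OF H(1,3), of "\<lambda>\<beta> x. shift (- \<beta>) (x * g)" f']
    by (simp add: left_diff_distrib shift_diff sum_subtractf)
  ultimately show "Q = (\<lambda>g. \<Sum>\<beta>\<in>F. shift (- \<beta>) (f \<beta> * g))" by (simp add: Q)
qed (use assms in blast)

lemma diff_antipode_add:
  assumes "P \<in> carrier (D\<^sub>\<hh> :: ('v::complex_fd_space, 'v diff_op) h_alg)" "Q \<in> carrier D\<^sub>\<hh>"
  shows "diff_antipode (\<lambda>g. P g + Q g) = (\<lambda>g. diff_antipode P g + diff_antipode Q g)"
proof -
  obtain F f where P: "P = diff_sum F f" "finite F" using assms(1) by (auto simp: diff_alg_simps)
  obtain F' f' where Q: "Q = diff_sum F' f'" "finite F'" using assms(2) by (auto simp: diff_alg_simps)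
  define H where "H = F \<union> F'"
  have H: "finite H" "F \<subseteq> H" "F' \<subseteq> H" using P Q by (auto simp: H_def)
  define d where "d \<beta> = (if \<beta> \<in> F then f \<beta> else 0) + (if \<beta> \<in> F' then f' \<beta> else 0)" for \<beta>
  have "(\<lambda>g. P g + Q g) = diff_sum H d"
    unfolding P Q diff_sum_def d_def
    using sum_extend[OF H(1,2), of "\<lambda>\<beta> x. x * shift \<beta> _" f] sum_extend[OF H(1,3), of "\<lambda>\<beta> x. x * shift \<beta> _" f']
    by (auto simp: distrib_right sum.distrib)
  then show ?thesis
    unfolding P(1) Q(1) diff_antipode_sum[OF P(2)] diff_antipode_sum[OF Q(2)]
    using sum_extend[OF H(1,2), of "\<lambda>\<beta> x. shift (- \<beta>) (x * _)" f]
      sum_extend[OF H(1,3), of "\<lambda>\<beta> x. shift (- \<beta>) (x * _)" f']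
    by (auto simp: diff_antipode_sum[OF H(1)] d_def distrib_right shift_add sum.distrib)
qed

lemma diff_antipode_monomial: "diff_antipode (\<lambda>g. f * shift \<beta> g) = (\<lambda>g. shift (- \<beta>) (f * g))"
  using diff_antipode_sum[of "{\<beta>}" "\<lambda>_. f"] by (simp add: diff_sum_def)

section \<open>Convolution inverses\<close>

text \<open>The target of convolution, to be instantiated both by \<open>A\<close> and by its tensor
  square.\<close>

locale complex_algebra = cvector_space M + ring M
  for M :: "('v::complex_fd_space, 'c, 'm) h_alg_scheme" (structure) +
  assumes smult_left: "\<lbrakk>x \<in> carrier M; y \<in> carrier M\<rbrakk> \<Longrightarrow> (c \<odot> x) \<otimes> y = c \<odot> (x \<otimes> y)"
    and smult_right: "\<lbrakk>x \<in> carrier M; y \<in> carrier M\<rbrakk> \<Longrightarrow> x \<otimes> (c \<odot> y) = c \<odot> (x \<otimes> y)"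
begin

lemma clinear_mult_right: "z \<in> carrier M \<Longrightarrow> clinear_on M M (\<lambda>m. m \<otimes> z)"
  by (simp add: clinear_on_def l_distr smult_left)

lemma clinear_mult_left: "z \<in> carrier M \<Longrightarrow> clinear_on M M (\<lambda>m. z \<otimes> m)"
  by (simp add: clinear_on_def r_distr smult_right)

end

lemma (in h_algebra) balanced_cong:
  assumes "balanced C A A \<psi>" "\<And>x y. x \<in> carrier A \<Longrightarrow> y \<in> carrier A \<Longrightarrow> \<phi> x y = \<psi> x y"
  shows "balanced C A A \<phi>"
  by (rule balancedI) (simp_all add: assms(2) bigr_in_carrier balancedD[OF assms(1)])

lemma (in h_algebra) complex_algebra: "complex_algebra A"
  using smult_mult_left smult_mult_right
  by (simp add: complex_algebra_def complex_algebra_axioms_def cvector_space_axioms ring_axioms)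

lemma (in h_algebra) complex_algebra_mtensor: "complex_algebra AA"
  by (simp add: complex_algebra_def complex_algebra_axioms_def mtensor_cvector_space mtensor_ring mtensor_mult_smult)

lemma clinear_id: "clinear_on A A (\<lambda>x. x)"
  by (simp add: clinear_on_def)

lemma clinear_compose:
  assumes "clinear_on A B f" "clinear_on B C g"
  shows "clinear_on A C (\<lambda>x. g (f x))"
  by (simp add: clinear_on_def[of A C] clinear_onD[OF assms(1)] clinear_onD[OF assms(2)])

text \<open>The map \<open>h\<close> whose convolution inverses are compared. \<open>M\<close>
  carries no moment maps of its own; \<open>h (\<mu>\<^sub>l f)\<close> and
  \<open>h (\<mu>\<^sub>r f)\<close> take their place.\<close>

locale bialgebroid_map = h_bialgebroid A \<Delta> \<epsilon>
  for A :: "('v::complex_fd_space, 'a, 'm) h_alg_scheme" (structure) and \<Delta> \<epsilon> +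
  fixes M :: "('v, 'c, 'k) h_alg_scheme" and h :: "'a \<Rightarrow> 'c"
  assumes M: "complex_algebra M" and h_lin: "clinear_on A M h"
    and h_mult: "\<lbrakk>x \<in> carrier A; y \<in> carrier A\<rbrakk> \<Longrightarrow> h (x \<otimes> y) = h x \<otimes>\<^bsub>M\<^esub> h y"
begin

sublocale M: complex_algebra M by (rule M)

lemma h_closed [simp]: "x \<in> carrier A \<Longrightarrow> h x \<in> carrier M"
  using clinear_onD[OF h_lin] by blast

context
  fixes S1 S2 :: "'a \<Rightarrow> 'c"
  assumes S1: "clinear_on A M S1" and S2: "clinear_on A M S2"
    and S1_rmom: "\<And>x f. x \<in> carrier A \<Longrightarrow> S1 (\<mu>\<^sub>r f \<otimes> x) = S1 x \<otimes>\<^bsub>M\<^esub> h (\<mu>\<^sub>l f)"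
    and S2_lmom: "\<And>x f. x \<in> carrier A \<Longrightarrow> S2 (x \<otimes> \<mu>\<^sub>l f) = h (\<mu>\<^sub>r f) \<otimes>\<^bsub>M\<^esub> S2 x"
begin

lemma S1_closed: "x \<in> carrier A \<Longrightarrow> S1 x \<in> carrier M"
  using clinear_onD[OF S1] by blast

lemma S2_closed: "x \<in> carrier A \<Longrightarrow> S2 x \<in> carrier M"
  using clinear_onD[OF S2] by blast

lemma balanced_convolution_left: "balanced M A A (\<lambda>u v. S1 u \<otimes>\<^bsub>M\<^esub> h v)"
  by (rule balancedI)
     (auto simp: bigr_in_carrier S1_closed clinear_onD[OF S1] clinear_onD[OF h_lin] M.l_distr M.r_distr
       M.smult_left M.smult_right S1_rmom h_mult M.m_assoc)

text \<open>The rule for \<open>S2\<close> concerns multiplication by \<open>\<mu>\<^sub>l f\<close>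
  from the right, while balancing puts the function on the left. It is therefore first moved to the
  right of \<open>a\<close> and of \<open>b\<close>, with the same shift \<gamma> in both.\<close>

lemma balanced_convolution_right: "balanced M A A (\<lambda>u v. h u \<otimes>\<^bsub>M\<^esub> S2 v)"
proof (rule balancedI)
  fix \<alpha> \<gamma> \<beta> a b f
  assume a: "a \<in> bigr A \<alpha> \<gamma>" and b: "b \<in> bigr A \<gamma> \<beta>"
  have "h (\<mu>\<^sub>r f \<otimes> a) \<otimes>\<^bsub>M\<^esub> S2 b = h a \<otimes>\<^bsub>M\<^esub> (h (\<mu>\<^sub>r (shift \<gamma> f)) \<otimes>\<^bsub>M\<^esub> S2 b)"
    using a b by (simp add: rmom_comm[OF a] h_mult bigr_in_carrier S2_closed M.m_assoc)
  also have "\<dots> = h a \<otimes>\<^bsub>M\<^esub> S2 (\<mu>\<^sub>l f \<otimes> b)"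
    using b by (simp add: lmom_comm[OF b] S2_lmom bigr_in_carrier)
  finally show "h (\<mu>\<^sub>r f \<otimes> a) \<otimes>\<^bsub>M\<^esub> S2 b = h a \<otimes>\<^bsub>M\<^esub> S2 (\<mu>\<^sub>l f \<otimes> b)" .
qed (auto simp: bigr_in_carrier S2_closed clinear_onD[OF S2] clinear_onD[OF h_lin] M.l_distr M.r_distr
       M.smult_left M.smult_right)

text \<open>The sum of S1(a1) h(a2) S2(a3) is grouped as S1(a1) times (h(a2) S2(a3)). The bracket is
  the image under \<open>h\<close> of a left moment; the rule for \<open>S1\<close> absorbs it as a
  right moment in the argument of \<open>S1\<close>, and the counit restores \<open>a\<close>. Here
  \<open>S1\<close> is no inverse of \<open>h\<close> yet; the lemma is later applied to maps such
  as u -> S(u b).\<close>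

lemma convolution_expand:
  assumes right_inverse: "\<And>\<alpha> \<beta> a. a \<in> bigr A \<alpha> \<beta> \<Longrightarrow>
      lift_tensor M (\<lambda>u v. h u \<otimes>\<^bsub>M\<^esub> S2 v) (\<Delta> a) = h (\<mu>\<^sub>l (\<epsilon> a 1))"
    and a: "a \<in> carrier A"
  shows "S1 a = lift_tensor M (\<lambda>x z. lift_tensor M (\<lambda>u v. S1 u \<otimes>\<^bsub>M\<^esub> h v) (\<Delta> x) \<otimes>\<^bsub>M\<^esub> S2 z) (\<Delta> a)"
    and "balanced M A A (\<lambda>x z. lift_tensor M (\<lambda>u v. S1 u \<otimes>\<^bsub>M\<^esub> h v) (\<Delta> x) \<otimes>\<^bsub>M\<^esub> S2 z)"
proof -
  note bc = bigr_closed bigr_closed and MV = M.cvector_space_axioms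
  let ?\<phi> = "\<lambda>u v z. S1 u \<otimes>\<^bsub>M\<^esub> h v \<otimes>\<^bsub>M\<^esub> S2 z"
  let ?\<psi> = "\<lambda>u v z. S1 u \<otimes>\<^bsub>M\<^esub> (h v \<otimes>\<^bsub>M\<^esub> S2 z)"
  note ca = comult_carrier[OF a]
  have hl: "balanced M A A (\<lambda>u v. ?\<phi> u v z)" if "z \<in> bigr A \<gamma> \<beta>" for z \<gamma> \<beta>
    using that by (intro balanced_comp[OF balanced_convolution_left] M.clinear_mult_right S2_closed bigr_in_carrier)
  have hr': "balanced M A A (?\<psi> u)" if "u \<in> bigr A \<gamma> \<beta>" for u \<gamma> \<beta>
    using that by (intro balanced_comp[OF balanced_convolution_right] M.clinear_mult_left S1_closed bigr_in_carrier)
  have hr: "balanced M A A (?\<phi> u)" if u: "u \<in> bigr A \<gamma> \<beta>" for u \<gamma> \<beta>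
    using u by (intro balanced_cong[OF hr'[OF u]]) (simp add: M.m_assoc S1_closed S2_closed bigr_in_carrier)
  have co: "lift_tensor M (\<lambda>x z. lift_tensor M (\<lambda>u v. ?\<phi> u v z) (\<Delta> x)) (\<Delta> a) =
      lift_tensor M (\<lambda>x z. lift_tensor M (?\<phi> x) (\<Delta> z)) (\<Delta> a)"
    "balanced M A A (\<lambda>x z. lift_tensor M (\<lambda>u v. ?\<phi> u v z) (\<Delta> x))"
    "balanced M A A (\<lambda>x z. lift_tensor M (?\<phi> x) (\<Delta> z))"
    by (rule coassoc_lift[OF MV _ _ a], erule hl, erule hr)+
  have pull_left: "lift_tensor M (\<lambda>u v. ?\<phi> u v z) (\<Delta> x) =
      lift_tensor M (\<lambda>u v. S1 u \<otimes>\<^bsub>M\<^esub> h v) (\<Delta> x) \<otimes>\<^bsub>M\<^esub> S2 z" if "x \<in> carrier A" "z \<in> carrier A" for x z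
    using that
    by (intro lift_comp[OF bc MV MV balanced_convolution_left] M.clinear_mult_right S2_closed comult_carrier)
  show t: "balanced M A A (\<lambda>x z. lift_tensor M (\<lambda>u v. S1 u \<otimes>\<^bsub>M\<^esub> h v) (\<Delta> x) \<otimes>\<^bsub>M\<^esub> S2 z)"
    by (rule balanced_cong[OF co(2)]) (rule pull_left[symmetric])
  have sc: "balanced M A A (\<lambda>x z. S1 (\<mu>\<^sub>r (\<epsilon> z 1) \<otimes> x))"
    by (rule balanced_comp[OF balanced_counit_right S1])
  have "lift_tensor M (\<lambda>x z. lift_tensor M (\<lambda>u v. S1 u \<otimes>\<^bsub>M\<^esub> h v) (\<Delta> x) \<otimes>\<^bsub>M\<^esub> S2 z) (\<Delta> a) =
      lift_tensor M (\<lambda>x z. lift_tensor M (\<lambda>u v. ?\<phi> u v z) (\<Delta> x)) (\<Delta> a)"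
    by (rule lift_cong_carrier[OF bc MV t co(2) _ ca]) (rule pull_left[symmetric]; rule bigr_in_carrier; assumption)
  also have "\<dots> = lift_tensor M (\<lambda>x z. lift_tensor M (?\<phi> x) (\<Delta> z)) (\<Delta> a)" by (rule co(1))
  also have "\<dots> = lift_tensor M (\<lambda>x z. S1 (\<mu>\<^sub>r (\<epsilon> z 1) \<otimes> x)) (\<Delta> a)"
  proof (rule lift_cong_carrier[OF bc MV co(3) sc _ ca])
    fix \<alpha> \<gamma> \<beta> x z assume x: "x \<in> bigr A \<alpha> \<gamma>" and z: "z \<in> bigr A \<gamma> \<beta>"
    note cz = comult_carrier[OF bigr_in_carrier[OF z]] and xc = bigr_in_carrier[OF x]
    have "lift_tensor M (?\<phi> x) (\<Delta> z) = lift_tensor M (?\<psi> x) (\<Delta> z)"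
      by (rule lift_cong_carrier[OF bc MV hr[OF x] hr'[OF x] _ cz])
         (simp add: M.m_assoc S1_closed S2_closed xc bigr_in_carrier)
    also have "\<dots> = S1 x \<otimes>\<^bsub>M\<^esub> lift_tensor M (\<lambda>u v. h u \<otimes>\<^bsub>M\<^esub> S2 v) (\<Delta> z)"
      by (rule lift_comp[OF bc MV MV balanced_convolution_right M.clinear_mult_left[OF S1_closed[OF xc]] cz])
    also have "\<dots> = S1 (\<mu>\<^sub>r (\<epsilon> z 1) \<otimes> x)" by (simp add: right_inverse[OF z] S1_rmom xc)
    finally show "lift_tensor M (?\<phi> x) (\<Delta> z) = S1 (\<mu>\<^sub>r (\<epsilon> z 1) \<otimes> x)" .
  qed
  also have "\<dots> = S1 (lift_tensor A (\<lambda>x z. \<mu>\<^sub>r (\<epsilon> z 1) \<otimes> x) (\<Delta> a))"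
    by (rule lift_comp[OF bc cvector_space MV balanced_counit_right S1 ca])
  finally show "S1 a = lift_tensor M (\<lambda>x z. lift_tensor M (\<lambda>u v. S1 u \<otimes>\<^bsub>M\<^esub> h v) (\<Delta> x) \<otimes>\<^bsub>M\<^esub> S2 z) (\<Delta> a)"
    by (simp add: counit_sum_right[OF a])
qed

text \<open>In the expansion of \<open>S1 a\<close> the other bracket S1(a1) h(a2) is now evaluated.
  Its coefficient carries the shift by the left degree of \<open>x\<close>; as
  \<open>\<epsilon> x\<close> is zero off the diagonal, this equals the shift by the right degree,
  which is the one produced by moving the coefficient past \<open>z\<close>. It is absorbed into
  \<open>S2\<close>, and the counit restores \<open>a\<close>.\<close>

lemma convolution_inverse_unique:
  assumes right_inverse: "\<And>\<alpha> \<beta> a. a \<in> bigr A \<alpha> \<beta> \<Longrightarrow>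
      lift_tensor M (\<lambda>u v. h u \<otimes>\<^bsub>M\<^esub> S2 v) (\<Delta> a) = h (\<mu>\<^sub>l (\<epsilon> a 1))"
    and left_inverse: "\<And>\<alpha> \<beta> a. a \<in> bigr A \<alpha> \<beta> \<Longrightarrow>
      lift_tensor M (\<lambda>u v. S1 u \<otimes>\<^bsub>M\<^esub> h v) (\<Delta> a) = h (\<mu>\<^sub>r (shift \<alpha> (\<epsilon> a 1)))"
    and a: "a \<in> carrier A"
  shows "S1 a = S2 a"
proof -
  note bc = bigr_closed bigr_closed and MV = M.cvector_space_axioms
  have ex: "S1 a = lift_tensor M (\<lambda>x z. lift_tensor M (\<lambda>u v. S1 u \<otimes>\<^bsub>M\<^esub> h v) (\<Delta> x) \<otimes>\<^bsub>M\<^esub> S2 z) (\<Delta> a)"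
    "balanced M A A (\<lambda>x z. lift_tensor M (\<lambda>u v. S1 u \<otimes>\<^bsub>M\<^esub> h v) (\<Delta> x) \<otimes>\<^bsub>M\<^esub> S2 z)"
    by (rule convolution_expand[OF _ a], rule right_inverse, assumption)+
  have sc: "balanced M A A (\<lambda>x z. S2 (\<mu>\<^sub>l (\<epsilon> x 1) \<otimes> z))"
    by (rule balanced_comp[OF balanced_counit_left S2])
  note ex(1)
  also have "lift_tensor M (\<lambda>x z. lift_tensor M (\<lambda>u v. S1 u \<otimes>\<^bsub>M\<^esub> h v) (\<Delta> x) \<otimes>\<^bsub>M\<^esub> S2 z) (\<Delta> a) =
      lift_tensor M (\<lambda>x z. S2 (\<mu>\<^sub>l (\<epsilon> x 1) \<otimes> z)) (\<Delta> a)"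
  proof (rule lift_cong_carrier[OF bc MV ex(2) sc _ comult_carrier[OF a]])
    fix \<alpha> \<gamma> \<beta> x z assume x: "x \<in> bigr A \<alpha> \<gamma>" and z: "z \<in> bigr A \<gamma> \<beta>"
    have "shift \<alpha> (\<epsilon> x 1) = shift \<gamma> (\<epsilon> x 1)" using counit_homogeneous(2)[OF x] by (cases "\<alpha> = \<gamma>") auto
    then show "lift_tensor M (\<lambda>u v. S1 u \<otimes>\<^bsub>M\<^esub> h v) (\<Delta> x) \<otimes>\<^bsub>M\<^esub> S2 z = S2 (\<mu>\<^sub>l (\<epsilon> x 1) \<otimes> z)"
      by (simp add: left_inverse[OF x] lmom_comm[OF z] S2_lmom bigr_in_carrier[OF z])
  qed
  also have "\<dots> = S2 (lift_tensor A (\<lambda>x z. \<mu>\<^sub>l (\<epsilon> x 1) \<otimes> z) (\<Delta> a))"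
    by (rule lift_comp[OF bc cvector_space MV balanced_counit_left S2 comult_carrier[OF a]])
  finally show ?thesis by (simp add: counit_sum_left[OF a])
qed

end

end

section \<open>Bihomogeneous components\<close>

context h_algebra
begin

lemma decompositionI:
  assumes "\<And>\<alpha> \<beta>. c \<alpha> \<beta> \<in> bigr A \<alpha> \<beta>" "finite K" "\<And>\<alpha> \<beta>. c \<alpha> \<beta> \<noteq> \<zero> \<Longrightarrow> (\<alpha>, \<beta>) \<in> K"
    and "x = (\<Oplus>d \<in> K. c (fst d) (snd d))"
  shows "decomposition A x c"
proof -
  have sub: "{(\<alpha>, \<beta>). c \<alpha> \<beta> \<noteq> \<zero>} \<subseteq> K" using assms(3) by auto
  have "(\<Oplus>d \<in> K. c (fst d) (snd d)) = (\<Oplus>d \<in> {(\<alpha>, \<beta>). c \<alpha> \<beta> \<noteq> \<zero>}. c (fst d) (snd d))"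
    using assms(2) sub bigr_in_carrier[OF assms(1)] by (intro add.finprod_mono_neutral_cong_right) auto
  then show ?thesis
    unfolding decomposition_def using assms finite_subset[OF sub] by simp
qed

lemma decomposition_component:
  assumes "x \<in> carrier A"
  shows "decomposition A x (\<lambda>\<alpha> \<beta>. component A \<alpha> \<beta> x)"
  using theI'[OF direct_sum[OF assms]] by (simp add: component_def)

lemma component_eqI: "decomposition A x c \<Longrightarrow> x \<in> carrier A \<Longrightarrow> component A \<alpha> \<beta> x = c \<alpha> \<beta>"
  using decomposition_component[of x] direct_sum[of x] by (metis (no_types, lifting))

lemma component_bigr: "x \<in> carrier A \<Longrightarrow> component A \<alpha> \<beta> x \<in> bigr A \<alpha> \<beta>"
  using decomposition_component by (auto simp: decomposition_def)

lemma component_carrier [simp]: "x \<in> carrier A \<Longrightarrow> component A \<alpha> \<beta> x \<in> carrier A"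
  using component_bigr bigr_in_carrier by blast

definition component_support :: "'a \<Rightarrow> ('v \<times> 'v) set" where
  "component_support x = {(\<alpha>, \<beta>). component A \<alpha> \<beta> x \<noteq> \<zero>}"

lemma finite_component_support: "x \<in> carrier A \<Longrightarrow> finite (component_support x)"
  using decomposition_component by (auto simp: decomposition_def component_support_def)

lemma sum_components:
  assumes "x \<in> carrier A" "finite K" "component_support x \<subseteq> K"
  shows "(\<Oplus>d \<in> K. component A (fst d) (snd d) x) = x"
proof -
  have "x = (\<Oplus>d \<in> component_support x. component A (fst d) (snd d) x)"
    using decomposition_component[OF assms(1)] by (auto simp: decomposition_def component_support_def)
  also have "\<dots> = (\<Oplus>d \<in> K. component A (fst d) (snd d) x)"
    using assms by (intro add.finprod_mono_neutral_cong_left) (auto simp: component_support_def)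
  finally show ?thesis by simp
qed

lemma component_add:
  assumes "x \<in> carrier A" "y \<in> carrier A"
  shows "component A \<alpha> \<beta> (x \<oplus> y) = component A \<alpha> \<beta> x \<oplus> component A \<alpha> \<beta> y"
proof (rule component_eqI[OF decompositionI[where K = "component_support x \<union> component_support y"]])
  let ?K = "component_support x \<union> component_support y"
  have "(\<Oplus>d \<in> ?K. component A (fst d) (snd d) x \<oplus> component A (fst d) (snd d) y) =
      (\<Oplus>d \<in> ?K. component A (fst d) (snd d) x) \<oplus> (\<Oplus>d \<in> ?K. component A (fst d) (snd d) y)"
    using assms by (intro add.finprod_multf) auto
  then show "x \<oplus> y = (\<Oplus>d \<in> ?K. component A (fst d) (snd d) x \<oplus> component A (fst d) (snd d) y)"
    using assms by (simp add: sum_components finite_component_support)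
  show "finite ?K" using assms by (simp add: finite_component_support)
qed (use assms in \<open>auto simp: bigr_add component_bigr component_support_def\<close>)

lemma component_smult:
  assumes "x \<in> carrier A"
  shows "component A \<alpha> \<beta> (c \<odot> x) = c \<odot> component A \<alpha> \<beta> x"
proof (rule component_eqI[OF decompositionI[where K = "component_support x"]])
  let ?K = "component_support x"
  have "c \<odot> (\<Oplus>d \<in> K. component A (fst d) (snd d) x) = (\<Oplus>d \<in> K. c \<odot> component A (fst d) (snd d) x)"
    if "finite K" for K
    using that assms smult_r_null[of c]
    by (induction K rule: finite_induct) (auto simp: smult_add_vec)
  from this[OF finite_component_support[OF assms]]
  show "c \<odot> x = (\<Oplus>d \<in> ?K. c \<odot> component A (fst d) (snd d) x)"
    by (simp only: sum_components[OF assms finite_component_support[OF assms] order_refl])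
  show "(\<alpha>, \<beta>) \<in> ?K" if "c \<odot> component A \<alpha> \<beta> x \<noteq> \<zero>" for \<alpha> \<beta>
    using that smult_r_null[of c] by (auto simp: component_support_def)
qed (use assms in \<open>auto simp: bigr_smult component_bigr finite_component_support\<close>)

lemma clinear_component: "clinear_on A A (component A \<alpha> \<beta>)"
  by (simp add: clinear_on_def component_add component_smult)

lemma component_homogeneous:
  assumes "x \<in> bigr A \<alpha> \<beta>"
  shows "component A \<gamma> \<delta> x = (if \<gamma> = \<alpha> \<and> \<delta> = \<beta> then x else \<zero>)"
  using bigr_in_carrier[OF assms]
  by (intro component_eqI[OF decompositionI[where K = "{(\<alpha>, \<beta>)}"]])
     (auto simp: assms bigr_zero split: if_splits)

lemma component_zero: "component A \<alpha> \<beta> \<zero> = \<zero>"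
  using component_homogeneous[OF bigr_zero, of \<alpha> \<beta> \<alpha> \<beta>] by simp

text \<open>Right multiplication by \<open>b\<close> translates all bidegrees by a fixed amount, so
  no other component of \<open>x\<close> can contribute.\<close>

lemma component_mult_right:
  assumes b: "b \<in> bigr A \<gamma> \<delta>" and x: "x \<in> carrier A"
  shows "component A \<alpha> \<beta> x \<otimes> b = component A (\<alpha> + \<gamma>) (\<beta> + \<delta>) (x \<otimes> b)"
  using x
proof (induction rule: carrier_induct)
  case (homogeneous \<xi> \<eta> x)
  then show ?case using bigr_in_carrier[OF b]
    by (auto simp: component_homogeneous[OF homogeneous] component_homogeneous[OF bigr_mult[OF homogeneous b]])
next
  case (add x y)
  then show ?case using bigr_in_carrier[OF b] by (simp add: component_add l_distr)
qed

text \<open>Unlike in \<open>carrier_induct\<close>, \<open>P\<close> is required only for the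
  components of the given \<open>x\<close>, not for all homogeneous elements. Properties that are
  assumed of generators alone demand this form.\<close>

lemma components_induct:
  assumes x: "x \<in> carrier A" and zero: "P \<zero>" and comp: "\<And>\<alpha> \<beta>. P (component A \<alpha> \<beta> x)"
    and add: "\<And>u v. u \<in> carrier A \<Longrightarrow> v \<in> carrier A \<Longrightarrow> P u \<Longrightarrow> P v \<Longrightarrow> P (u \<oplus> v)"
  shows "P x"
proof -
  have "P (\<Oplus>d \<in> K. component A (fst d) (snd d) x)" if "finite K" for K
    using that
  proof (induction K rule: finite_induct)
    case empty
    then show ?case using zero by simp
  next
    case (insert d K)
    then show ?case using x by (auto intro!: add comp finsum_closed)
  qed
  from this[OF finite_component_support[OF x]] show ?thesis
    by (simp only: sum_components[OF x finite_component_support[OF x] order_refl])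
qed

text \<open>Glues one linear map per bidegree into a single linear map on \<open>A\<close>; the
  graded part of the antipode is built in this way.\<close>

lemma clinear_graded_map:
  assumes T: "\<And>\<alpha> \<beta>. clinear_on A A (T \<alpha> \<beta>)"
  shows "clinear_on A A (\<lambda>x. \<Oplus>d \<in> component_support x. T (fst d) (snd d) (component A (fst d) (snd d) x))"
    (is "clinear_on A A ?S")
proof -
  have Tc: "T \<alpha> \<beta> (component A \<alpha> \<beta> x) \<in> carrier A" if "x \<in> carrier A" for x \<alpha> \<beta>
    using clinear_onD(1)[OF T] that by simp
  have T0: "T \<alpha> \<beta> \<zero> = \<zero>" for \<alpha> \<beta>
    by (rule clinear_on_zero[OF T cvector_space_axioms cvector_space_axioms])
  \<comment> \<open>The supports of \<open>x\<close>, \<open>y\<close> and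
    \<open>x \<oplus> y\<close> differ. Terms outside the support vanish since
    \<open>T \<alpha> \<beta> \<zero> = \<zero>\<close>, so all sums can be taken over a common
    finite set and compared termwise.\<close>
  have ext: "?S x = (\<Oplus>d \<in> K. T (fst d) (snd d) (component A (fst d) (snd d) x))"
    if "x \<in> carrier A" "finite K" "component_support x \<subseteq> K" for x K
    using that Tc T0 by (intro add.finprod_mono_neutral_cong_left) (auto simp: component_support_def)
  show ?thesis
    unfolding clinear_on_def
  proof (intro conjI ballI allI)
    show "?S \<in> carrier A \<rightarrow> carrier A" using Tc by (auto intro: finsum_closed)
    fix x assume x: "x \<in> carrier A"
    show "?S (x \<oplus> y) = ?S x \<oplus> ?S y" if y: "y \<in> carrier A" for y
    proof -
      let ?K = "component_support x \<union> component_support y \<union> component_support (x \<oplus> y)"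
      have K: "finite ?K" using x y by (simp add: finite_component_support)
      have "?S (x \<oplus> y) = (\<Oplus>d \<in> ?K. T (fst d) (snd d) (component A (fst d) (snd d) (x \<oplus> y)))"
        using x y K by (intro ext) auto
      also have "\<dots> = (\<Oplus>d \<in> ?K. T (fst d) (snd d) (component A (fst d) (snd d) x) \<oplus>
          T (fst d) (snd d) (component A (fst d) (snd d) y))"
        using x y by (simp add: component_add clinear_onD(2)[OF T])
      also have "\<dots> = (\<Oplus>d \<in> ?K. T (fst d) (snd d) (component A (fst d) (snd d) x)) \<oplus>
          (\<Oplus>d \<in> ?K. T (fst d) (snd d) (component A (fst d) (snd d) y))"
        using x y Tc by (intro add.finprod_multf) auto
      also have "\<dots> = ?S x \<oplus> ?S y"
        using x y K by (intro arg_cong2[where f = "(\<oplus>)"] ext[symmetric]) auto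
      finally show ?thesis .
    qed
    fix c
    let ?K = "component_support x \<union> component_support (c \<odot> x)"
    have K: "finite ?K" using x by (simp add: finite_component_support)
    have sm: "c \<odot> (\<Oplus>d \<in> K. T (fst d) (snd d) (component A (fst d) (snd d) x)) =
        (\<Oplus>d \<in> K. c \<odot> T (fst d) (snd d) (component A (fst d) (snd d) x))" if "finite K" for K
      using that x Tc smult_r_null[of c]
      by (induction K rule: finite_induct) (auto simp: smult_add_vec finsum_closed Pi_def)
    have "?S (c \<odot> x) = (\<Oplus>d \<in> ?K. T (fst d) (snd d) (component A (fst d) (snd d) (c \<odot> x)))"
      using x K by (intro ext) auto
    also have "\<dots> = (\<Oplus>d \<in> ?K. c \<odot> T (fst d) (snd d) (component A (fst d) (snd d) x))"
      using x by (simp add: component_smult clinear_onD(3)[OF T])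
    also have "\<dots> = c \<odot> (\<Oplus>d \<in> ?K. T (fst d) (snd d) (component A (fst d) (snd d) x))"
      by (rule sm[OF K, symmetric])
    also have "\<dots> = c \<odot> ?S x" using x K by (intro arg_cong[where f = "\<lambda>y. c \<odot> y"] ext[symmetric]) auto
    finally show "?S (c \<odot> x) = c \<odot> ?S x" .
  qed
qed

lemma graded_map_homogeneous:
  assumes T: "\<And>\<alpha> \<beta>. clinear_on A A (T \<alpha> \<beta>)" and x: "x \<in> bigr A \<alpha> \<beta>"
  shows "(\<Oplus>d \<in> component_support x. T (fst d) (snd d) (component A (fst d) (snd d) x)) = T \<alpha> \<beta> x"
proof (cases "x = \<zero>")
  case True
  then show ?thesis
    using clinear_on_zero[OF T cvector_space_axioms cvector_space_axioms]
    by (simp add: component_support_def component_zero)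
next
  case False
  then have "component_support x = {(\<alpha>, \<beta>)}"
    by (auto simp: component_support_def component_homogeneous[OF x] split: if_splits)
  then show ?thesis
    using clinear_onD(1)[OF T bigr_in_carrier[OF x]] by (simp add: component_homogeneous[OF x])
qed

lemma clinear_lift_param:
  assumes C: "cvector_space C" and X: "X \<in> carrier AA"
    and \<Phi>: "\<And>b. b \<in> carrier A \<Longrightarrow> balanced C A A (\<Phi> b)"
    and lin: "\<And>\<alpha> \<gamma> \<beta> x y. x \<in> bigr A \<alpha> \<gamma> \<Longrightarrow> y \<in> bigr A \<gamma> \<beta> \<Longrightarrow> clinear_on A C (\<lambda>b. \<Phi> b x y)"
  shows "clinear_on A C (\<lambda>b. lift_tensor C (\<Phi> b) X)"
  unfolding clinear_on_def
proof (intro conjI ballI allI funcsetI)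
  note bc = bigr_closed bigr_closed and X' = X[unfolded mtensor_carrier_span]
  fix b c assume b: "b \<in> carrier A"
  show "lift_tensor C (\<Phi> b) X \<in> carrier C"
    by (rule tensor_lift.lift_closed[OF tensor_liftI[OF bc C \<Phi>[OF b]] X])
  show "lift_tensor C (\<Phi> (c \<odot> b)) X = c \<odot>\<^bsub>C\<^esub> lift_tensor C (\<Phi> b) X"
    by (rule lift_fun_smult[OF bc C \<Phi>[OF b] \<Phi>[OF smult_carrier[OF b]] _ X']) 
       (rule clinear_onD(3)[OF lin b])
  fix b' assume b': "b' \<in> carrier A"
  show "lift_tensor C (\<Phi> (b \<oplus> b')) X = lift_tensor C (\<Phi> b) X \<oplus>\<^bsub>C\<^esub> lift_tensor C (\<Phi> b') X"
    by (rule lift_fun_add[OF bc C \<Phi>[OF b] \<Phi>[OF b'] \<Phi>[OF a_closed[OF b b']] _ X'])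
       (rule clinear_onD(2)[OF lin b b'])
qed

end

section \<open>The antipode\<close>

lemma (in h_bialgebroid) bialgebroid_map_id: "bialgebroid_map A \<Delta> \<epsilon> A (\<lambda>x. x)"
  by (simp add: bialgebroid_map_def bialgebroid_map_axioms_def h_bialgebroid_axioms complex_algebra clinear_id)

lemma (in h_bialgebroid) bialgebroid_map_comult: "bialgebroid_map A \<Delta> \<epsilon> AA \<Delta>"
  by (simp add: bialgebroid_map_def bialgebroid_map_axioms_def h_bialgebroid_axioms
      complex_algebra_mtensor comult_clinear comult_mult)

text \<open>Passing \<open>z\<close> costs a shift by \<gamma> rather than \<alpha>, but the two can
  differ only where \<open>\<epsilon> x\<close> is zero.\<close>

lemma (in h_bialgebroid) lmom_counit_comm:
  assumes x: "x \<in> bigr A \<alpha> \<gamma>" and z: "z \<in> bigr A \<gamma> \<beta>"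
  shows "z \<otimes> \<mu>\<^sub>l (shift \<alpha> (\<epsilon> x 1)) = \<mu>\<^sub>l (\<epsilon> x 1) \<otimes> z"
proof -
  have "shift \<alpha> (\<epsilon> x 1) = shift \<gamma> (\<epsilon> x 1)" using counit_homogeneous(2)[OF x] by (cases "\<alpha> = \<gamma>") auto
  then show ?thesis by (simp add: lmom_comm[OF z])
qed

context h_hopf_algebroid
begin

sublocale idm: bialgebroid_map A \<Delta> \<epsilon> A "\<lambda>x. x"
  by (rule bialgebroid_map_id)

lemma S_closed [simp]: "x \<in> carrier A \<Longrightarrow> S x \<in> carrier A"
  using clinear_onD[OF antipode_linear] by blast

lemma balanced_antipode_left: "balanced A A A (\<lambda>x y. x \<otimes> S y)"
  by (rule idm.balanced_convolution_right[OF antipode_linear antipode_linear antipode_rmom antipode_lmom])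

lemma balanced_antipode_right: "balanced A A A (\<lambda>x y. S x \<otimes> y)"
  by (rule idm.balanced_convolution_left[OF antipode_linear antipode_linear antipode_rmom antipode_lmom])

lemma sum_antipode_left: "a \<in> carrier A \<Longrightarrow> lift_tensor A (\<lambda>x y. x \<otimes> S y) (\<Delta> a) = \<mu>\<^sub>l (\<epsilon> a 1)"
  using antipode_left by (simp add: antipode_id_left_def)

lemma sum_antipode_right:
  "a \<in> bigr A \<alpha> \<beta> \<Longrightarrow> lift_tensor A (\<lambda>x y. S x \<otimes> y) (\<Delta> a) = \<mu>\<^sub>r (shift \<alpha> (\<epsilon> a 1))"
  using antipode_right by (simp add: antipode_id_right_def)

text \<open>\<open>S'\<close> enters only as a left inverse with the rule for the right moment map.
  This is exactly what can be checked for the graded part of \<open>S\<close>.\<close>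

lemma antipode_unique:
  assumes "clinear_on A A S'"
    and "\<And>x f. x \<in> carrier A \<Longrightarrow> S' (\<mu>\<^sub>r f \<otimes> x) = S' x \<otimes> \<mu>\<^sub>l f"
    and "\<And>\<alpha> \<beta> a. a \<in> bigr A \<alpha> \<beta> \<Longrightarrow> lift_tensor A (\<lambda>x y. S' x \<otimes> y) (\<Delta> a) = \<mu>\<^sub>r (shift \<alpha> (\<epsilon> a 1))"
    and "a \<in> carrier A"
  shows "S' a = S a"
  by (rule idm.convolution_inverse_unique[OF assms(1) antipode_linear assms(2) antipode_lmom _ _ assms(4)])
     (auto intro: sum_antipode_left bigr_in_carrier assms(3))

text \<open>The part of \<open>S\<close> that reverses and negates degrees is an antipode as well.\<close>

lemma antipode_bigr:
  assumes "a \<in> bigr A \<alpha> \<beta>"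
  shows "S a \<in> bigr A (- \<beta>) (- \<alpha>)"
proof -
  define T where "T \<alpha> \<beta> x = component A (- \<beta>) (- \<alpha>) (S x)" for \<alpha> \<beta> x
  have T: "clinear_on A A (T \<alpha> \<beta>)" for \<alpha> \<beta>
    unfolding T_def by (rule clinear_compose[OF antipode_linear clinear_component])
  define S' where "S' x = (\<Oplus>d \<in> component_support x. T (fst d) (snd d) (component A (fst d) (snd d) x))" for x
  have S': "clinear_on A A S'"
    using clinear_graded_map[OF T] by (simp add: S'_def[abs_def])
  have S'h: "S' x = component A (- \<beta>) (- \<alpha>) (S x)" if "x \<in> bigr A \<alpha> \<beta>" for x \<alpha> \<beta>
    using graded_map_homogeneous[OF T that] by (simp add: S'_def T_def)
  have S'r: "S' (\<mu>\<^sub>r f \<otimes> x) = S' x \<otimes> \<mu>\<^sub>l f" if "x \<in> carrier A" for x f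
    using that
  proof (induction rule: carrier_induct)
    case (homogeneous \<alpha> \<beta> x)
    then show ?case using component_mult_right[OF lmom_bigr, of "S x" "- \<beta>" "- \<alpha>" f] bigr_in_carrier[OF homogeneous]
      by (simp add: S'h[OF homogeneous] S'h[OF bigr_rmom_left[OF homogeneous]] antipode_rmom)
  next
    case (add x y)
    then show ?case using clinear_onD[OF S'] by (simp add: r_distr l_distr)
  qed
  have "S' a = S a"
  proof (rule antipode_unique[OF S' S'r _ bigr_in_carrier[OF assms]])
    fix \<alpha> \<beta> a assume a: "a \<in> bigr A \<alpha> \<beta>"
    note ca = comult_carrier[OF bigr_in_carrier[OF a]]
    note bc = bigr_closed bigr_closed
    \<comment> \<open>The projection of \<open>S x\<close> to degree (-\<gamma>, -\<alpha>) depends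
      on the summand. After multiplication by \<open>y\<close> of degree (\<gamma>, \<beta>) it
      becomes the projection to (0, \<beta> - \<alpha>), which is the same for all summands and can
      leave the sum.\<close>
    have "lift_tensor A (\<lambda>x y. S' x \<otimes> y) (\<Delta> a) =
        lift_tensor A (\<lambda>x y. component A 0 (\<beta> - \<alpha>) (S x \<otimes> y)) (\<Delta> a)"
    proof (rule lift_cong[OF bc cvector_space _ _ _ hmod_homD(1)[OF comult_hmod_hom a]])
      show "balanced A A A (\<lambda>x y. S' x \<otimes> y)"
        by (rule idm.balanced_convolution_left[OF S' antipode_linear S'r antipode_lmom])
      show "balanced A A A (\<lambda>x y. component A 0 (\<beta> - \<alpha>) (S x \<otimes> y))"
        by (rule balanced_comp[OF balanced_antipode_right clinear_component])
      fix \<gamma> x y assume x: "x \<in> bigr A \<alpha> \<gamma>" and y: "y \<in> bigr A \<gamma> \<beta>"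
      show "S' x \<otimes> y = component A 0 (\<beta> - \<alpha>) (S x \<otimes> y)"
        using component_mult_right[OF y, of "S x" "- \<gamma>" "- \<alpha>"] bigr_in_carrier[OF x]
        by (simp add: S'h[OF x])
    qed
    also have "\<dots> = component A 0 (\<beta> - \<alpha>) (lift_tensor A (\<lambda>x y. S x \<otimes> y) (\<Delta> a))"
      by (rule lift_comp[OF bc cvector_space cvector_space balanced_antipode_right clinear_component ca])
    also have "\<dots> = component A 0 (\<beta> - \<alpha>) (\<mu>\<^sub>r (shift \<alpha> (\<epsilon> a 1)))"
      by (simp add: sum_antipode_right[OF a])
    \<comment> \<open>For \<alpha> = \<beta> the moment lies in degree (0, 0), onto which the
      projection goes; otherwise the counit of \<open>a\<close> vanishes.\<close>
    also have "\<dots> = \<mu>\<^sub>r (shift \<alpha> (\<epsilon> a 1))"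
      using counit_homogeneous(2)[OF a]
      by (cases "\<alpha> = \<beta>") (auto simp: component_homogeneous[OF rmom_bigr] rmom_zero component_zero)
    finally show "lift_tensor A (\<lambda>x y. S' x \<otimes> y) (\<Delta> a) = \<mu>\<^sub>r (shift \<alpha> (\<epsilon> a 1))" .
  qed
  moreover have "S' a \<in> bigr A (- \<beta>) (- \<alpha>)"
    using bigr_in_carrier[OF assms] by (simp add: S'h[OF assms] component_bigr)
  ultimately show ?thesis by simp
qed

text \<open>The coproduct of 1 is a single tensor, so the left antipode identity at 1 reads 1 S(1) =
  1.\<close>

lemma antipode_one: "S \<one> = \<one>"
proof -
  interpret L: tensor_lift A A A "\<lambda>x y. x \<otimes> S y"
    by (rule tensor_liftI[OF bigr_closed bigr_closed cvector_space balanced_antipode_left])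
  show ?thesis
    using sum_antipode_left[of \<one>] L.lift_tensor_tensor[OF one_bigr one_bigr]
    by (simp add: comult_one counit_one lmom_one)
qed

lemma antipode_mom: "S (\<mu>\<^sub>l f) = \<mu>\<^sub>r f" "S (\<mu>\<^sub>r f) = \<mu>\<^sub>l f"
  using antipode_lmom[of \<one> f] antipode_rmom[of \<one> f] by (simp_all add: antipode_one)

text \<open>Compare \<open>(a b)\<inverse> a = b\<inverse>\<close> in a group.\<close>

lemma antipode_mult_sum:
  assumes a: "a \<in> bigr A \<alpha> \<beta>" and b: "b \<in> bigr A \<gamma> \<delta>"
  shows "lift_tensor A (\<lambda>u v. S (u \<otimes> b) \<otimes> v) (\<Delta> a) = \<mu>\<^sub>r (shift (\<alpha> + \<gamma>) (\<epsilon> a 1)) \<otimes> S b"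
proof -
  note bc = bigr_closed bigr_closed and V = cvector_space
  note ac = bigr_in_carrier[OF a] and ca = comult_carrier[OF bigr_in_carrier[OF a]]
  note Sl = clinear_onD[OF antipode_linear]
  \<comment> \<open>With \<open>a\<close> fixed, \<open>G\<close> is to take the part of
    \<open>S1\<close> in \<open>convolution_expand\<close>, as a function of \<open>b\<close>. This
    requires its linearity and its behaviour under \<open>\<mu>\<^sub>r f\<close>.\<close>
  define G where "G b = lift_tensor A (\<lambda>u v. S (u \<otimes> b) \<otimes> v) (\<Delta> a)" for b
  have tb: "balanced A A A (\<lambda>u v. S (u \<otimes> b) \<otimes> v)" if "b \<in> carrier A" for b
    using that by (intro balancedI) (auto simp: bigr_in_carrier l_distr r_distr Sl smult_mult_left
        smult_mult_right antipode_rmom m_assoc)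
  have G: "clinear_on A A G"
    unfolding G_def[abs_def]
    by (rule clinear_lift_param[OF V ca tb], assumption)
       (auto simp: clinear_on_def bigr_in_carrier l_distr r_distr Sl smult_mult_left smult_mult_right)
  have Gr: "G (\<mu>\<^sub>r f \<otimes> b) = G b \<otimes> \<mu>\<^sub>l f" if b: "b \<in> carrier A" for b f
  proof -
    have rb: "\<mu>\<^sub>r f \<otimes> b \<in> carrier A" using b by simp
    have "G (\<mu>\<^sub>r f \<otimes> b) = lift_tensor A (\<lambda>u v. (S (u \<otimes> b) \<otimes> v) \<otimes> \<mu>\<^sub>l f) (\<Delta> a)"
      unfolding G_def
    proof (rule lift_cong_carrier[OF bc V tb[OF rb]
          balanced_comp[OF tb[OF b] idm.M.clinear_mult_right[OF lmom_carrier]] _ ca])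
      fix \<alpha> \<gamma> \<beta> u v assume u: "u \<in> bigr A \<alpha> \<gamma>" and v: "v \<in> bigr A \<gamma> \<beta>"
      note uc = bigr_in_carrier[OF u] and vc = bigr_in_carrier[OF v]
      have "u \<otimes> (\<mu>\<^sub>r f \<otimes> b) = \<mu>\<^sub>r (shift (- \<gamma>) f) \<otimes> (u \<otimes> b)"
        using uc b by (simp flip: m_assoc add: rmom_comm'[OF u])
      then show "S (u \<otimes> (\<mu>\<^sub>r f \<otimes> b)) \<otimes> v = (S (u \<otimes> b) \<otimes> v) \<otimes> \<mu>\<^sub>l f"
        using uc vc b by (simp add: antipode_rmom m_assoc lmom_comm'[OF v])
    qed
    also have "\<dots> = G b \<otimes> \<mu>\<^sub>l f"
      unfolding G_def
      by (rule lift_comp[OF bc V V tb[OF b] idm.M.clinear_mult_right[OF lmom_carrier] ca])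
    finally show ?thesis .
  qed
  \<comment> \<open>The convolution of \<open>G\<close> with the identity at \<open>x\<close> is the
    sum of S(a1 x1) a2 x2, which is the right antipode sum of the product
    \<open>a \<otimes> x\<close>.\<close>
  have inner: "lift_tensor A (\<lambda>u v. G u \<otimes> v) (\<Delta> x) = \<mu>\<^sub>r (shift (\<alpha> + \<gamma>) (\<epsilon> (a \<otimes> x) 1))"
    if x: "x \<in> bigr A \<gamma> \<eta>" for x \<gamma> \<eta>
  proof -
    note cx = comult_carrier[OF bigr_in_carrier[OF x]]
    let ?\<Phi> = "\<lambda>u v u' v'. S (u \<otimes> u') \<otimes> (v \<otimes> v')"
    note h = balanced_mult[OF balanced_antipode_right]
    have "\<mu>\<^sub>r (shift (\<alpha> + \<gamma>) (\<epsilon> (a \<otimes> x) 1)) = lift_tensor A (\<lambda>u v. S u \<otimes> v) (\<Delta> (a \<otimes> x))"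
      by (rule sum_antipode_right[OF bigr_mult[OF a x], symmetric])
    also have "\<dots> = lift_tensor A (\<lambda>u v. S u \<otimes> v) (\<Delta> a \<otimes>\<^bsub>AA\<^esub> \<Delta> x)"
      by (simp add: comult_mult ac bigr_in_carrier[OF x])
    also have "\<dots> = lift_tensor A (\<lambda>u v. lift_tensor A (?\<Phi> u v) (\<Delta> x)) (\<Delta> a)"
      by (rule lift_mult[OF V balanced_antipode_right ca cx])
    also have "\<dots> = lift_tensor A (\<lambda>u' v'. lift_tensor A (\<lambda>u v. ?\<Phi> u v u' v') (\<Delta> a)) (\<Delta> x)"
      by (rule lift_swap[OF V h ca cx])
    also have "\<dots> = lift_tensor A (\<lambda>u' v'. G u' \<otimes> v') (\<Delta> x)"
    proof (rule lift_cong_carrier[OF bc V _ _ _ cx])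
      show "balanced A A A (\<lambda>u' v'. lift_tensor A (\<lambda>u v. ?\<Phi> u v u' v') (\<Delta> a))"
        by (rule balanced_lift_param[OF V, of "\<lambda>u' v' u v. ?\<Phi> u v u' v'", OF h(2,1) ca])
      show "balanced A A A (\<lambda>u' v'. G u' \<otimes> v')"
        by (rule idm.balanced_convolution_left[OF G antipode_linear Gr antipode_lmom])
      fix \<alpha> \<gamma> \<beta> u' v' assume u': "u' \<in> bigr A \<alpha> \<gamma>" and v': "v' \<in> bigr A \<gamma> \<beta>"
      note uv' = bigr_in_carrier[OF u'] bigr_in_carrier[OF v']
      have "lift_tensor A (\<lambda>u v. ?\<Phi> u v u' v') (\<Delta> a) = lift_tensor A (\<lambda>u v. (S (u \<otimes> u') \<otimes> v) \<otimes> v') (\<Delta> a)"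
        by (rule lift_cong_carrier[OF bc V h(2)[OF u' v']
              balanced_comp[OF tb[OF uv'(1)] idm.M.clinear_mult_right[OF uv'(2)]] _ ca])
           (simp add: m_assoc bigr_in_carrier uv')
      also have "\<dots> = G u' \<otimes> v'"
        unfolding G_def
        by (rule lift_comp[OF bc V V tb[OF uv'(1)] idm.M.clinear_mult_right[OF uv'(2)] ca])
      finally show "lift_tensor A (\<lambda>u v. ?\<Phi> u v u' v') (\<Delta> a) = G u' \<otimes> v'" .
    qed
    finally show ?thesis by simp
  qed
  note bcar = bigr_in_carrier[OF b]
  have ex: "G b = lift_tensor A (\<lambda>x z. lift_tensor A (\<lambda>u v. G u \<otimes> v) (\<Delta> x) \<otimes> S z) (\<Delta> b)"
    "balanced A A A (\<lambda>x z. lift_tensor A (\<lambda>u v. G u \<otimes> v) (\<Delta> x) \<otimes> S z)"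
    by (rule idm.convolution_expand[OF G antipode_linear Gr antipode_lmom _ bcar],
        assumption, assumption, rule sum_antipode_left, rule bigr_in_carrier, assumption)+
  let ?m = "\<mu>\<^sub>r (shift (\<alpha> + \<gamma>) (\<epsilon> a 1))"
  have lin: "clinear_on A A (\<lambda>w. ?m \<otimes> S w)"
    by (rule clinear_compose[OF antipode_linear idm.M.clinear_mult_left[OF rmom_carrier]])
  note ex(1)
  also have "lift_tensor A (\<lambda>x z. lift_tensor A (\<lambda>u v. G u \<otimes> v) (\<Delta> x) \<otimes> S z) (\<Delta> b) =
      lift_tensor A (\<lambda>x z. ?m \<otimes> S (\<mu>\<^sub>l (\<epsilon> x 1) \<otimes> z)) (\<Delta> b)"
  proof (rule lift_cong[OF bc V ex(2) balanced_comp[OF balanced_counit_left lin] _ hmod_homD(1)[OF comult_hmod_hom b]])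
    fix \<eta> x z assume x: "x \<in> bigr A \<gamma> \<eta>" and z: "z \<in> bigr A \<eta> \<delta>"
    \<comment> \<open>The counit of the product contributes a shift by -\<beta> to the second
      coefficient. It cancels \<alpha> when the degrees of \<open>a\<close> agree, and otherwise the
      first coefficient is zero.\<close>
    have "shift (\<alpha> + \<gamma>) (\<epsilon> (a \<otimes> x) 1) = shift (\<alpha> + \<gamma>) (\<epsilon> a 1) * shift \<gamma> (\<epsilon> x 1)"
      using counit_homogeneous(2)[OF a] counit_mult_one[OF a bigr_in_carrier[OF x]]
      by (cases "\<alpha> = \<beta>") (auto simp: shift_mult shift_shift)
    then show "lift_tensor A (\<lambda>u v. G u \<otimes> v) (\<Delta> x) \<otimes> S z = ?m \<otimes> S (\<mu>\<^sub>l (\<epsilon> x 1) \<otimes> z)"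
      using bigr_in_carrier[OF z]
      by (simp add: inner[OF x] rmom_mult m_assoc antipode_lmom flip: lmom_counit_comm[OF x z])
  qed
  also have "\<dots> = ?m \<otimes> S (lift_tensor A (\<lambda>x z. \<mu>\<^sub>l (\<epsilon> x 1) \<otimes> z) (\<Delta> b))"
    by (rule lift_comp[OF bc V V balanced_counit_left lin comult_carrier[OF bcar]])
  finally show ?thesis by (simp add: counit_sum_left[OF bcar] G_def)
qed

text \<open>With \<open>b\<close> fixed, the map u -> S(u b) takes the part of \<open>S1\<close> in
  \<open>convolution_expand\<close>, and the inner sums are known from
  \<open>antipode_mult_sum\<close>. Since \<open>S b\<close> has right degree -\<gamma>, moving the
  moment to its right turns the shift \<alpha> + \<gamma> into \<alpha>; then it is absorbed into
  \<open>S z\<close>, and the counit restores \<open>a\<close>.\<close>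

lemma antipode_mult:
  assumes a: "a \<in> carrier A" and b: "b \<in> carrier A"
  shows "S (a \<otimes> b) = S b \<otimes> S a"
  using b
proof (induction rule: carrier_induct)
  case (add x y)
  then show ?case using a clinear_onD[OF antipode_linear] by (simp add: r_distr l_distr)
next
  case (homogeneous \<gamma> \<delta> b)
  note b = homogeneous and bcar = bigr_in_carrier[OF homogeneous]
  note bc = bigr_closed bigr_closed and V = cvector_space
  note Sl = clinear_onD[OF antipode_linear]
  have S1: "clinear_on A A (\<lambda>a. S (a \<otimes> b))"
    by (rule clinear_compose[OF idm.M.clinear_mult_right[OF bcar] antipode_linear])
  have S1r: "S (\<mu>\<^sub>r f \<otimes> x \<otimes> b) = S (x \<otimes> b) \<otimes> \<mu>\<^sub>l f" if "x \<in> carrier A" for x f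
    using that bcar by (simp add: m_assoc antipode_rmom)
  have ex: "S (a \<otimes> b) = lift_tensor A (\<lambda>x z. lift_tensor A (\<lambda>u v. S (u \<otimes> b) \<otimes> v) (\<Delta> x) \<otimes> S z) (\<Delta> a)"
    "balanced A A A (\<lambda>x z. lift_tensor A (\<lambda>u v. S (u \<otimes> b) \<otimes> v) (\<Delta> x) \<otimes> S z)"
    by (rule idm.convolution_expand[OF S1 antipode_linear S1r antipode_lmom _ a],
        assumption, assumption, rule sum_antipode_left, rule bigr_in_carrier, assumption)+
  have Sb: "S b \<in> carrier A" using bcar by simp
  have lin: "clinear_on A A (\<lambda>w. S b \<otimes> S w)"
    by (rule clinear_compose[OF antipode_linear idm.M.clinear_mult_left[OF Sb]])
  note ex(1)
  also have "lift_tensor A (\<lambda>x z. lift_tensor A (\<lambda>u v. S (u \<otimes> b) \<otimes> v) (\<Delta> x) \<otimes> S z) (\<Delta> a) =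
      lift_tensor A (\<lambda>x z. S b \<otimes> S (\<mu>\<^sub>l (\<epsilon> x 1) \<otimes> z)) (\<Delta> a)"
  proof (rule lift_cong_carrier[OF bc V ex(2) balanced_comp[OF balanced_counit_left lin] _ comult_carrier[OF a]])
    fix \<alpha> \<eta> \<beta> x z assume x: "x \<in> bigr A \<alpha> \<eta>" and z: "z \<in> bigr A \<eta> \<beta>"
    have "\<mu>\<^sub>r (shift (\<alpha> + \<gamma>) (\<epsilon> x 1)) \<otimes> S b = S b \<otimes> \<mu>\<^sub>r (shift \<alpha> (\<epsilon> x 1))"
      by (simp add: rmom_comm[OF antipode_bigr[OF b]] shift_shift)
    then show "lift_tensor A (\<lambda>u v. S (u \<otimes> b) \<otimes> v) (\<Delta> x) \<otimes> S z = S b \<otimes> S (\<mu>\<^sub>l (\<epsilon> x 1) \<otimes> z)"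
      using bigr_in_carrier[OF z] Sb
      by (simp add: antipode_mult_sum[OF x b] m_assoc antipode_lmom flip: lmom_counit_comm[OF x z])
  qed
  also have "\<dots> = S b \<otimes> S (lift_tensor A (\<lambda>x z. \<mu>\<^sub>l (\<epsilon> x 1) \<otimes> z) (\<Delta> a))"
    by (rule lift_comp[OF bc V V balanced_counit_left lin comult_carrier[OF a]])
  finally show ?case by (simp add: counit_sum_left[OF a])
qed

text \<open>The counit of the sum of S(a1) a2 is computed in two ways. By the right antipode
  identity it is the shifted coefficient. By multiplicativity only the value \<epsilon>(a2)1 of the
  second factor matters; it can be carried into S(a1) as a left moment, which is \<open>S\<close> of
  a right moment times a1, and these terms sum to \<open>S a\<close>.\<close>

lemma counit_antipode_one:
  assumes a: "a \<in> bigr A \<alpha> \<beta>"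
  shows "\<epsilon> (S a) 1 = shift \<alpha> (\<epsilon> a 1)"
proof -
  note bc = bigr_closed bigr_closed and V = cvector_space
  note ac = bigr_in_carrier[OF a] and ca = comult_carrier[OF bigr_in_carrier[OF a]]
  \<comment> \<open>The counit has values in the function field; composing with the injective
    \<open>\<mu>\<^sub>l\<close> moves them into \<open>A\<close>, where \<open>lift_tensor\<close>
    can sum them.\<close>
  define E where "E b = \<mu>\<^sub>l (\<epsilon> b 1)" for b
  have E: "clinear_on A A E"
    unfolding clinear_on_def E_def
  proof (intro conjI ballI allI)
    fix x c assume x: "x \<in> carrier A"
    show "\<mu>\<^sub>l (\<epsilon> (c \<odot> x) 1) = c \<odot> \<mu>\<^sub>l (\<epsilon> x 1)"
      using lmom_mult_smult[of \<one> c "\<epsilon> x 1"] x by (simp add: counit_smult)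
  qed (auto simp: counit_add lmom_add)
  have "E (S a) = E (S (lift_tensor A (\<lambda>x z. \<mu>\<^sub>r (\<epsilon> z 1) \<otimes> x) (\<Delta> a)))"
    by (simp add: counit_sum_right[OF ac])
  also have "\<dots> = lift_tensor A (\<lambda>x z. E (S (\<mu>\<^sub>r (\<epsilon> z 1) \<otimes> x))) (\<Delta> a)"
    by (rule lift_comp[OF bc V V balanced_counit_right clinear_compose[OF antipode_linear E] ca, symmetric])
  also have "\<dots> = lift_tensor A (\<lambda>x z. E (S x \<otimes> z)) (\<Delta> a)"
  proof (rule lift_cong_carrier[OF bc V balanced_comp[OF balanced_counit_right clinear_compose[OF antipode_linear E]]
        balanced_comp[OF balanced_antipode_right E] _ ca])
    fix \<alpha> \<gamma> \<beta> x z assume x: "x \<in> bigr A \<alpha> \<gamma>" and z: "z \<in> bigr A \<gamma> \<beta>"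
    show "E (S (\<mu>\<^sub>r (\<epsilon> z 1) \<otimes> x)) = E (S x \<otimes> z)"
      using bigr_in_carrier[OF x] bigr_in_carrier[OF z]
      by (simp add: E_def antipode_rmom counit_mult_one[OF antipode_bigr[OF x]] counit_lmom)
  qed
  also have "\<dots> = E (lift_tensor A (\<lambda>x z. S x \<otimes> z) (\<Delta> a))"
    by (rule lift_comp[OF bc V V balanced_antipode_right E ca])
  finally have "\<mu>\<^sub>l (\<epsilon> (S a) 1) = \<mu>\<^sub>l (shift \<alpha> (\<epsilon> a 1))"
    by (simp add: sum_antipode_right[OF a] E_def counit_rmom)
  then show ?thesis using lmom_inj by (simp add: inj_eq)
qed

text \<open>On homogeneous elements an operator is fixed by its value at 1 and its degree, and both
  are known for \<open>S a\<close>: the reversed degree turns the shift by -\<beta> into one by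
  \<alpha>.\<close>

lemma counit_antipode:
  assumes "a \<in> carrier A"
  shows "\<epsilon> (S a) = diff_antipode (\<epsilon> a)"
  using assms
proof (induction rule: carrier_induct)
  case (homogeneous \<alpha> \<beta> a)
  have "\<epsilon> (S a) = (\<lambda>g. shift \<alpha> (\<epsilon> a 1) * shift \<alpha> g)"
    using counit_homogeneous(1)[OF antipode_bigr[OF homogeneous]]
    by (simp add: counit_antipode_one[OF homogeneous])
  moreover have "diff_antipode (\<epsilon> a) = (\<lambda>g. shift \<beta> (\<epsilon> a 1 * g))"
    using counit_homogeneous(1)[OF homogeneous] diff_antipode_monomial[of "\<epsilon> a 1" "- \<beta>"] by simp
  ultimately show ?case
    using counit_homogeneous(2)[OF homogeneous] by (cases "\<alpha> = \<beta>") (auto simp: shift_mult)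
next
  case (add x y)
  have "\<epsilon> z \<in> carrier D\<^sub>\<hh>" if "z \<in> carrier A" for z
    using counit_hom that by (auto simp: h_hom_def ring_hom_def)
  then show ?case using add clinear_onD[OF antipode_linear]
    by (simp add: counit_add diff_antipode_add)
qed

end

context h_algebra
begin

text \<open>The projection to a component is inserted since \<open>tensor\<close> is bilinear on homogeneous elements only.\<close>

lemma clinear_tensor_right:
  assumes "t \<in> bigr A \<alpha> \<gamma>"
  shows "clinear_on A AA (\<lambda>w. tensor A A t (component A \<delta> \<beta> w))"
  by (auto simp: clinear_on_def tensor_carrier component_add component_smult
      tensor_homogeneous(2)[OF assms component_bigr component_bigr] tensor_homogeneous(4)[OF assms component_bigr])

lemma clinear_tensor_left:
  assumes "t \<in> bigr A \<delta> \<beta>"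
  shows "clinear_on A AA (\<lambda>w. tensor A A (component A \<alpha> \<gamma> w) t)"
  by (auto simp: clinear_on_def tensor_carrier component_add component_smult
      tensor_homogeneous(1)[OF component_bigr assms component_bigr] tensor_homogeneous(3)[OF component_bigr assms])

end

section \<open>The antipode and the coproduct\<close>

context h_hopf_algebroid
begin

text \<open>The reversal of degrees makes \<open>S b\<close> and \<open>S a\<close> meet at
  -\<gamma>. Antimultiplicativity puts the moments on the right of both factors and exchanges their
  kinds, so the claim becomes balancing from the right, the last rule of
  \<open>tensor_homogeneous\<close>.\<close>

lemma balanced_flip: "balanced AA A A (\<lambda>a b. tensor A A (S b) (S a))"
proof (rule balancedI)
  note Sl = clinear_onD[OF antipode_linear]
  fix \<alpha> \<gamma> \<beta> a b a' b' c f assume a: "a \<in> bigr A \<alpha> \<gamma>" and b: "b \<in> bigr A \<gamma> \<beta>"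
  note th = tensor_homogeneous[OF antipode_bigr[OF b] antipode_bigr[OF a]]
  note ab = bigr_in_carrier[OF a] bigr_in_carrier[OF b]
  show "tensor A A (S b) (S a) \<in> carrier AA" by (rule tensor_carrier)
  show "tensor A A (S b) (S (a \<oplus> a')) = tensor A A (S b) (S a) \<oplus>\<^bsub>AA\<^esub> tensor A A (S b) (S a')"
    if "a' \<in> bigr A \<alpha> \<gamma>"
    using th(2)[OF antipode_bigr[OF that]] ab bigr_in_carrier[OF that] by (simp add: Sl)
  show "tensor A A (S (b \<oplus> b')) (S a) = tensor A A (S b) (S a) \<oplus>\<^bsub>AA\<^esub> tensor A A (S b') (S a)"
    if "b' \<in> bigr A \<gamma> \<beta>"
    using th(1)[OF antipode_bigr[OF that]] ab bigr_in_carrier[OF that] by (simp add: Sl)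
  show "tensor A A (S b) (S (c \<odot> a)) = c \<odot>\<^bsub>AA\<^esub> tensor A A (S b) (S a)"
    "tensor A A (S (c \<odot> b)) (S a) = c \<odot>\<^bsub>AA\<^esub> tensor A A (S b) (S a)"
    using th(3,4) ab by (simp_all add: Sl)
  show "tensor A A (S b) (S (\<mu>\<^sub>r f \<otimes> a)) = tensor A A (S (\<mu>\<^sub>l f \<otimes> b)) (S a)"
    using th(6)[of f] ab by (simp add: antipode_rmom antipode_mult antipode_mom)
qed

text \<open>Supplies the rule demanded of \<open>S2\<close> when uniqueness is applied with
  \<open>h = \<Delta>\<close>, as \<open>\<Delta>\<close> maps moments to moments of the
  square.\<close>

lemma flip_antipode_lmom:
  assumes "X \<in> carrier AA"
  shows "flip_antipode A S (X \<otimes>\<^bsub>AA\<^esub> \<mu>\<^sub>l\<^bsub>AA\<^esub> f) = \<mu>\<^sub>r\<^bsub>AA\<^esub> f \<otimes>\<^bsub>AA\<^esub> flip_antipode A S X"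
proof -
  interpret L: tensor_lift A A AA "\<lambda>a b. tensor A A (S b) (S a)"
    by (rule tensor_liftI[OF bigr_closed bigr_closed mtensor_cvector_space balanced_flip])
  show ?thesis
    unfolding flip_antipode_def using bigr_closed bigr_closed assms
  proof (induction rule: mtensor_induct)
    case zero
    then show ?case by (simp add: L.lift_zero mtensor_mult_zero mtensor_mom_carrier)
  next
    case (tensor \<alpha> \<gamma> \<beta> a b)
    then show ?case
      by (simp add: mtensor_lmom tensor_mult[OF tensor lmom_bigr one_bigr] bigr_in_carrier
          L.lift_tensor_tensor[OF tensor] L.lift_tensor_tensor[OF bigr_lmom_right[OF tensor(1)] tensor(2)]
          antipode_lmom mtensor_rmom_mult_tensor[OF antipode_bigr[OF tensor(2)] antipode_bigr[OF tensor(1)]])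
  next
    case (add X Y)
    then show ?case
      by (simp add: mtensor_distrib mtensor_mom_carrier mtensor_mult_closed L.lift_add L.lift_closed)
  qed
qed

text \<open>The product of x tensor y with the flipped antipodes of u tensor v, as a function of
  four separate variables, so that coassociativity can regroup the fourfold coproduct.\<close>

definition flip_product :: "'a \<Rightarrow> 'a \<Rightarrow> 'a \<Rightarrow> 'a \<Rightarrow> ('a \<times> 'a \<Rightarrow>\<^sub>0 complex) set" where
  "flip_product x y u v = tensor A A (x \<otimes> S v) (y \<otimes> S u)"

text \<open>Balancing between \<open>y\<close> and \<open>u\<close> is the one rule that needs equal
  degrees: then \<open>y \<otimes> S u\<close> has right degree zero and commutes with
  \<open>\<mu>\<^sub>r f\<close>. The other two balancing rules are those of the tensor product,
  from the left and from the right.\<close>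

lemma flip_product_linear:
  assumes x: "x \<in> bigr A \<alpha>1 \<beta>1" and y: "y \<in> bigr A \<alpha>2 \<beta>2" and u: "u \<in> bigr A \<alpha>3 \<beta>3" and v: "v \<in> bigr A \<alpha>4 \<beta>4"
  shows "flip_product x y u v \<in> carrier AA"
    "x' \<in> bigr A \<alpha>1 \<beta>1 \<Longrightarrow> flip_product (x \<oplus> x') y u v = flip_product x y u v \<oplus>\<^bsub>AA\<^esub> flip_product x' y u v"
    "y' \<in> bigr A \<alpha>2 \<beta>2 \<Longrightarrow> flip_product x (y \<oplus> y') u v = flip_product x y u v \<oplus>\<^bsub>AA\<^esub> flip_product x y' u v"
    "u' \<in> bigr A \<alpha>3 \<beta>3 \<Longrightarrow> flip_product x y (u \<oplus> u') v = flip_product x y u v \<oplus>\<^bsub>AA\<^esub> flip_product x y u' v"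
    "v' \<in> bigr A \<alpha>4 \<beta>4 \<Longrightarrow> flip_product x y u (v \<oplus> v') = flip_product x y u v \<oplus>\<^bsub>AA\<^esub> flip_product x y u v'"
    "flip_product (c \<odot> x) y u v = c \<odot>\<^bsub>AA\<^esub> flip_product x y u v"
    "flip_product x (c \<odot> y) u v = c \<odot>\<^bsub>AA\<^esub> flip_product x y u v"
    "flip_product x y (c \<odot> u) v = c \<odot>\<^bsub>AA\<^esub> flip_product x y u v"
    "flip_product x y u (c \<odot> v) = c \<odot>\<^bsub>AA\<^esub> flip_product x y u v"
    "flip_product (\<mu>\<^sub>r f \<otimes> x) y u v = flip_product x (\<mu>\<^sub>l f \<otimes> y) u v"
    "\<beta>2 = \<alpha>3 \<Longrightarrow> flip_product x (\<mu>\<^sub>r f \<otimes> y) u v = flip_product x y (\<mu>\<^sub>l f \<otimes> u) v"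
    "flip_product x y (\<mu>\<^sub>r f \<otimes> u) v = flip_product x y u (\<mu>\<^sub>l f \<otimes> v)"
proof -
  note Sl = clinear_onD[OF antipode_linear]
  have p: "x' \<otimes> S v' \<in> bigr A (\<alpha>1 - \<beta>4) (\<beta>1 - \<alpha>4)" if "x' \<in> bigr A \<alpha>1 \<beta>1" "v' \<in> bigr A \<alpha>4 \<beta>4" for x' v'
    using bigr_mult[OF that(1) antipode_bigr[OF that(2)]] by simp
  have q: "y' \<otimes> S u' \<in> bigr A (\<alpha>2 - \<beta>3) (\<beta>2 - \<alpha>3)" if "y' \<in> bigr A \<alpha>2 \<beta>2" "u' \<in> bigr A \<alpha>3 \<beta>3" for y' u'
    using bigr_mult[OF that(1) antipode_bigr[OF that(2)]] by simp
  note th = tensor_homogeneous[OF p[OF x v] q[OF y u]]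
  note car [simp] = x[THEN bigr_in_carrier] y[THEN bigr_in_carrier] u[THEN bigr_in_carrier] v[THEN bigr_in_carrier]
  show "flip_product x y u v \<in> carrier AA" by (simp add: flip_product_def tensor_carrier)
  show "flip_product (x \<oplus> x') y u v = flip_product x y u v \<oplus>\<^bsub>AA\<^esub> flip_product x' y u v" if "x' \<in> bigr A \<alpha>1 \<beta>1"
    using th(1)[OF p[OF that v]] bigr_in_carrier[OF that] by (simp add: flip_product_def l_distr)
  show "flip_product x (y \<oplus> y') u v = flip_product x y u v \<oplus>\<^bsub>AA\<^esub> flip_product x y' u v" if "y' \<in> bigr A \<alpha>2 \<beta>2"
    using th(2)[OF q[OF that u]] bigr_in_carrier[OF that] by (simp add: flip_product_def l_distr)
  show "flip_product x y (u \<oplus> u') v = flip_product x y u v \<oplus>\<^bsub>AA\<^esub> flip_product x y u' v" if "u' \<in> bigr A \<alpha>3 \<beta>3"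
    using th(2)[OF q[OF y that]] bigr_in_carrier[OF that] by (simp add: flip_product_def r_distr Sl)
  show "flip_product x y u (v \<oplus> v') = flip_product x y u v \<oplus>\<^bsub>AA\<^esub> flip_product x y u v'" if "v' \<in> bigr A \<alpha>4 \<beta>4"
    using th(1)[OF p[OF x that]] bigr_in_carrier[OF that] by (simp add: flip_product_def r_distr Sl)
  show "flip_product (c \<odot> x) y u v = c \<odot>\<^bsub>AA\<^esub> flip_product x y u v"
    "flip_product x (c \<odot> y) u v = c \<odot>\<^bsub>AA\<^esub> flip_product x y u v"
    "flip_product x y (c \<odot> u) v = c \<odot>\<^bsub>AA\<^esub> flip_product x y u v"
    "flip_product x y u (c \<odot> v) = c \<odot>\<^bsub>AA\<^esub> flip_product x y u v"
    using th(3,4) by (simp_all add: flip_product_def Sl smult_mult_left smult_mult_right)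
  show "flip_product (\<mu>\<^sub>r f \<otimes> x) y u v = flip_product x (\<mu>\<^sub>l f \<otimes> y) u v"
    using th(5) by (simp add: flip_product_def m_assoc)
  show "flip_product x (\<mu>\<^sub>r f \<otimes> y) u v = flip_product x y (\<mu>\<^sub>l f \<otimes> u) v" if "\<beta>2 = \<alpha>3"
    using rmom_comm[OF q[OF y u], of f] that
    by (simp add: flip_product_def antipode_mult antipode_mom m_assoc shift_zero)
  show "flip_product x y (\<mu>\<^sub>r f \<otimes> u) v = flip_product x y u (\<mu>\<^sub>l f \<otimes> v)"
    using th(6)[of f] by (simp add: flip_product_def antipode_mult antipode_mom m_assoc)
qed

lemma balanced_flip_product:
  shows "x \<in> bigr A \<alpha> \<gamma> \<Longrightarrow> y \<in> bigr A \<delta> \<beta> \<Longrightarrow> balanced AA A A (flip_product x y)"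
    and "u \<in> bigr A \<alpha> \<gamma> \<Longrightarrow> v \<in> bigr A \<delta> \<beta> \<Longrightarrow> balanced AA A A (\<lambda>x y. flip_product x y u v)"
    and "x \<in> bigr A \<alpha> \<gamma> \<Longrightarrow> v \<in> bigr A \<delta> \<beta> \<Longrightarrow> balanced AA A A (\<lambda>y u. flip_product x y u v)"
  by (rule balancedI; rule flip_product_linear; (assumption | rule refl))+

text \<open>In x S(z3) tensor z1 S(z2) the second factor is summed first and gives the left moment
  of \<epsilon>(z1)1. It crosses the tensor sign and enters \<open>S\<close> as a left moment, and
  the counit collapses the remaining sum to x S(z) tensor 1.\<close>

lemma sum_flip_product:
  assumes x: "x \<in> bigr A \<alpha> \<gamma>" and z: "z \<in> bigr A \<gamma> \<beta>"
  shows "lift_tensor AA (\<lambda>y w. lift_tensor AA (flip_product x y) (\<Delta> w)) (\<Delta> z) = tensor A A (x \<otimes> S z) \<one>"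
    and "balanced AA A A (\<lambda>y w. lift_tensor AA (flip_product x y) (\<Delta> w))"
proof -
  note bc = bigr_closed bigr_closed and V = mtensor_cvector_space
  note cz = comult_carrier[OF bigr_in_carrier[OF z]] and xc = bigr_in_carrier[OF x] and zc = bigr_in_carrier[OF z]
  have co: "lift_tensor AA (\<lambda>y v. lift_tensor AA (\<lambda>y u. flip_product x y u v) (\<Delta> y)) (\<Delta> z) =
      lift_tensor AA (\<lambda>y w. lift_tensor AA (flip_product x y) (\<Delta> w)) (\<Delta> z)"
    "balanced AA A A (\<lambda>y v. lift_tensor AA (\<lambda>y u. flip_product x y u v) (\<Delta> y))"
    "balanced AA A A (\<lambda>y w. lift_tensor AA (flip_product x y) (\<Delta> w))"
    by (rule coassoc_lift[OF V _ _ zc], erule balanced_flip_product(3)[OF x], erule balanced_flip_product(1)[OF x])+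
  define R where "R w = tensor A A (component A (\<alpha> - \<beta>) 0 (x \<otimes> S w)) \<one>" for w
  have R: "clinear_on A AA R"
    unfolding R_def[abs_def]
    by (rule clinear_compose[OF _ clinear_tensor_left[OF one_bigr]])
       (rule clinear_compose[OF antipode_linear idm.M.clinear_mult_left[OF xc]])
  have "lift_tensor AA (\<lambda>y v. lift_tensor AA (\<lambda>y u. flip_product x y u v) (\<Delta> y)) (\<Delta> z) =
      lift_tensor AA (\<lambda>y v. R (\<mu>\<^sub>l (\<epsilon> y 1) \<otimes> v)) (\<Delta> z)"
  proof (rule lift_cong[OF bc V co(2) balanced_comp[OF balanced_counit_left R] _ hmod_homD(1)[OF comult_hmod_hom z]])
    fix \<xi> y v assume y: "y \<in> bigr A \<gamma> \<xi>" and v: "v \<in> bigr A \<xi> \<beta>"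
    note vc = bigr_in_carrier[OF v] and cy = comult_carrier[OF bigr_in_carrier[OF y]]
    have p: "x \<otimes> S v \<in> bigr A (\<alpha> - \<beta>) (\<gamma> - \<xi>)" using bigr_mult[OF x antipode_bigr[OF v]] by simp
    have "lift_tensor AA (\<lambda>y u. flip_product x y u v) (\<Delta> y) =
        lift_tensor AA (\<lambda>y u. tensor A A (x \<otimes> S v) (component A (\<gamma> - \<xi>) 0 (y \<otimes> S u))) (\<Delta> y)"
    proof (rule lift_cong[OF bc V balanced_flip_product(3)[OF x v]
          balanced_comp[OF balanced_antipode_left clinear_tensor_right[OF p]] _ hmod_homD(1)[OF comult_hmod_hom y]])
      fix \<eta> y u assume y: "y \<in> bigr A \<gamma> \<eta>" and u: "u \<in> bigr A \<eta> \<xi>"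
      have "y \<otimes> S u \<in> bigr A (\<gamma> - \<xi>) 0" using bigr_mult[OF y antipode_bigr[OF u]] by simp
      then show "flip_product x y u v = tensor A A (x \<otimes> S v) (component A (\<gamma> - \<xi>) 0 (y \<otimes> S u))"
        by (simp add: flip_product_def component_homogeneous)
    qed
    also have "\<dots> = tensor A A (x \<otimes> S v) (component A (\<gamma> - \<xi>) 0 (lift_tensor A (\<lambda>y u. y \<otimes> S u) (\<Delta> y)))"
      by (rule lift_comp[OF bc cvector_space V balanced_antipode_left clinear_tensor_right[OF p] cy])
    also have "\<dots> = tensor A A (x \<otimes> S v) (component A (\<gamma> - \<xi>) 0 (\<mu>\<^sub>l (\<epsilon> y 1)))"
      by (simp add: sum_antipode_left bigr_in_carrier[OF y])
    also have "component A (\<gamma> - \<xi>) 0 (\<mu>\<^sub>l (\<epsilon> y 1)) = \<mu>\<^sub>l (\<epsilon> y 1)"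
      using counit_homogeneous(2)[OF y]
      by (cases "\<gamma> = \<xi>") (auto simp: component_homogeneous[OF lmom_bigr] lmom_zero component_zero)
    also have "tensor A A (x \<otimes> S v) (\<mu>\<^sub>l (\<epsilon> y 1)) = tensor A A (x \<otimes> S v \<otimes> \<mu>\<^sub>r (\<epsilon> y 1)) \<one>"
      using tensor_homogeneous(6)[OF p one_bigr] by simp
    also have "x \<otimes> S v \<otimes> \<mu>\<^sub>r (\<epsilon> y 1) = x \<otimes> S (\<mu>\<^sub>l (\<epsilon> y 1) \<otimes> v)"
      using xc vc by (simp add: antipode_mult antipode_mom m_assoc)
    \<comment> \<open>Inserting the projection changes nothing: for \<gamma> = \<xi> the element
      lies in the chosen degree, and otherwise \<open>\<epsilon> y\<close> makes it zero.\<close>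
    also have "\<dots> = component A (\<alpha> - \<beta>) 0 (x \<otimes> S (\<mu>\<^sub>l (\<epsilon> y 1) \<otimes> v))"
    proof (cases "\<gamma> = \<xi>")
      case True
      have "x \<otimes> S (\<mu>\<^sub>l (\<epsilon> y 1) \<otimes> v) \<in> bigr A (\<alpha> - \<beta>) 0"
        using bigr_mult[OF x antipode_bigr[OF bigr_lmom_left[OF v]]] True by simp
      then show ?thesis by (simp add: component_homogeneous)
    next
      case False
      then show ?thesis
        using counit_homogeneous(2)[OF y] xc vc
          clinear_on_zero[OF antipode_linear cvector_space cvector_space]
        by (simp add: lmom_zero component_zero)
    qed
    finally show "lift_tensor AA (\<lambda>y u. flip_product x y u v) (\<Delta> y) = R (\<mu>\<^sub>l (\<epsilon> y 1) \<otimes> v)"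
      by (simp add: R_def)
  qed
  also have "\<dots> = R (lift_tensor A (\<lambda>y v. \<mu>\<^sub>l (\<epsilon> y 1) \<otimes> v) (\<Delta> z))"
    by (rule lift_comp[OF bc cvector_space V balanced_counit_left R cz])
  also have "\<dots> = R z" by (simp add: counit_sum_left[OF zc])
  also have "x \<otimes> S z \<in> bigr A (\<alpha> - \<beta>) 0" using bigr_mult[OF x antipode_bigr[OF z]] by simp
  then have "R z = tensor A A (x \<otimes> S z) \<one>"
    by (simp add: R_def component_homogeneous)
  finally show "lift_tensor AA (\<lambda>y w. lift_tensor AA (flip_product x y) (\<Delta> w)) (\<Delta> z) = tensor A A (x \<otimes> S z) \<one>"
    using co(1) by simp
  show "balanced AA A A (\<lambda>y w. lift_tensor AA (flip_product x y) (\<Delta> w))" by (rule co(3))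
qed

text \<open>Left multiplication by a fixed tensor is linear, so it can be moved into the sum over
  \<open>\<Delta> v\<close>, where it multiplies pure tensors.\<close>

lemma comult_flip_product:
  assumes U: "U \<in> bigr AA \<alpha> \<gamma>" and v: "v \<in> bigr A \<gamma> \<beta>"
  shows "U \<otimes>\<^bsub>AA\<^esub> flip_antipode A S (\<Delta> v) =
    lift_tensor AA (\<lambda>x y. lift_tensor AA (flip_product x y) (\<Delta> v)) U"
    and "balanced AA A A (\<lambda>x y. lift_tensor AA (flip_product x y) (\<Delta> v))"
proof -
  note bc = bigr_closed bigr_closed and V = mtensor_cvector_space
  note cv = comult_carrier[OF bigr_in_carrier[OF v]]
  interpret AAalg: complex_algebra AA by (rule complex_algebra_mtensor)
  show t: "balanced AA A A (\<lambda>x y. lift_tensor AA (flip_product x y) (\<Delta> v))"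
    by (rule balanced_lift_param[OF V balanced_flip_product(1) balanced_flip_product(2) cv])
  interpret L: tensor_lift A A AA "\<lambda>x y. lift_tensor AA (flip_product x y) (\<Delta> v)"
    by (rule tensor_liftI[OF bc V t])
  interpret F: tensor_lift A A AA "\<lambda>a b. tensor A A (S b) (S a)"
    by (rule tensor_liftI[OF bc V balanced_flip])
  note Fc = F.lift_closed[OF cv]
  note car = mtensor_bigr_carrier[THEN subsetD]
  show "U \<otimes>\<^bsub>AA\<^esub> flip_antipode A S (\<Delta> v) = lift_tensor AA (\<lambda>x y. lift_tensor AA (flip_product x y) (\<Delta> v)) U"
    unfolding flip_antipode_def using bc U
  proof (induction rule: mtensor_bigr_induct)
    case zero
    then show ?case using Fc by (simp add: L.lift_zero mtensor_mult_zero)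
  next
    case (add X Y)
    then show ?case using Fc by (simp add: car mtensor_distrib L.lift_add)
  next
    case (tensor \<eta> x y)
    note lin = AAalg.clinear_mult_left[OF tensor_carrier[of A A x y]]
    have "tensor A A x y \<otimes>\<^bsub>AA\<^esub> lift_tensor AA (\<lambda>a b. tensor A A (S b) (S a)) (\<Delta> v) =
        lift_tensor AA (\<lambda>a b. tensor A A x y \<otimes>\<^bsub>AA\<^esub> tensor A A (S b) (S a)) (\<Delta> v)"
      by (rule lift_comp[OF bc V V balanced_flip lin cv, symmetric])
    also have "\<dots> = lift_tensor AA (flip_product x y) (\<Delta> v)"
      by (rule lift_cong[OF bc V balanced_comp[OF balanced_flip lin] balanced_flip_product(1)[OF tensor] _
            hmod_homD(1)[OF comult_hmod_hom v]])
         (simp add: tensor_mult[OF tensor antipode_bigr antipode_bigr] flip_product_def)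
    finally show ?case by (simp add: L.lift_tensor_tensor[OF tensor])
  qed
qed

text \<open>Both sides are convolution inverses of \<open>\<Delta>\<close>.\<close>

lemma comult_antipode:
  assumes a: "a \<in> carrier A"
  shows "\<Delta> (S a) = flip_antipode A S (\<Delta> a)"
proof -
  note bc = bigr_closed bigr_closed and V = mtensor_cvector_space
  interpret D: bialgebroid_map A \<Delta> \<epsilon> AA \<Delta> by (rule bialgebroid_map_comult)
  let ?F = "\<lambda>a. flip_antipode A S (\<Delta> a)"
  have S1: "clinear_on A AA (\<lambda>a. \<Delta> (S a))"
    by (rule clinear_compose[OF antipode_linear comult_clinear])
  have S1r: "\<Delta> (S (\<mu>\<^sub>r f \<otimes> x)) = \<Delta> (S x) \<otimes>\<^bsub>AA\<^esub> \<Delta> (\<mu>\<^sub>l f)" if "x \<in> carrier A" for x f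
    using that by (simp add: antipode_rmom comult_mult)
  have S2: "clinear_on A AA ?F"
    unfolding flip_antipode_def by (rule clinear_sweedler[OF V balanced_flip])
  have S2l: "?F (x \<otimes> \<mu>\<^sub>l f) = \<Delta> (\<mu>\<^sub>r f) \<otimes>\<^bsub>AA\<^esub> ?F x" if "x \<in> carrier A" for x f
    using flip_antipode_lmom[OF comult_carrier[OF that], of f] that
    by (simp add: comult_mult comult_lmom comult_rmom mtensor_lmom mtensor_rmom)
  show ?thesis
  proof (rule D.convolution_inverse_unique[OF S1 S2 S1r S2l _ _ a])
    fix \<alpha> \<beta> a assume a: "a \<in> bigr A \<alpha> \<beta>"
    note ca = comult_carrier[OF bigr_in_carrier[OF a]]
    show "lift_tensor AA (\<lambda>u v. \<Delta> (S u) \<otimes>\<^bsub>AA\<^esub> \<Delta> v) (\<Delta> a) = \<Delta> (\<mu>\<^sub>r (shift \<alpha> (\<epsilon> a 1)))"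
    proof -
      have "lift_tensor AA (\<lambda>u v. \<Delta> (S u) \<otimes>\<^bsub>AA\<^esub> \<Delta> v) (\<Delta> a) = lift_tensor AA (\<lambda>u v. \<Delta> (S u \<otimes> v)) (\<Delta> a)"
        by (rule lift_cong_carrier[OF bc V D.balanced_convolution_left[OF S1 S2 S1r S2l]
              balanced_comp[OF balanced_antipode_right comult_clinear] _ ca])
           (simp_all add: comult_mult bigr_in_carrier)
      also have "\<dots> = \<Delta> (lift_tensor A (\<lambda>u v. S u \<otimes> v) (\<Delta> a))"
        by (rule lift_comp[OF bc cvector_space V balanced_antipode_right comult_clinear ca])
      finally show ?thesis by (simp add: sum_antipode_right[OF a])
    qed
    let ?\<phi> = "\<lambda>x y w. lift_tensor AA (flip_product x y) (\<Delta> w)"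
    define E where "E w = tensor A A (component A (\<alpha> - \<beta>) 0 w) \<one>" for w
    have E: "clinear_on A AA E" unfolding E_def[abs_def] by (rule clinear_tensor_left[OF one_bigr])
    have co: "lift_tensor AA (\<lambda>x z. lift_tensor AA (\<lambda>u v. ?\<phi> u v z) (\<Delta> x)) (\<Delta> a) =
        lift_tensor AA (\<lambda>x z. lift_tensor AA (?\<phi> x) (\<Delta> z)) (\<Delta> a)"
      "balanced AA A A (\<lambda>x z. lift_tensor AA (\<lambda>u v. ?\<phi> u v z) (\<Delta> x))"
      "balanced AA A A (\<lambda>x z. lift_tensor AA (?\<phi> x) (\<Delta> z))"
      \<comment> \<open>The zero elements instantiate the variables \<open>U\<close> and
        \<open>z\<close> of the two cited balancedness claims.\<close>
      by (rule coassoc_lift[OF V _ _ bigr_in_carrier[OF a]], erule comult_flip_product(2)[rotated],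
          rule mtensor_bigr_zero[OF bc], erule sum_flip_product(2), rule bigr_zero)+
    \<comment> \<open>The sum is a1 S(a4) tensor a2 S(a3). Splitting off a1 leaves an inner sum that
      \<open>sum_flip_product\<close> evaluates, and one application of the left antipode identity
      remains.\<close>
    have "lift_tensor AA (\<lambda>u v. \<Delta> u \<otimes>\<^bsub>AA\<^esub> ?F v) (\<Delta> a) =
        lift_tensor AA (\<lambda>x z. lift_tensor AA (\<lambda>u v. ?\<phi> u v z) (\<Delta> x)) (\<Delta> a)"
      by (rule lift_cong_carrier[OF bc V D.balanced_convolution_right[OF S1 S2 S1r S2l] co(2) _ ca])
         (simp_all add: comult_flip_product(1)[OF hmod_homD(1)[OF comult_hmod_hom]])
    also have "\<dots> = lift_tensor AA (\<lambda>x z. lift_tensor AA (?\<phi> x) (\<Delta> z)) (\<Delta> a)" by (rule co(1))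
    also have "\<dots> = lift_tensor AA (\<lambda>x z. E (x \<otimes> S z)) (\<Delta> a)"
    proof (rule lift_cong[OF bc V co(3) balanced_comp[OF balanced_antipode_left E] _ hmod_homD(1)[OF comult_hmod_hom a]])
      fix \<gamma> x z assume x: "x \<in> bigr A \<alpha> \<gamma>" and z: "z \<in> bigr A \<gamma> \<beta>"
      have "x \<otimes> S z \<in> bigr A (\<alpha> - \<beta>) 0" using bigr_mult[OF x antipode_bigr[OF z]] by simp
      then show "lift_tensor AA (?\<phi> x) (\<Delta> z) = E (x \<otimes> S z)"
        by (simp add: sum_flip_product(1)[OF x z] E_def component_homogeneous)
    qed
    also have "\<dots> = E (lift_tensor A (\<lambda>x z. x \<otimes> S z) (\<Delta> a))"
      by (rule lift_comp[OF bc cvector_space V balanced_antipode_left E ca])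
    also have "\<dots> = tensor A A (component A (\<alpha> - \<beta>) 0 (\<mu>\<^sub>l (\<epsilon> a 1))) \<one>"
      by (simp add: sum_antipode_left bigr_in_carrier[OF a] E_def)
    also have "component A (\<alpha> - \<beta>) 0 (\<mu>\<^sub>l (\<epsilon> a 1)) = \<mu>\<^sub>l (\<epsilon> a 1)"
      using counit_homogeneous(2)[OF a]
      by (cases "\<alpha> = \<beta>") (auto simp: component_homogeneous[OF lmom_bigr] lmom_zero component_zero)
    finally show "lift_tensor AA (\<lambda>u v. \<Delta> u \<otimes>\<^bsub>AA\<^esub> ?F v) (\<Delta> a) = \<Delta> (\<mu>\<^sub>l (\<epsilon> a 1))"
      by (simp add: comult_lmom)
  qed
qed

end

section \<open>Antipodes from generators\<close>

locale bialgebroid_antihom = h_bialgebroid A \<Delta> \<epsilon>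
  for A :: "('v::complex_fd_space, 'a, 'm) h_alg_scheme" (structure) and \<Delta> \<epsilon> +
  fixes S :: "'a \<Rightarrow> 'a"
  assumes antihom: "alg_antihom A S"
    and S_lmom: "S (\<mu>\<^sub>l f) = \<mu>\<^sub>r f" and S_rmom: "S (\<mu>\<^sub>r f) = \<mu>\<^sub>l f"
begin

sublocale idm: bialgebroid_map A \<Delta> \<epsilon> A "\<lambda>x. x"
  by (rule bialgebroid_map_id)

lemma S_linear: "clinear_on A A S"
  using antihom by (simp add: alg_antihom_def)

lemma S_closed [simp]: "x \<in> carrier A \<Longrightarrow> S x \<in> carrier A"
  using clinear_onD[OF S_linear] by blast

lemma S_one: "S \<one> = \<one>"
  using antihom by (simp add: alg_antihom_def)

lemma S_mult: "x \<in> carrier A \<Longrightarrow> y \<in> carrier A \<Longrightarrow> S (x \<otimes> y) = S y \<otimes> S x"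
  using antihom by (simp add: alg_antihom_def)

lemma S_rmom_mult: "a \<in> carrier A \<Longrightarrow> S (\<mu>\<^sub>r f \<otimes> a) = S a \<otimes> \<mu>\<^sub>l f"
  by (simp add: S_mult S_rmom)

lemma S_mult_lmom: "a \<in> carrier A \<Longrightarrow> S (a \<otimes> \<mu>\<^sub>l f) = \<mu>\<^sub>r f \<otimes> S a"
  by (simp add: S_mult S_lmom)

lemma balanced_left: "balanced A A A (\<lambda>x y. x \<otimes> S y)"
  by (rule idm.balanced_convolution_right[OF S_linear S_linear S_rmom_mult S_mult_lmom])

lemma balanced_right: "balanced A A A (\<lambda>x y. S x \<otimes> y)"
  by (rule idm.balanced_convolution_left[OF S_linear S_linear S_rmom_mult S_mult_lmom])

text \<open>The bidegree is an argument because the right identity involves \<alpha>, and because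
  zero lies in every degree.\<close>

definition antipodal :: "'v \<Rightarrow> 'v \<Rightarrow> 'a \<Rightarrow> bool" where
  "antipodal \<alpha> \<beta> a \<longleftrightarrow> a \<in> bigr A \<alpha> \<beta> \<and> antipode_id_left A \<Delta> \<epsilon> S a \<and> antipode_id_right A \<Delta> \<epsilon> S \<alpha> a"

lemma antipodalD:
  assumes "antipodal \<alpha> \<beta> a"
  shows "a \<in> bigr A \<alpha> \<beta>" "lift_tensor A (\<lambda>x y. x \<otimes> S y) (\<Delta> a) = \<mu>\<^sub>l (\<epsilon> a 1)"
    "lift_tensor A (\<lambda>x y. S x \<otimes> y) (\<Delta> a) = \<mu>\<^sub>r (shift \<alpha> (\<epsilon> a 1))"
  using assms by (auto simp: antipodal_def antipode_id_left_def antipode_id_right_def)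

lemma antipodalI:
  assumes "a \<in> bigr A \<alpha> \<beta>" "lift_tensor A (\<lambda>x y. x \<otimes> S y) (\<Delta> a) = \<mu>\<^sub>l (\<epsilon> a 1)"
    "lift_tensor A (\<lambda>x y. S x \<otimes> y) (\<Delta> a) = \<mu>\<^sub>r (shift \<alpha> (\<epsilon> a 1))"
  shows "antipodal \<alpha> \<beta> a"
  using assms by (auto simp: antipodal_def antipode_id_left_def antipode_id_right_def)

lemmas sweedler_left = clinear_onD[OF clinear_sweedler[OF cvector_space balanced_left]]
lemmas sweedler_right = clinear_onD[OF clinear_sweedler[OF cvector_space balanced_right]]

lemma antipodal_add:
  assumes a: "antipodal \<alpha> \<beta> a" and b: "antipodal \<alpha> \<beta> b"
  shows "antipodal \<alpha> \<beta> (a \<oplus> b)"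
  using bigr_in_carrier[OF antipodalD(1)[OF a]] bigr_in_carrier[OF antipodalD(1)[OF b]]
  by (intro antipodalI bigr_add antipodalD(1)[OF a] antipodalD(1)[OF b])
     (simp_all add: sweedler_left sweedler_right antipodalD(2,3)[OF a] antipodalD(2,3)[OF b]
       counit_add lmom_add rmom_add shift_add)

lemma antipodal_smult:
  assumes a: "antipodal \<alpha> \<beta> a"
  shows "antipodal \<alpha> \<beta> (c \<odot> a)"
  using bigr_in_carrier[OF antipodalD(1)[OF a]] lmom_mult_smult[of \<one> c] rmom_mult_smult[of \<one> c]
  by (intro antipodalI bigr_smult antipodalD(1)[OF a])
     (simp_all add: sweedler_left sweedler_right antipodalD(2,3)[OF a] counit_smult shift_mult)

lemma antipodal_zero: "antipodal \<alpha> \<beta> \<zero>"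
proof (rule antipodalI[OF bigr_zero])
  have "\<epsilon> \<zero> 1 = 0" using counit_smult[of \<zero> 0] by (simp add: mero_const_zero)
  then show "lift_tensor A (\<lambda>x y. x \<otimes> S y) (\<Delta> \<zero>) = \<mu>\<^sub>l (\<epsilon> \<zero> 1)"
    "lift_tensor A (\<lambda>x y. S x \<otimes> y) (\<Delta> \<zero>) = \<mu>\<^sub>r (shift \<alpha> (\<epsilon> \<zero> 1))"
    using clinear_on_zero[OF clinear_sweedler[OF cvector_space balanced_left] cvector_space cvector_space]
      clinear_on_zero[OF clinear_sweedler[OF cvector_space balanced_right] cvector_space cvector_space]
    by (simp_all add: lmom_zero rmom_zero)
qed

lemma antipodal_one: "antipodal 0 0 \<one>"
proof (rule antipodalI[OF one_bigr])
  note L = tensor_liftI[OF bigr_closed bigr_closed cvector_space]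
  show "lift_tensor A (\<lambda>x y. x \<otimes> S y) (\<Delta> \<one>) = \<mu>\<^sub>l (\<epsilon> \<one> 1)"
    using tensor_lift.lift_tensor_tensor[OF L[OF balanced_left] one_bigr one_bigr]
    by (simp add: comult_one counit_one S_one lmom_one)
  show "lift_tensor A (\<lambda>x y. S x \<otimes> y) (\<Delta> \<one>) = \<mu>\<^sub>r (shift 0 (\<epsilon> \<one> 1))"
    using tensor_lift.lift_tensor_tensor[OF L[OF balanced_right] one_bigr one_bigr]
    by (simp add: comult_one counit_one S_one rmom_one)
qed

text \<open>As \<open>S\<close> reverses products, the sum for \<open>a \<otimes> b\<close> is
  nested: the pair of \<open>b\<close> is innermost in the left identity, that of \<open>a\<close>
  in the right one, where the two sums must first be exchanged. The inner sum is a moment, which is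
  moved outwards past the remaining factors.\<close>

lemma antipodal_mult:
  assumes ga: "antipodal \<alpha> \<beta> a" and gb: "antipodal \<gamma> \<delta> b"
  shows "antipodal (\<alpha> + \<gamma>) (\<beta> + \<delta>) (a \<otimes> b)"
proof -
  note a = antipodalD(1)[OF ga] and b = antipodalD(1)[OF gb]
  note ac = bigr_in_carrier[OF a] and bcar = bigr_in_carrier[OF b]
  note ca = comult_carrier[OF ac] and cb = comult_carrier[OF bcar]
  note bc = bigr_closed bigr_closed and V = cvector_space
  have e: "\<epsilon> (a \<otimes> b) 1 = \<epsilon> a 1 * shift (- \<beta>) (\<epsilon> b 1)" by (rule counit_mult_one[OF a bcar])
  have ea: "\<alpha> = \<beta> \<or> \<epsilon> a 1 = 0" and eb: "\<gamma> = \<delta> \<or> \<epsilon> b 1 = 0"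
    using counit_homogeneous(2)[OF a] counit_homogeneous(2)[OF b] by (cases "\<alpha> = \<beta>"; cases "\<gamma> = \<delta>"; simp)+
  have lin: "clinear_on A A (\<lambda>w. x \<otimes> w \<otimes> y)" if "x \<in> carrier A" "y \<in> carrier A" for x y
    by (rule clinear_compose[OF idm.M.clinear_mult_left idm.M.clinear_mult_right]) (rule that)+
  show ?thesis
  proof (rule antipodalI[OF bigr_mult[OF a b]])
    let ?\<Phi> = "\<lambda>x y x' y'. (x \<otimes> x') \<otimes> S (y \<otimes> y')"
    note h = balanced_mult[OF balanced_left]
    have "lift_tensor A (\<lambda>x y. x \<otimes> S y) (\<Delta> (a \<otimes> b)) = lift_tensor A (\<lambda>x y. x \<otimes> S y) (\<Delta> a \<otimes>\<^bsub>AA\<^esub> \<Delta> b)"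
      by (simp add: comult_mult ac bcar)
    also have "\<dots> = lift_tensor A (\<lambda>x y. lift_tensor A (?\<Phi> x y) (\<Delta> b)) (\<Delta> a)"
      by (rule lift_mult[OF V balanced_left ca cb])
    also have "\<dots> = lift_tensor A (\<lambda>x y. \<mu>\<^sub>l (shift (- \<alpha>) (\<epsilon> b 1)) \<otimes> (x \<otimes> S y)) (\<Delta> a)"
    proof (rule lift_cong[OF bc V balanced_lift_param[OF V h cb]
          balanced_comp[OF balanced_left idm.M.clinear_mult_left[OF lmom_carrier]] _ hmod_homD(1)[OF comult_hmod_hom a]])
      fix \<eta> x y assume x: "x \<in> bigr A \<alpha> \<eta>" and y: "y \<in> bigr A \<eta> \<beta>"
      note xy = bigr_in_carrier[OF x] bigr_in_carrier[OF y]
      have Sy: "S y \<in> carrier A" using xy by simp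
      have "lift_tensor A (?\<Phi> x y) (\<Delta> b) = lift_tensor A (\<lambda>x' y'. x \<otimes> (x' \<otimes> S y') \<otimes> S y) (\<Delta> b)"
        by (rule lift_cong_carrier[OF bc V h(1)[OF x y] balanced_comp[OF balanced_left lin[OF xy(1) Sy]] _ cb])
           (simp add: xy S_mult m_assoc bigr_in_carrier)
      also have "\<dots> = x \<otimes> lift_tensor A (\<lambda>x' y'. x' \<otimes> S y') (\<Delta> b) \<otimes> S y"
        by (rule lift_comp[OF bc V V balanced_left lin[OF xy(1) Sy] cb])
      finally show "lift_tensor A (?\<Phi> x y) (\<Delta> b) = \<mu>\<^sub>l (shift (- \<alpha>) (\<epsilon> b 1)) \<otimes> (x \<otimes> S y)"
        using xy by (simp add: antipodalD(2)[OF gb] lmom_comm'[OF x] m_assoc)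
    qed
    also have "\<dots> = \<mu>\<^sub>l (shift (- \<alpha>) (\<epsilon> b 1)) \<otimes> lift_tensor A (\<lambda>x y. x \<otimes> S y) (\<Delta> a)"
      by (rule lift_comp[OF bc V V balanced_left idm.M.clinear_mult_left[OF lmom_carrier] ca])
    also have "\<dots> = \<mu>\<^sub>l (\<epsilon> (a \<otimes> b) 1)"
      using ea by (auto simp: antipodalD(2)[OF ga] e mult.commute simp flip: lmom_mult)
    finally show "lift_tensor A (\<lambda>x y. x \<otimes> S y) (\<Delta> (a \<otimes> b)) = \<mu>\<^sub>l (\<epsilon> (a \<otimes> b) 1)" .
  next
    let ?\<Phi> = "\<lambda>x y x' y'. S (x \<otimes> x') \<otimes> (y \<otimes> y')"
    note h = balanced_mult[OF balanced_right]
    \<comment> \<open>The shift \<alpha> comes from the right identity for \<open>a\<close>; moving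
      the moment past \<open>y'\<close> of right degree \<delta> adds \<delta>.\<close>
    let ?m = "\<mu>\<^sub>r (shift (\<alpha> + \<delta>) (\<epsilon> a 1))"
    have "lift_tensor A (\<lambda>x y. S x \<otimes> y) (\<Delta> (a \<otimes> b)) = lift_tensor A (\<lambda>x y. S x \<otimes> y) (\<Delta> a \<otimes>\<^bsub>AA\<^esub> \<Delta> b)"
      by (simp add: comult_mult ac bcar)
    also have "\<dots> = lift_tensor A (\<lambda>x y. lift_tensor A (?\<Phi> x y) (\<Delta> b)) (\<Delta> a)"
      by (rule lift_mult[OF V balanced_right ca cb])
    also have "\<dots> = lift_tensor A (\<lambda>x' y'. lift_tensor A (\<lambda>x y. ?\<Phi> x y x' y') (\<Delta> a)) (\<Delta> b)"
      by (rule lift_swap[OF V h ca cb])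
    also have "\<dots> = lift_tensor A (\<lambda>x' y'. (S x' \<otimes> y') \<otimes> ?m) (\<Delta> b)"
    proof (rule lift_cong[OF bc V balanced_lift_param[OF V, of "\<lambda>x' y' x y. ?\<Phi> x y x' y'", OF h(2,1) ca]
          balanced_comp[OF balanced_right idm.M.clinear_mult_right[OF rmom_carrier]] _ hmod_homD(1)[OF comult_hmod_hom b]])
      fix \<eta> x' y' assume x': "x' \<in> bigr A \<gamma> \<eta>" and y': "y' \<in> bigr A \<eta> \<delta>"
      note xy = bigr_in_carrier[OF x'] bigr_in_carrier[OF y']
      have Sx: "S x' \<in> carrier A" using xy by simp
      have "lift_tensor A (\<lambda>x y. ?\<Phi> x y x' y') (\<Delta> a) = lift_tensor A (\<lambda>x y. S x' \<otimes> (S x \<otimes> y) \<otimes> y') (\<Delta> a)"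
        by (rule lift_cong_carrier[OF bc V h(2)[OF x' y'] balanced_comp[OF balanced_right lin[OF Sx xy(2)]] _ ca])
           (simp add: xy S_mult m_assoc bigr_in_carrier)
      also have "\<dots> = S x' \<otimes> lift_tensor A (\<lambda>x y. S x \<otimes> y) (\<Delta> a) \<otimes> y'"
        by (rule lift_comp[OF bc V V balanced_right lin[OF Sx xy(2)] ca])
      finally show "lift_tensor A (\<lambda>x y. ?\<Phi> x y x' y') (\<Delta> a) = (S x' \<otimes> y') \<otimes> ?m"
        using xy by (simp add: antipodalD(3)[OF ga] rmom_comm[OF y'] m_assoc shift_shift add.commute)
    qed
    also have "\<dots> = lift_tensor A (\<lambda>x y. S x \<otimes> y) (\<Delta> b) \<otimes> ?m"
      by (rule lift_comp[OF bc V V balanced_right idm.M.clinear_mult_right[OF rmom_carrier] cb])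
    also have "\<dots> = \<mu>\<^sub>r (shift \<gamma> (\<epsilon> b 1) * shift (\<alpha> + \<delta>) (\<epsilon> a 1))"
      by (simp add: antipodalD(3)[OF gb] rmom_mult)
    \<comment> \<open>The shifts on the two sides differ by \<gamma> - \<delta> at the first
      coefficient and by \<alpha> - \<beta> at the second; each difference is zero unless the
      product vanishes.\<close>
    also have "shift \<gamma> (\<epsilon> b 1) * shift (\<alpha> + \<delta>) (\<epsilon> a 1) = shift (\<alpha> + \<gamma>) (\<epsilon> (a \<otimes> b) 1)"
      using ea eb by (auto simp: e shift_mult shift_shift)
    finally show "lift_tensor A (\<lambda>x y. S x \<otimes> y) (\<Delta> (a \<otimes> b)) = \<mu>\<^sub>r (shift (\<alpha> + \<gamma>) (\<epsilon> (a \<otimes> b) 1))" .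
  qed
qed

text \<open>Stated by components, since the right identity makes sense only in a fixed degree; in
  this form the elements are closed under sums of unlike degrees.\<close>

definition all_antipodal :: "'a \<Rightarrow> bool" where
  "all_antipodal x \<longleftrightarrow> x \<in> carrier A \<and> (\<forall>\<alpha> \<beta>. antipodal \<alpha> \<beta> (component A \<alpha> \<beta> x))"

lemma all_antipodal_homogeneous: "antipodal \<alpha> \<beta> x \<Longrightarrow> all_antipodal x"
  using component_homogeneous[OF antipodalD(1)]
  by (auto simp: all_antipodal_def antipodal_zero intro: bigr_in_carrier antipodalD(1))

lemma all_antipodal_add: "all_antipodal x \<Longrightarrow> all_antipodal y \<Longrightarrow> all_antipodal (x \<oplus> y)"
  by (simp add: all_antipodal_def component_add antipodal_add)

lemma all_antipodal_smult: "all_antipodal x \<Longrightarrow> all_antipodal (c \<odot> x)"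
  by (simp add: all_antipodal_def component_smult antipodal_smult)

text \<open>Distributivity reduces both factors to their components, one factor at a time, so no
  formula for the components of a product is required.\<close>

lemma all_antipodal_mult:
  assumes x: "all_antipodal x" and y: "all_antipodal y"
  shows "all_antipodal (x \<otimes> y)"
proof -
  have xc: "x \<in> carrier A" and yc: "y \<in> carrier A" using x y by (auto simp: all_antipodal_def)
  have z: "all_antipodal \<zero>" by (rule all_antipodal_homogeneous[OF antipodal_zero])
  have 1: "all_antipodal (a \<otimes> y)" if a: "antipodal \<alpha> \<beta> a" for a \<alpha> \<beta>
    using yc
  proof (rule components_induct)
    have ac: "a \<in> carrier A" by (rule bigr_in_carrier[OF antipodalD(1)[OF a]])
    show "all_antipodal (a \<otimes> \<zero>)" using ac z by simp
    show "all_antipodal (a \<otimes> component A \<gamma> \<delta> y)" for \<gamma> \<delta>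
      using y by (intro all_antipodal_homogeneous[OF antipodal_mult[OF a, of \<gamma> \<delta>]]) (simp add: all_antipodal_def)
    show "all_antipodal (a \<otimes> (u \<oplus> v))" if "u \<in> carrier A" "v \<in> carrier A"
      "all_antipodal (a \<otimes> u)" "all_antipodal (a \<otimes> v)" for u v
      using that ac by (simp add: r_distr all_antipodal_add)
  qed
  show ?thesis using xc
  proof (rule components_induct)
    show "all_antipodal (\<zero> \<otimes> y)" using yc z by simp
    show "all_antipodal (component A \<gamma> \<delta> x \<otimes> y)" for \<gamma> \<delta>
      using x by (intro 1[of \<gamma> \<delta>]) (simp add: all_antipodal_def)
    show "all_antipodal ((u \<oplus> v) \<otimes> y)" if "u \<in> carrier A" "v \<in> carrier A"
      "all_antipodal (u \<otimes> y)" "all_antipodal (v \<otimes> y)" for u v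
      using that yc by (simp add: l_distr all_antipodal_add)
  qed
qed

lemma all_antipodal_alg_gen:
  assumes "\<And>x. x \<in> X \<Longrightarrow> all_antipodal x" and "x \<in> alg_gen A X"
  shows "all_antipodal x"
  using assms(2)
  by (induction rule: alg_gen.induct)
     (auto intro: assms(1) all_antipodal_homogeneous[OF antipodal_one] all_antipodal_add all_antipodal_mult
       all_antipodal_smult)

text \<open>The left identity is additive and independent of degrees, so it passes from components
  to all of \<open>A\<close>; the right one is demanded of homogeneous elements, each of which is
  its own component.\<close>

lemma hopf_algebroidI:
  assumes X: "X \<subseteq> carrier A" and gen: "alg_gen A X = carrier A"
    and id: "\<And>x \<alpha> \<beta>. x \<in> X \<Longrightarrow> antipode_id_left A \<Delta> \<epsilon> S (component A \<alpha> \<beta> x) \<and>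
      antipode_id_right A \<Delta> \<epsilon> S \<alpha> (component A \<alpha> \<beta> x)"
  shows "h_hopf_algebroid A \<Delta> \<epsilon> S"
proof -
  have "all_antipodal x" if "x \<in> X" for x
    using that X id by (auto simp: all_antipodal_def antipodal_def component_bigr)
  then have all: "all_antipodal x" if "x \<in> carrier A" for x
    using all_antipodal_alg_gen[of X x] gen that by simp
  have left: "antipode_id_left A \<Delta> \<epsilon> S a" if a: "a \<in> carrier A" for a
    using a
  proof (rule components_induct)
    show "antipode_id_left A \<Delta> \<epsilon> S \<zero>" using antipodal_zero[of 0 0] by (simp add: antipodal_def)
    show "antipode_id_left A \<Delta> \<epsilon> S (component A \<alpha> \<beta> a)" for \<alpha> \<beta>
      using all[OF a] by (simp add: all_antipodal_def antipodal_def)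
    show "antipode_id_left A \<Delta> \<epsilon> S (u \<oplus> v)" if "u \<in> carrier A" "v \<in> carrier A"
      "antipode_id_left A \<Delta> \<epsilon> S u" "antipode_id_left A \<Delta> \<epsilon> S v" for u v
      using that by (simp add: antipode_id_left_def sweedler_left counit_add lmom_add)
  qed
  have right: "antipode_id_right A \<Delta> \<epsilon> S \<alpha> a" if a: "a \<in> bigr A \<alpha> \<beta>" for a \<alpha> \<beta>
  proof -
    have "antipodal \<alpha> \<beta> (component A \<alpha> \<beta> a)" using all[OF bigr_in_carrier[OF a]] by (simp add: all_antipodal_def)
    then show ?thesis by (simp add: component_homogeneous[OF a] antipodal_def)
  qed
  show ?thesis
    by (intro h_hopf_algebroid.intro h_bialgebroid_axioms h_hopf_algebroid_axioms.intro S_linear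
        S_rmom_mult S_mult_lmom left right)
qed

end

theorem proposition2p2:
  fixes A :: "('v::complex_fd_space, 'a) h_alg"
    and \<Delta> :: "'a \<Rightarrow> ('a \<times> 'a \<Rightarrow>\<^sub>0 complex) set"
    and \<epsilon> :: "'a \<Rightarrow> 'v diff_op"
  shows
    "(\<forall>S. h_hopf_algebroid A \<Delta> \<epsilon> S \<longrightarrow>
        (\<forall>S'. h_hopf_algebroid A \<Delta> \<epsilon> S' \<longrightarrow> (\<forall>a\<in>carrier A. S' a = S a)) \<and>
        (\<forall>\<alpha> \<beta>. S ` bigr A \<alpha> \<beta> \<subseteq> bigr A (- \<beta>) (- \<alpha>)) \<and>
        (\<forall>a\<in>carrier A. \<forall>b\<in>carrier A. S (a \<otimes>\<^bsub>A\<^esub> b) = S b \<otimes>\<^bsub>A\<^esub> S a) \<and>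
        (\<forall>a\<in>carrier A. \<Delta> (S a) = flip_antipode A S (\<Delta> a)) \<and>
        S \<one>\<^bsub>A\<^esub> = \<one>\<^bsub>A\<^esub> \<and>
        (\<forall>a\<in>carrier A. \<epsilon> (S a) = diff_antipode (\<epsilon> a)) \<and>
        (\<forall>f. S (\<mu>\<^sub>l\<^bsub>A\<^esub> f) = \<mu>\<^sub>r\<^bsub>A\<^esub> f) \<and>
        (\<forall>f. S (\<mu>\<^sub>r\<^bsub>A\<^esub> f) = \<mu>\<^sub>l\<^bsub>A\<^esub> f)) \<and>
     (\<forall>X S. h_bialgebroid A \<Delta> \<epsilon> \<and> X \<subseteq> carrier A \<and> alg_gen A X = carrier A \<and>
        alg_antihom A S \<and>
        (\<forall>f. S (\<mu>\<^sub>l\<^bsub>A\<^esub> f) = \<mu>\<^sub>r\<^bsub>A\<^esub> f) \<and>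
        (\<forall>f. S (\<mu>\<^sub>r\<^bsub>A\<^esub> f) = \<mu>\<^sub>l\<^bsub>A\<^esub> f) \<and>
        (\<forall>x\<in>X. \<forall>\<alpha> \<beta>. antipode_id_left A \<Delta> \<epsilon> S (component A \<alpha> \<beta> x) \<and>
                        antipode_id_right A \<Delta> \<epsilon> S \<alpha> (component A \<alpha> \<beta> x)) \<longrightarrow>
        h_hopf_algebroid A \<Delta> \<epsilon> S)"
proof (intro conjI allI impI)
  fix S assume "h_hopf_algebroid A \<Delta> \<epsilon> S"
  then interpret h_hopf_algebroid A \<Delta> \<epsilon> S .
  show "\<forall>a\<in>carrier A. S' a = S a" if "h_hopf_algebroid A \<Delta> \<epsilon> S'" for S'
  proof -
    interpret S': h_hopf_algebroid A \<Delta> \<epsilon> S' by (rule that)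
    show ?thesis
      by (intro ballI antipode_unique S'.antipode_linear S'.antipode_rmom S'.sum_antipode_right)
  qed
  show "S ` bigr A \<alpha> \<beta> \<subseteq> bigr A (- \<beta>) (- \<alpha>)" for \<alpha> \<beta> using antipode_bigr by blast
  show "\<forall>a\<in>carrier A. \<forall>b\<in>carrier A. S (a \<otimes>\<^bsub>A\<^esub> b) = S b \<otimes>\<^bsub>A\<^esub> S a" using antipode_mult by blast
  show "\<forall>a\<in>carrier A. \<Delta> (S a) = flip_antipode A S (\<Delta> a)" using comult_antipode by blast
  show "S \<one>\<^bsub>A\<^esub> = \<one>\<^bsub>A\<^esub>" by (rule antipode_one)
  show "\<forall>a\<in>carrier A. \<epsilon> (S a) = diff_antipode (\<epsilon> a)" using counit_antipode by blast
  show "S (\<mu>\<^sub>l\<^bsub>A\<^esub> f) = \<mu>\<^sub>r\<^bsub>A\<^esub> f" "S (\<mu>\<^sub>r\<^bsub>A\<^esub> f) = \<mu>\<^sub>l\<^bsub>A\<^esub> f" for f by (rule antipode_mom)+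
next
  fix X S
  assume H: "h_bialgebroid A \<Delta> \<epsilon> \<and> X \<subseteq> carrier A \<and> alg_gen A X = carrier A \<and>
        alg_antihom A S \<and>
        (\<forall>f. S (\<mu>\<^sub>l\<^bsub>A\<^esub> f) = \<mu>\<^sub>r\<^bsub>A\<^esub> f) \<and>
        (\<forall>f. S (\<mu>\<^sub>r\<^bsub>A\<^esub> f) = \<mu>\<^sub>l\<^bsub>A\<^esub> f) \<and>
        (\<forall>x\<in>X. \<forall>\<alpha> \<beta>. antipode_id_left A \<Delta> \<epsilon> S (component A \<alpha> \<beta> x) \<and>
                        antipode_id_right A \<Delta> \<epsilon> S \<alpha> (component A \<alpha> \<beta> x))"
  then interpret bialgebroid_antihom A \<Delta> \<epsilon> S
    by (simp add: bialgebroid_antihom_def bialgebroid_antihom_axioms_def)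
  show "h_hopf_algebroid A \<Delta> \<epsilon> S" using H by (intro hopf_algebroidI[of X]) auto
qed

end
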